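(* Assume $\sigma_L^2=\sigma_R^2=:\sigma^2>0$. Let $c\in\mathbb{R}$ and let $\varphi:\mathbb{R}\to\mathbb{R}$ be continuous with finite limits at $\pm\infty$, symmetric with centre $c$ (i.e. $\varphi(x+c)=\varphi(-x+c)$ for all $x\in\mathbb{R}$), and monotone on $(c,\infty)$. Then the strategies $\{\theta^{n,c}\}$ are asymptotically optimal in the following sense. (1) If $\varphi$ is decreasing on $(c,\infty)$ and $(\mu_L,\mu_R)=(\overline{\mu},\underline{\mu})$, then $$\lim_{n\to\infty}E_P\left[\varphi\left(T_{n,n}^{\theta^{n,c}}\right)\right]=\lim_{n\to\infty}\sup_{\theta\in\Theta}E_P\left[\varphi\left(T_{n,n}^{\theta}\right)\right]=E_P[\varphi(\eta_1)],\qquad \eta_1\sim\mathcal{B}\left(\tfrac{\underline{\mu}-\overline{\mu}}{2},\tfrac{\overline{\mu}+\underline{\mu}}{2},c\right).$$ (2) If $\varphi$ is increasing on $(c,\infty)$ and $(\mu_L,\mu_R)=(\underline{\mu},\overline{\mu})$, then $$\lim_{n\to\infty}E_P\left[\varphi\left(T_{n,n}^{\theta^{n,c}}\right)\right]=\lim_{n\to\infty}\sup_{\theta\in\Theta}E_P\left[\varphi\left(T_{n,n}^{\theta}\right)\right]=E_P[\varphi(\eta_2)],\qquad \eta_2\sim\mathcal{B}\left(\tfrac{\overline{\mu}-\underline{\mu}}{2},\tfrac{\overline{\mu}+\underline{\mu}}{2},c\right).$$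
   Context: Setting (two-armed bandit). Let $(\Omega,\mathcal{F},P)$ be a probability space and $W^L,W^R$ real random variables with finite means $\mu_L,\mu_R$ and finite variances $\sigma_L^2,\sigma_R^2$. Let $\{W_i^L\}_{i\ge1}$ and $\{W_i^R\}_{i\ge1}$ be sequences of i.i.d. copies of $W^L$ and $W^R$ respectively, the two sequences being independent of each other. Put $\overline{\mu}=\max\{\mu_L,\mu_R\}$, $\underline{\mu}=\min\{\mu_L,\mu_R\}$. A sampling strategy is a sequence $\theta=(\vartheta_1,\vartheta_2,\dots)$ of $\{1,2\}$-valued random variables; the reward at round $i$ is $Z_i^{\theta}=W_i^L$ if $\vartheta_i=1$ and $Z_i^\theta=W_i^R$ if $\vartheta_i=2$. Let $\mathcal{H}_n^{\theta}=\sigma\{Z_1^{\theta},\dots,Z_n^{\theta}\}$, $\mathcal{H}_0^{\theta}=\{\emptyset,\Omega\}$. The strategy $\theta$ is admissible if $\vartheta_n$ is $\mathcal{H}_{n-1}^{\theta}$-measurable for all $n\ge1$; $\Theta$ is the set of all admissible strategies. With $\sigma$ the common standard deviation, for $\theta\in\Theta$, $n\ge1$ and $1\le m\le n$, $$T_{m,n}^{\theta}=\frac1n\sum_{i=1}^{m}Z_i^{\theta}+\frac1{\sqrt n}\sum_{i=1}^{m}\frac1\sigma\left(Z_i^{\theta}-E_P[Z_i^{\theta}|\mathcal{H}_{i-1}^{\theta}]\right),\qquad T_{0,n}^{\theta}=0.$$ For $n\ge1$, $c\in\mathbb{R}$, the strategy $\theta^{n,c}=(\vartheta_1^{n,c},\vartheta_2^{n,c},\dots)$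 is defined recursively: $\vartheta_m^{n,c}=1$ if $T_{m-1,n}^{\theta^{n,c}}\le c-\left(1-\frac{m-1}{n}\right)\frac{\overline{\mu}+\underline{\mu}}{2}$, and $\vartheta_m^{n,c}=2$ otherwise (only rounds $m\le n$ matter here). Bandit distribution: $\eta\sim\mathcal{B}(\alpha,\beta,c)$, $(\alpha,\beta,c)\in\mathbb{R}^3$, means that $\eta$ has density $$f^{\alpha,\beta,c}(y)=\frac1{\sqrt{2\pi}}e^{-\frac{(y-\beta)^2-2\alpha(|y-c|-|c-\beta|)+\alpha^2}{2}}-\alpha e^{2\alpha|y-c|}\,\Phi(-|c-\beta|-|y-c|-\alpha),$$ where $\Phi$ is the standard normal distribution function. *)

theory Defs
  imports "HOL-Probability.Probability"
begin

text \<open>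
  Rounds are numbered from 1; the values of all sequences at index 0 are irrelevant.
  Arm 1 is the left arm, arm 2 the right arm.
\<close>

definition reward ::
    "(nat \<Rightarrow> 'a \<Rightarrow> real) \<Rightarrow> (nat \<Rightarrow> 'a \<Rightarrow> real) \<Rightarrow> (nat \<Rightarrow> 'a \<Rightarrow> nat) \<Rightarrow> nat \<Rightarrow> 'a \<Rightarrow> real" where
  "reward WL WR \<theta> i \<omega> = (if \<theta> i \<omega> = 1 then WL i \<omega> else WR i \<omega>)"

definition history ::
    "'a measure \<Rightarrow> (nat \<Rightarrow> 'a \<Rightarrow> real) \<Rightarrow> (nat \<Rightarrow> 'a \<Rightarrow> real) \<Rightarrow> (nat \<Rightarrow> 'a \<Rightarrow> nat) \<Rightarrow> nat \<Rightarrow> 'a measure"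
  where
  "history M WL WR \<theta> n =
     sigma (space M)
       (\<Union>i\<in>{1..n}. {reward WL WR \<theta> i -` A \<inter> space M | A. A \<in> sets borel})"

definition sampling_strategy :: "'a measure \<Rightarrow> (nat \<Rightarrow> 'a \<Rightarrow> nat) \<Rightarrow> bool" where
  "sampling_strategy M \<theta> \<longleftrightarrow> (\<forall>n\<ge>1. \<theta> n \<in> measurable M (count_space {1, 2}))"

definition admissible_strategies ::
    "'a measure \<Rightarrow> (nat \<Rightarrow> 'a \<Rightarrow> real) \<Rightarrow> (nat \<Rightarrow> 'a \<Rightarrow> real) \<Rightarrow> (nat \<Rightarrow> 'a \<Rightarrow> nat) set" where
  "admissible_strategies M WL WR =
     {\<theta>. sampling_strategy M \<theta> \<and>
         (\<forall>n\<ge>1. \<theta> n \<in> measurable (history M WL WR \<theta> (n - 1)) (count_space {1, 2}))}"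

definition T_stat ::
    "'a measure \<Rightarrow> real \<Rightarrow> (nat \<Rightarrow> 'a \<Rightarrow> real) \<Rightarrow> (nat \<Rightarrow> 'a \<Rightarrow> real) \<Rightarrow> (nat \<Rightarrow> 'a \<Rightarrow> nat)
      \<Rightarrow> nat \<Rightarrow> nat \<Rightarrow> 'a \<Rightarrow> real" where
  "T_stat M \<sigma> WL WR \<theta> m n \<omega> =
     1 / real n * (\<Sum>i=1..m. reward WL WR \<theta> i \<omega>)
     + 1 / sqrt (real n) *
       (\<Sum>i=1..m. 1 / \<sigma> *
          (reward WL WR \<theta> i \<omega>
           - real_cond_exp M (history M WL WR \<theta> (i - 1)) (reward WL WR \<theta> i) \<omega>))"

text \<open>
  The choice at round \<open>m\<close> depends on \<open>T\<^bsub>m-1,n\<^esub>\<close> of the strategy being defined, hence only on its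
  first \<open>m - 1\<close> entries. The recursion therefore builds strategies whose entries up to index
  \<open>m\<close> are final (the remaining entries being a dummy 1), and \<open>\<theta>\<^bsup>n,c\<^esup>\<close> is the diagonal. The
  defining recursion of \<open>\<theta>\<^bsup>n,c\<^esup>\<close> is the lemma \<open>threshold_strategy_rec\<close> below.
  The arguments \<open>\<mu>u\<close>, \<open>\<mu>l\<close> are the larger and the smaller mean.
\<close>

primrec threshold_strategy_upto ::
    "'a measure \<Rightarrow> real \<Rightarrow> (nat \<Rightarrow> 'a \<Rightarrow> real) \<Rightarrow> (nat \<Rightarrow> 'a \<Rightarrow> real) \<Rightarrow> real \<Rightarrow> real \<Rightarrow> nat \<Rightarrow> real
      \<Rightarrow> nat \<Rightarrow> (nat \<Rightarrow> 'a \<Rightarrow> nat)" where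
  "threshold_strategy_upto M \<sigma> WL WR \<mu>u \<mu>l n c 0 = (\<lambda>i \<omega>. 1)"
| "threshold_strategy_upto M \<sigma> WL WR \<mu>u \<mu>l n c (Suc m) =
     (let \<theta> = threshold_strategy_upto M \<sigma> WL WR \<mu>u \<mu>l n c m in
      \<theta>(Suc m := (\<lambda>\<omega>.
        if T_stat M \<sigma> WL WR \<theta> m n \<omega> \<le> c - (1 - real m / real n) * ((\<mu>u + \<mu>l) / 2)
        then 1 else 2)))"

definition threshold_strategy ::
    "'a measure \<Rightarrow> real \<Rightarrow> (nat \<Rightarrow> 'a \<Rightarrow> real) \<Rightarrow> (nat \<Rightarrow> 'a \<Rightarrow> real) \<Rightarrow> real \<Rightarrow> real \<Rightarrow> nat \<Rightarrow> real
      \<Rightarrow> nat \<Rightarrow> 'a \<Rightarrow> nat" where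
  "threshold_strategy M \<sigma> WL WR \<mu>u \<mu>l n c m = threshold_strategy_upto M \<sigma> WL WR \<mu>u \<mu>l n c m m"

lemma reward_cong: "\<theta> i = \<theta>' i \<Longrightarrow> reward WL WR \<theta> i = reward WL WR \<theta>' i"
  by (simp add: reward_def fun_eq_iff)

lemma history_cong:
  assumes "\<And>i. 1 \<le> i \<Longrightarrow> i \<le> n \<Longrightarrow> \<theta> i = \<theta>' i"
  shows "history M WL WR \<theta> n = history M WL WR \<theta>' n"
proof -
  have "reward WL WR \<theta> i = reward WL WR \<theta>' i" if "i \<in> {1..n}" for i
    using assms that by (intro reward_cong) auto
  then show ?thesis
    unfolding history_def by (intro arg_cong[where f = "sigma (space M)"] SUP_cong) auto
qed

lemma T_stat_cong:
  assumes "\<And>i. 1 \<le> i \<Longrightarrow> i \<le> m \<Longrightarrow> \<theta> i = \<theta>' i"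
  shows "T_stat M \<sigma> WL WR \<theta> m n = T_stat M \<sigma> WL WR \<theta>' m n"
proof -
  have 1: "reward WL WR \<theta> i = reward WL WR \<theta>' i" if "i \<in> {1..m}" for i
    using assms that by (intro reward_cong) auto
  have 2: "history M WL WR \<theta> (i - 1) = history M WL WR \<theta>' (i - 1)" if "i \<in> {1..m}" for i
    using assms that by (intro history_cong) auto
  show ?thesis
    unfolding T_stat_def fun_eq_iff using 1 2
    by (auto intro!: arg_cong2[where f = "(+)"] arg_cong2[where f = "(*)"] sum.cong
        simp del: One_nat_def)
qed

lemma threshold_strategy_upto_eq:
  assumes "i \<le> m"
  shows "threshold_strategy_upto M \<sigma> WL WR \<mu>u \<mu>l n c m i
         = threshold_strategy M \<sigma> WL WR \<mu>u \<mu>l n c i"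
  using assms
proof (induction m)
  case 0
  then show ?case by (simp add: threshold_strategy_def)
next
  case (Suc m)
  then show ?case
    by (cases "i = Suc m") (auto simp: threshold_strategy_def Let_def)
qed

lemma threshold_strategy_rec:
  assumes "m \<ge> 1"
  shows "threshold_strategy M \<sigma> WL WR \<mu>u \<mu>l n c m \<omega> =
    (if T_stat M \<sigma> WL WR (threshold_strategy M \<sigma> WL WR \<mu>u \<mu>l n c) (m - 1) n \<omega>
        \<le> c - (1 - real (m - 1) / real n) * ((\<mu>u + \<mu>l) / 2)
     then 1 else 2)"
proof -
  obtain k where k: "m = Suc k" using assms by (cases m) auto
  have "T_stat M \<sigma> WL WR (threshold_strategy_upto M \<sigma> WL WR \<mu>u \<mu>l n c k) k n
      = T_stat M \<sigma> WL WR (threshold_strategy M \<sigma> WL WR \<mu>u \<mu>l n c) k n"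
    by (intro T_stat_cong threshold_strategy_upto_eq)
  then show ?thesis
    unfolding k threshold_strategy_def[of _ _ _ _ _ _ _ _ "Suc k"] by (simp add: Let_def)
qed

definition bandit_density :: "real \<Rightarrow> real \<Rightarrow> real \<Rightarrow> real \<Rightarrow> real" where
  "bandit_density \<alpha> \<beta> c y =
     1 / sqrt (2 * pi)
       * exp (- ((y - \<beta>)\<^sup>2 - 2 * \<alpha> * (\<bar>y - c\<bar> - \<bar>c - \<beta>\<bar>) + \<alpha>\<^sup>2) / 2)
     - \<alpha> * exp (2 * \<alpha> * \<bar>y - c\<bar>)
       * cdf std_normal_distribution (- \<bar>c - \<beta>\<bar> - \<bar>y - c\<bar> - \<alpha>)"

definition bandit_distributed ::
    "'b measure \<Rightarrow> ('b \<Rightarrow> real) \<Rightarrow> real \<Rightarrow> real \<Rightarrow> real \<Rightarrow> bool" where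
  "bandit_distributed N \<eta> \<alpha> \<beta> c \<longleftrightarrow>
     distributed N lborel \<eta> (\<lambda>y. ennreal (bandit_density \<alpha> \<beta> c y))"

end

(*
  Put beta = (mu_u + mu_l) / 2 and S_m = T_{m,n} + (1 - m/n) beta - c. Relative to beta the two arms have
  drifts -a and a, so under the threshold strategy S behaves like a diffusion with drift a sgn(S), and
  |S| like a reflected Brownian motion with drift a. The distribution function of the latter,
  v(t, x) = P(|S_t| <= y | S_0 = x), is explicit (refl_val below). It solves
  v_t = v_xx / 2 + a sgn(x) v_x, is smooth enough for t > 0 and decreases in |x|. Lindeberg's
  replacement argument applied to v(t_m, S_m) therefore shows that the expectation of v(0+, S_n)
  converges to v(1, beta - c) for the threshold strategy and is asymptotically on the correct side of
  it, uniformly over all admissible strategies. A function phi that is symmetric about c and monotone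
  on each side is uniformly approximated by combinations of the functions v(0+, .) with coefficients of one sign,
  and y -> v(1, beta - c) turns out to be the distribution function of |eta - c|.
*)

theory Submission
  imports Defs "HOL-Real_Asymp.Real_Asymp"
begin

text \<open>Two things obstruct a second-order expansion: the feedback drift a sgn(x) jumps at 0,
  and v(0+, .) is an indicator. The first is harmless because v_x vanishes at 0: the even extension
  in x has a Lipschitz second derivative, and sgn(x) v_x has no jump. The second is avoided by
  running the clock from 1 + \<delta> down to \<delta> > 0; the constants depend on \<delta>, so n
  tends to infinity with \<delta> fixed. Optimality is then a verification argument. The chosen arm
  enters one round only through (D - a sgn(S)) v_x(S) / n, where D is -a or a. This is 0 under the
  threshold rule, and otherwise 0 or -2 a times the slope at |S|, whose sign is known since v
  decreases in |x|. Hence a \<le> 0 suits decreasing \<phi>, and a \<ge> 0 suits increasing \<phi>,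
  whose indicators carry negative weights. Only second moments are available, so the Taylor
  remainder is bounded by min(h^2, |h|^3), which makes the total error of n rounds vanish without a
  rate.\<close>

section \<open>Gaussian kernels of Brownian motion with drift\<close>

abbreviation std_normal_cdf :: "real \<Rightarrow> real" where
  "std_normal_cdf \<equiv> cdf std_normal_distribution"

lemma std_normal_cdf_has_real_derivative:
  "(std_normal_cdf has_real_derivative std_normal_density x) (at x)"
proof -
  interpret real_distribution std_normal_distribution by (rule real_dist_normal_dist)
  have cont: "continuous_on S std_normal_density" for S
    by (auto simp: normal_density_def[abs_def] intro!: continuous_intros)
  \<comment> \<open>Differentiation is local: a finite base point to the left of \<open>x\<close>
    puts \<open>x\<close> inside a compact interval, where the fundamental theorem of calculus for
    continuous integrands applies.\<close>
  define a where "a = x - 1"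
  have eq: "std_normal_cdf u = std_normal_cdf a + integral {a..u} std_normal_density" if "a < u" for u
  proof -
    have "measure std_normal_distribution {a<..u} = (\<integral>z. std_normal_density z * indicator {a<..u} z \<partial>lborel)"
    proof -
      have "measure std_normal_distribution {a<..u} = integral\<^sup>L std_normal_distribution (indicator {a<..u})"
        by simp
      also have "\<dots> = (\<integral>z. std_normal_density z *\<^sub>R indicator {a<..u} z \<partial>lborel)"
        by (rule integral_density) auto
      finally show ?thesis by simp
    qed
    also have "\<dots> = (\<integral>z. std_normal_density z * indicator {a..u} z \<partial>lborel)"
      using AE_lborel_singleton[of a]
      by (intro integral_cong_AE) (auto simp: indicator_def elim!: eventually_mono)
    also have "\<dots> = integral {a..u} std_normal_density"
      using set_borel_integral_eq_integral(2)[OF borel_integrable_atLeastAtMost'[OF cont[of "{a..u}"]]]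
      by (simp add: set_lebesgue_integral_def mult.commute)
    finally show ?thesis using cdf_diff_eq[OF that] by simp
  qed
  have "((\<lambda>u. std_normal_cdf a + integral {a..u} std_normal_density) has_real_derivative
      0 + std_normal_density x) (at x within {a..x+1})"
    by (intro DERIV_add DERIV_const integral_has_real_derivative cont) (auto simp: a_def)
  then have "((\<lambda>u. std_normal_cdf a + integral {a..u} std_normal_density) has_real_derivative
      std_normal_density x) (at x)"
    by (simp add: a_def at_within_Icc_at)
  then show ?thesis
    by (rule has_field_derivative_transform_within[where d=1]) (auto simp: eq a_def dist_real_def abs_if split: if_splits)
qed

text \<open>Distribution function at time \<open>t\<close> of Brownian motion with drift
  \<open>a\<close> started at 0. \<open>bm_density\<close>, \<open>bm_density1\<close> and
  \<open>bm_density2\<close> are its first three derivatives in \<open>z\<close>,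
  \<open>bm_tderiv\<close> and \<open>bm_tderiv2\<close> its first two in \<open>t\<close>.\<close>

definition bm_cdf :: "real \<Rightarrow> real \<Rightarrow> real \<Rightarrow> real" where
  "bm_cdf a t z = std_normal_cdf ((z - a * t) / sqrt t)"

definition bm_density :: "real \<Rightarrow> real \<Rightarrow> real \<Rightarrow> real" where
  "bm_density a t z = exp (- (z - a * t)\<^sup>2 / (2 * t)) / sqrt (2 * pi * t)"

definition bm_density1 :: "real \<Rightarrow> real \<Rightarrow> real \<Rightarrow> real" where
  "bm_density1 a t z = - ((z - a * t) / t) * bm_density a t z"

definition bm_density2 :: "real \<Rightarrow> real \<Rightarrow> real \<Rightarrow> real" where
  "bm_density2 a t z = (((z - a * t) / t)\<^sup>2 - 1 / t) * bm_density a t z"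

text \<open>The forward equation p_t = p_zz / 2 - a p_z of the density, integrated once in
  \<open>z\<close>.\<close>

definition bm_tderiv :: "real \<Rightarrow> real \<Rightarrow> real \<Rightarrow> real" where
  "bm_tderiv a t z = bm_density1 a t z / 2 - a * bm_density a t z"

text \<open>Comes from writing \<open>bm_tderiv\<close> as -(a/2 + z/(2t)) times the density. The
  result is a cubic polynomial in \<open>z\<close> times the Gaussian kernel, the fastest growth
  that has to be dominated below.\<close>

definition bm_tderiv2 :: "real \<Rightarrow> real \<Rightarrow> real \<Rightarrow> real" where
  "bm_tderiv2 a t z = (z / (2 * t\<^sup>2) - (a / 2 + z / (2 * t)) *
     ((((z - a * t) / t)\<^sup>2 - 1 / t) / 2 + a * ((z - a * t) / t))) * bm_density a t z"

lemma bm_density_nonneg: "t > 0 \<Longrightarrow> 0 \<le> bm_density a t z"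
  by (simp add: bm_density_def)

lemma bm_density_std:
  assumes "t > 0"
  shows "bm_density a t z = std_normal_density ((z - a * t) / sqrt t) / sqrt t"
  using assms by (simp add: bm_density_def std_normal_density_def power_divide real_sqrt_mult
      del: real_sqrt_eq_iff)

lemma bm_cdf_has_real_derivative:
  assumes "t > 0"
  shows "((\<lambda>z. bm_cdf a t z) has_real_derivative bm_density a t z) (at z within S)"
proof -
  have "((\<lambda>z. (z - a * t) / sqrt t) has_real_derivative 1 / sqrt t) (at z)"
    using assms by (auto intro!: derivative_eq_intros simp: sqrt_divide_self_eq inverse_eq_divide)
  from DERIV_chain2[OF std_normal_cdf_has_real_derivative this]
  have "((\<lambda>z. bm_cdf a t z) has_real_derivative bm_density a t z) (at z)"
    unfolding bm_cdf_def bm_density_std[OF assms] by simp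
  then show ?thesis by (rule has_field_derivative_at_within)
qed

lemma bm_cdf_has_tderiv:
  assumes "t > 0"
  shows "((\<lambda>t. bm_cdf a t z) has_real_derivative bm_tderiv a t z) (at t)"
proof -
  have d: "((\<lambda>t. (z - a * t) / sqrt t) has_real_derivative (- a / sqrt t - (z - a * t) / (2 * t * sqrt t))) (at t)"
    using assms by (auto intro!: derivative_eq_intros simp: field_simps)
  have eq: "std_normal_density ((z - a * t) / sqrt t) * (- a / sqrt t - (z - a * t) / (2 * t * sqrt t))
    = bm_tderiv a t z"
    using assms unfolding bm_tderiv_def bm_density1_def bm_density_std[OF assms]
    by (simp add: diff_divide_distrib algebra_simps)
  show ?thesis
    using DERIV_chain2[OF std_normal_cdf_has_real_derivative d] unfolding eq by (simp add: bm_cdf_def)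
qed

lemma bm_density_has_real_derivative:
  assumes "t > 0"
  shows "((\<lambda>z. bm_density a t z) has_real_derivative bm_density1 a t z) (at z within S)"
proof -
  have "((\<lambda>z. - (z - a * t)\<^sup>2 / (2 * t)) has_real_derivative - ((z - a * t) / t)) (at z within S)"
    using assms by (auto intro!: derivative_eq_intros simp: field_simps)
  from DERIV_cdivide[OF DERIV_chain2[OF DERIV_exp this], of "sqrt (2 * pi * t)"] show ?thesis
    by (simp add: bm_density_def bm_density1_def mult.commute)
qed

lemma bm_density1_has_real_derivative:
  assumes "t > 0"
  shows "((\<lambda>z. bm_density1 a t z) has_real_derivative bm_density2 a t z) (at z within S)"
proof -
  have "((\<lambda>z. - ((z - a * t) / t)) has_real_derivative - (1 / t)) (at z within S)"
    using assms by (auto intro!: derivative_eq_intros simp: field_simps)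
  from DERIV_mult[OF this bm_density_has_real_derivative[OF assms, of a]]
  have "((\<lambda>z. bm_density1 a t z) has_real_derivative
      - (1 / t) * bm_density a t z + bm_density1 a t z * - ((z - a * t) / t)) (at z within S)"
    by (simp only: bm_density1_def)
  moreover have "k * p + (- u * p) * - u = (u\<^sup>2 + k) * p" for k p u :: real
    by (simp add: algebra_simps power2_eq_square)
  ultimately show ?thesis
    unfolding bm_density1_def[of a t z] by (simp only:) (simp add: bm_density2_def)
qed

lemma bm_density_has_tderiv:
  assumes "t > 0"
  shows "((\<lambda>t. bm_density a t z) has_real_derivative
    bm_density a t z * (((z - a * t) / t)\<^sup>2 / 2 - 1 / (2 * t) + a * ((z - a * t) / t))) (at t)"
proof -
  have 1: "((\<lambda>t. - (z - a * t)\<^sup>2 / (2 * t)) has_real_derivative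
     ((z - a * t) / t)\<^sup>2 / 2 + a * ((z - a * t) / t)) (at t)"
    using assms by (auto intro!: derivative_eq_intros simp: field_simps power2_eq_square)
  have 2: "((\<lambda>t. 1 / sqrt (2 * pi * t)) has_real_derivative - (1 / (2 * t)) * (1 / sqrt (2 * pi * t))) (at t)"
    using assms by (auto intro!: derivative_eq_intros simp: field_simps real_sqrt_mult)
  have "((\<lambda>t. exp (- (z - a * t)\<^sup>2 / (2 * t)) * (1 / sqrt (2 * pi * t))) has_real_derivative
    bm_density a t z * (((z - a * t) / t)\<^sup>2 / 2 - 1 / (2 * t) + a * ((z - a * t) / t))) (at t)"
  proof (rule DERIV_cong[OF DERIV_mult[OF DERIV_chain2[OF DERIV_exp 1] 2]])
    have "E * (x + y) * q + - k * q * E = E * q * (x - k + y)" for E x y q k :: real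
      by (simp add: algebra_simps)
    then have "E * (x + y) * (1 / S) + - k * (1 / S) * E = E / S * (x - k + y)" for E x y S k :: real
      by (metis mult.right_neutral times_divide_eq_right)
    then show "exp (- (z - a * t)\<^sup>2 / (2 * t)) * (((z - a * t) / t)\<^sup>2 / 2 + a * ((z - a * t) / t)) * (1 / sqrt (2 * pi * t)) +
      - (1 / (2 * t)) * (1 / sqrt (2 * pi * t)) * exp (- (z - a * t)\<^sup>2 / (2 * t)) =
      bm_density a t z * (((z - a * t) / t)\<^sup>2 / 2 - 1 / (2 * t) + a * ((z - a * t) / t))"
      unfolding bm_density_def .
  qed
  then show ?thesis by (simp add: bm_density_def)
qed

lemma bm_tderiv_has_tderiv:
  assumes "t > 0"
  shows "((\<lambda>t. bm_tderiv a t z) has_real_derivative bm_tderiv2 a t z) (at t)"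
proof -
  have eq: "bm_tderiv a s z = - (a / 2 + z / (2 * s)) * bm_density a s z" if "s > 0" for s
    using that unfolding bm_tderiv_def bm_density1_def by (simp add: field_simps)
  have 1: "((\<lambda>s. - (a / 2 + z / (2 * s))) has_real_derivative z / (2 * t\<^sup>2)) (at t)"
    using assms by (auto intro!: derivative_eq_intros simp: field_simps power2_eq_square)
  have "((\<lambda>s. - (a / 2 + z / (2 * s)) * bm_density a s z) has_real_derivative bm_tderiv2 a t z) (at t)"
  proof (rule DERIV_cong[OF DERIV_mult[OF 1 bm_density_has_tderiv[OF assms]]])
    define u where "u = (z - a * t) / t"
    have "u\<^sup>2 / 2 - 1 / (2 * t) = (u\<^sup>2 - 1 / t) / 2" by (simp add: diff_divide_distrib)
    moreover have "k * p + p * Y * - b = (k - b * Y) * p" for k p Y b :: real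
      by (simp add: algebra_simps)
    ultimately show "z / (2 * t\<^sup>2) * bm_density a t z + bm_density a t z *
      (((z - a * t) / t)\<^sup>2 / 2 - 1 / (2 * t) + a * ((z - a * t) / t)) * - (a / 2 + z / (2 * t))
      = bm_tderiv2 a t z"
      unfolding bm_tderiv2_def u_def[symmetric] by (simp only:)
  qed
  then show ?thesis
    by (rule has_field_derivative_transform_within_open[where S="{0<..}"]) (use assms eq in auto)
qed

section \<open>Bounds uniform in time away from zero\<close>

text \<open>With x = u^2 / (2T), the fourth power of \<open>u\<close> is 4 T^2 x^2, at most 8 T^2
  exp x because exp x \<ge> x^2 / 2. The cube is at most 8 (1 + u^4), by comparing |u| with
  1.\<close>

lemma exp_dominates_cube:
  fixes u T :: real
  assumes "T > 0"
  shows "(1 + \<bar>u\<bar>) ^ 3 * exp (- u\<^sup>2 / (2 * T)) \<le> 8 * (1 + 8 * T\<^sup>2)"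
proof -
  define x where "x = u\<^sup>2 / (2 * T)"
  have x: "x \<ge> 0" using assms by (simp add: x_def)
  have "u ^ 4 = 4 * T\<^sup>2 * x\<^sup>2"
    using assms by (simp add: x_def field_simps flip: power_mult)
  also have "\<dots> \<le> 8 * T\<^sup>2 * exp x"
  proof -
    have "x\<^sup>2 / 2 \<le> exp x" using exp_lower_Taylor_quadratic[OF x] x by linarith
    then have "8 * T\<^sup>2 * (x\<^sup>2 / 2) \<le> 8 * T\<^sup>2 * exp x" by (intro mult_left_mono) auto
    then show ?thesis by simp
  qed
  finally have 4: "1 + u ^ 4 \<le> (1 + 8 * T\<^sup>2) * exp x"
    using one_le_exp_iff[of x] x unfolding distrib_right by linarith
  have "(1 + \<bar>u\<bar>) ^ 3 \<le> 8 * (1 + u ^ 4)"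
  proof (cases "\<bar>u\<bar> \<le> 1")
    case True
    then have "(1 + \<bar>u\<bar>) ^ 3 \<le> 2 ^ 3" by (intro power_mono) auto
    also have "(2::real) ^ 3 \<le> 8 * (1 + w)" if "w \<ge> 0" for w using that by simp
    finally show ?thesis by simp
  next
    case False
    then have "(1 + \<bar>u\<bar>) ^ 3 \<le> (2 * \<bar>u\<bar>) ^ 3" by (intro power_mono) auto
    also have "\<dots> = 8 * \<bar>u\<bar> ^ 3" by (simp add: power_mult_distrib)
    also have "\<dots> \<le> 8 * \<bar>u\<bar> ^ 4" using False by (intro mult_left_mono power_increasing) auto
    finally show ?thesis by simp
  qed
  also have "\<dots> \<le> 8 * (1 + 8 * T\<^sup>2) * exp x" using mult_left_mono[OF 4, of 8] unfolding mult.assoc by simp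
  finally have "(1 + \<bar>u\<bar>) ^ 3 * exp (- x) \<le> 8 * (1 + 8 * T\<^sup>2) * exp x * exp (- x)"
    by (intro mult_right_mono) auto
  then show ?thesis by (simp add: x_def exp_minus field_simps)
qed

text \<open>Each function is the kernel times a factor of at most cubic growth in |z - a t|. For
  \<open>t\<close> in a compact interval away from 0 the coefficients of that growth are bounded and
  the kernel lies below a fixed multiple of a Gaussian of variance \<open>T\<close>, so
  \<open>exp_dominates_cube\<close> applies.\<close>

lemma bm_density_bounds:
  assumes "0 < \<delta>" "\<delta> \<le> T"
  obtains C where "C > 0"
    "\<And>t z. t \<in> {\<delta>..T} \<Longrightarrow> \<bar>bm_density a t z\<bar> \<le> C"
    "\<And>t z. t \<in> {\<delta>..T} \<Longrightarrow> \<bar>bm_density1 a t z\<bar> \<le> C"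
    "\<And>t z. t \<in> {\<delta>..T} \<Longrightarrow> \<bar>bm_density2 a t z\<bar> \<le> C"
    "\<And>t z. t \<in> {\<delta>..T} \<Longrightarrow> \<bar>bm_tderiv2 a t z\<bar> \<le> C"
proof -
  define A where "A = \<bar>a\<bar>"
  define r where "r = 1 + 1 / \<delta>"
  define B where "B = 1 + T * A"
  \<comment> \<open>With s = 1 + |z - a t|, the quantity \<open>B * s\<close> bounds |z| and
    \<open>r\<close> bounds 1/t. The first two summands majorise the two terms of
    \<open>bm_tderiv2\<close>, the third the factor of \<open>bm_density2\<close>; the coefficients
    1 and \<open>r\<close> of the remaining functions lie below r^2.\<close>
  define K where "K = B * r\<^sup>2 + (A + B * r) * (r\<^sup>2 + A * r) + r\<^sup>2"
  define P where "P = 8 * (1 + 8 * T\<^sup>2) / sqrt (2 * pi * \<delta>)"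
  have T: "T > 0" using assms by auto
  have A0: "A \<ge> 0" and r1: "r \<ge> 1" and B1: "B \<ge> 1"
    using assms T by (auto simp: A_def r_def B_def)
  have P0: "P > 0" unfolding P_def using assms by (intro divide_pos_pos mult_pos_pos) (auto intro: add_pos_nonneg)
  have Br: "B * r\<^sup>2 \<ge> r\<^sup>2" using B1 by (metis mult_right_mono mult_1 zero_le_power2)
  have r2: "r \<le> r\<^sup>2" "1 \<le> r\<^sup>2" using r1 power_increasing[of 1 2 r] power_increasing[of 0 2 r] by auto
  have nn: "(A + B * r) * (r\<^sup>2 + A * r) \<ge> 0" using A0 B1 r1 by (intro mult_nonneg_nonneg) auto
  have K: "K > 0" "1 \<le> K" "r \<le> K" "r\<^sup>2 \<le> K" unfolding K_def using Br r2 nn by linarith+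
  have key: "\<bar>c * bm_density a t z\<bar> \<le> K * P"
    if t: "t \<in> {\<delta>..T}" and c: "\<bar>c\<bar> \<le> K * (1 + \<bar>z - a * t\<bar>) ^ 3" for c t z
  proof -
    have t0: "t > 0" using t assms by auto
    have "bm_density a t z \<le> exp (- (z - a * t)\<^sup>2 / (2 * T)) / sqrt (2 * pi * \<delta>)"
      unfolding bm_density_def using t t0 assms T
      by (intro frac_le) (auto simp: field_simps mult_right_mono mult_left_mono)
    then have "\<bar>c * bm_density a t z\<bar> \<le> K * (1 + \<bar>z - a * t\<bar>) ^ 3 *
        (exp (- (z - a * t)\<^sup>2 / (2 * T)) / sqrt (2 * pi * \<delta>))"
      unfolding abs_mult using bm_density_nonneg[OF t0, of a z] c K by (intro mult_mono) auto
    also have "\<dots> = K * ((1 + \<bar>z - a * t\<bar>) ^ 3 * exp (- (z - a * t)\<^sup>2 / (2 * T))) / sqrt (2 * pi * \<delta>)"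
      by simp
    also have "\<dots> \<le> K * (8 * (1 + 8 * T\<^sup>2)) / sqrt (2 * pi * \<delta>)"
      using exp_dominates_cube[OF T, of "z - a * t"] K assms by (intro divide_right_mono mult_left_mono) auto
    finally show ?thesis by (simp add: P_def)
  qed
  show ?thesis
  proof (rule that[of "K * P"])
    show "K * P > 0" using K P0 by simp
  next
    fix t z assume t: "t \<in> {\<delta>..T}"
    define s where "s = 1 + \<bar>z - a * t\<bar>"
    have s: "s \<ge> 1" by (simp add: s_def)
    have t0: "t > 0" using t assms by auto
    have s3: "1 \<le> s ^ 3" "s \<le> s ^ 3" "s\<^sup>2 \<le> s ^ 3"
      using s power_increasing[of 0 3 s] power_increasing[of 1 3 s] power_increasing[of 2 3 s] by auto
    have it: "1 / t \<le> r" using t assms by (auto simp: r_def intro: order_trans[OF frac_le[of 1 1 \<delta> t]])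
    have it0: "1 / t \<ge> 0" using t0 by simp
    have u: "\<bar>(z - a * t) / t\<bar> \<le> s * r"
    proof -
      have "\<bar>(z - a * t) / t\<bar> = \<bar>z - a * t\<bar> * (1 / t)" using t0 by (simp add: abs_divide)
      also have "\<dots> \<le> s * r" using it it0 s by (intro mult_mono) (auto simp: s_def)
      finally show ?thesis .
    qed
    have z: "\<bar>z\<bar> \<le> B * s"
    proof -
      have "\<bar>z\<bar> \<le> \<bar>z - a * t\<bar> + A * T"
      proof -
        have "\<bar>a * t\<bar> \<le> A * T" using t t0 unfolding A_def abs_mult by (intro mult_mono) auto
        then show ?thesis by linarith
      qed
      also have "\<dots> \<le> s + T * A * s"
        using s A0 T mult_left_mono[of 1 s "T * A"] by (simp add: s_def mult.commute)
      finally show ?thesis by (simp add: B_def algebra_simps)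
    qed
    have u2: "\<bar>((z - a * t) / t)\<^sup>2 - 1 / t\<bar> \<le> s\<^sup>2 * r\<^sup>2"
    proof -
      have "((z - a * t) / t)\<^sup>2 \<le> (s * r)\<^sup>2"
        using u s r1 by (intro power2_le_iff_abs_le[THEN iffD2]) auto
      moreover have "1 / t \<le> s\<^sup>2 * r\<^sup>2"
        using it r2 s by (smt (verit) mult_le_cancel_right1 one_le_power zero_le_power2)
      ultimately show ?thesis
        using it0 zero_le_power2[of "(z - a * t) / t"] unfolding power_mult_distrib by linarith
    qed
    have fin: "c * s ^ k \<le> K * s ^ 3" if "c \<le> K" "k \<le> 3" for c k
      using that s K by (intro mult_mono power_increasing) auto
    show "\<bar>bm_density a t z\<bar> \<le> K * P"
      using key[OF t, of 1 z] fin[of 1 0] K by (simp add: s_def)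
    show "\<bar>bm_density1 a t z\<bar> \<le> K * P"
      unfolding bm_density1_def
      using u fin[of r 1] K by (intro key[OF t]) (simp add: s_def mult.commute)
    show "\<bar>bm_density2 a t z\<bar> \<le> K * P"
      unfolding bm_density2_def
      using u2 fin[of "r\<^sup>2" 2] K by (intro key[OF t]) (simp add: s_def mult.commute)
    show "\<bar>bm_tderiv2 a t z\<bar> \<le> K * P"
      unfolding bm_tderiv2_def
    proof (intro key[OF t])
      have 1: "\<bar>z / (2 * t\<^sup>2)\<bar> \<le> (B * s) * r\<^sup>2"
      proof -
        have "\<bar>z / (2 * t\<^sup>2)\<bar> = \<bar>z\<bar> * (1 / t)\<^sup>2 / 2" by (simp add: abs_divide power_divide)
        also have "\<dots> \<le> \<bar>z\<bar> * (1 / t)\<^sup>2" by simp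
        also have "\<dots> \<le> (B * s) * r\<^sup>2" using z it it0 by (intro mult_mono power_mono) auto
        finally show ?thesis .
      qed
      have 2: "\<bar>a / 2 + z / (2 * t)\<bar> \<le> (A + B * r) * s"
      proof -
        have "\<bar>z / (2 * t)\<bar> \<le> \<bar>z\<bar> * (1 / t)" using t0 by (simp add: abs_divide field_simps)
        also have "\<dots> \<le> (B * s) * r" using z it it0 by (intro mult_mono) auto
        finally have "\<bar>z / (2 * t)\<bar> \<le> B * s * r" .
        moreover have "\<bar>a / 2\<bar> \<le> A * s" using s mult_left_mono[of 1 s A] A0 by (simp add: A_def)
        ultimately show ?thesis unfolding distrib_right mult.assoc[of B] mult.commute[of s r] by linarith
      qed
      have 3: "\<bar>(((z - a * t) / t)\<^sup>2 - 1 / t) / 2 + a * ((z - a * t) / t)\<bar> \<le> (r\<^sup>2 + A * r) * s\<^sup>2"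
      proof -
        have "\<bar>a * ((z - a * t) / t)\<bar> \<le> A * (s * r)"
          using u by (simp only: abs_mult A_def) (intro mult_left_mono, auto)
        also have "\<dots> \<le> A * r * s\<^sup>2"
          using A0 r1 s mult_left_mono[of s "s\<^sup>2" "A * r"] by (simp add: mult.commute mult.left_commute power2_eq_square)
        finally have "\<bar>a * ((z - a * t) / t)\<bar> \<le> A * r * s\<^sup>2" .
        moreover have "\<bar>p / 2 + q\<bar> \<le> P + Q" if "\<bar>p\<bar> \<le> P" "\<bar>q\<bar> \<le> Q" for p q P Q :: real
          using that by linarith
        ultimately show ?thesis using u2 unfolding distrib_right mult.commute[of "s\<^sup>2"] by blast
      qed
      have "\<bar>(a / 2 + z / (2 * t)) * ((((z - a * t) / t)\<^sup>2 - 1 / t) / 2 + a * ((z - a * t) / t))\<bar>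
          \<le> ((A + B * r) * s) * ((r\<^sup>2 + A * r) * s\<^sup>2)"
        unfolding abs_mult using 2 3 by (intro mult_mono) auto
      also have "\<dots> = (A + B * r) * (r\<^sup>2 + A * r) * s ^ 3" by (simp add: power2_eq_square power3_eq_cube)
      finally have 4: "\<bar>(a / 2 + z / (2 * t)) * ((((z - a * t) / t)\<^sup>2 - 1 / t) / 2 + a * ((z - a * t) / t))\<bar>
          \<le> (A + B * r) * (r\<^sup>2 + A * r) * s ^ 3" .
      have 5: "(B * s) * r\<^sup>2 \<le> (B * r\<^sup>2) * s ^ 3"
        using mult_left_mono[OF s3(2), of "B * r\<^sup>2"] B1 by (simp add: mult.commute mult.left_commute)
      have "\<bar>z / (2 * t\<^sup>2) - (a / 2 + z / (2 * t)) * ((((z - a * t) / t)\<^sup>2 - 1 / t) / 2 + a * ((z - a * t) / t))\<bar>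
         \<le> (B * r\<^sup>2) * s ^ 3 + (A + B * r) * (r\<^sup>2 + A * r) * s ^ 3"
        using 1 4 5 by linarith
      also have "\<dots> \<le> K * s ^ 3" using s3 s by (simp add: K_def algebra_simps)
      finally show "\<bar>z / (2 * t\<^sup>2) - (a / 2 + z / (2 * t)) * ((((z - a * t) / t)\<^sup>2 - 1 / t) / 2 + a * ((z - a * t) / t))\<bar>
         \<le> K * (1 + \<bar>z - a * t\<bar>) ^ 3" by (simp add: s_def)
    qed
  qed
qed

section \<open>Distribution function of reflected Brownian motion with drift\<close>

text \<open>For x \<ge> 0 and y \<ge> 0, the probability that Brownian motion with drift
  \<open>a\<close>, started at \<open>x\<close> and reflected at 0, is at most \<open>y\<close> at
  time \<open>t\<close>. The second term is an image term; its weight exp(2 a y) makes the slope in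
  \<open>x\<close> vanish at 0. \<open>refl_cdf1\<close> and \<open>refl_cdf2\<close> are the
  derivatives in \<open>x\<close>.\<close>

definition refl_cdf :: "real \<Rightarrow> real \<Rightarrow> real \<Rightarrow> real \<Rightarrow> real" where
  "refl_cdf a y t x = bm_cdf a t (y - x) - exp (2 * a * y) * bm_cdf a t (- y - x)"

definition refl_cdf1 :: "real \<Rightarrow> real \<Rightarrow> real \<Rightarrow> real \<Rightarrow> real" where
  "refl_cdf1 a y t x = exp (2 * a * y) * bm_density a t (- y - x) - bm_density a t (y - x)"

definition refl_cdf2 :: "real \<Rightarrow> real \<Rightarrow> real \<Rightarrow> real \<Rightarrow> real" where
  "refl_cdf2 a y t x = bm_density1 a t (y - x) - exp (2 * a * y) * bm_density1 a t (- y - x)"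

lemma refl_cdf_has_real_derivative:
  assumes "t > 0"
  shows "(refl_cdf a y t has_real_derivative refl_cdf1 a y t x) (at x)"
proof -
  have "((\<lambda>x. bm_cdf a t (c - x)) has_real_derivative - bm_density a t (c - x)) (at x)" for c
  proof -
    have "((\<lambda>x. c - x) has_real_derivative - 1) (at x)"
      by (auto intro!: derivative_eq_intros)
    from DERIV_chain2[OF bm_cdf_has_real_derivative[OF assms] this] show ?thesis by simp
  qed
  from DERIV_diff[OF this[of y] DERIV_cmult[OF this[of "-y"], of "exp (2 * a * y)"]] show ?thesis
    by (simp add: refl_cdf_def[abs_def] refl_cdf1_def)
qed

lemma refl_cdf1_has_real_derivative:
  assumes "t > 0"
  shows "(refl_cdf1 a y t has_real_derivative refl_cdf2 a y t x) (at x)"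
proof -
  have "((\<lambda>x. bm_density a t (c - x)) has_real_derivative - bm_density1 a t (c - x)) (at x)" for c
  proof -
    have "((\<lambda>x. c - x) has_real_derivative - 1) (at x)"
      by (auto intro!: derivative_eq_intros)
    from DERIV_chain2[OF bm_density_has_real_derivative[OF assms] this] show ?thesis by simp
  qed
  from DERIV_diff[OF DERIV_cmult[OF this[of "-y"], of "exp (2 * a * y)"] this[of y]] show ?thesis
    by (simp add: refl_cdf1_def[abs_def] refl_cdf2_def)
qed

text \<open>Both terms contain \<open>x\<close> with a minus sign. This reverses first derivatives
  but not second ones, so the forward equation of \<open>bm_cdf\<close> becomes the backward
  equation v_t = v_xx / 2 + a v_x.\<close>

lemma refl_cdf_has_tderiv:
  assumes "t > 0"
  shows "((\<lambda>t. refl_cdf a y t x) has_real_derivative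
    refl_cdf2 a y t x / 2 + a * refl_cdf1 a y t x) (at t)"
  unfolding refl_cdf_def
  by (rule DERIV_cong[OF DERIV_diff[OF bm_cdf_has_tderiv[OF assms] DERIV_cmult[OF bm_cdf_has_tderiv[OF assms]]]])
    (simp add: bm_tderiv_def refl_cdf1_def refl_cdf2_def algebra_simps diff_divide_distrib)

lemma refl_cdf_has_tderiv2:
  assumes "t > 0"
  shows "((\<lambda>t. refl_cdf2 a y t x / 2 + a * refl_cdf1 a y t x) has_real_derivative
    bm_tderiv2 a t (y - x) - exp (2 * a * y) * bm_tderiv2 a t (- y - x)) (at t)"
proof -
  have eq: "refl_cdf2 a y t x / 2 + a * refl_cdf1 a y t x =
      bm_tderiv a t (y - x) - exp (2 * a * y) * bm_tderiv a t (- y - x)" for t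
    by (simp add: bm_tderiv_def refl_cdf1_def refl_cdf2_def algebra_simps diff_divide_distrib)
  show ?thesis unfolding eq
    by (intro DERIV_diff DERIV_cmult bm_tderiv_has_tderiv assms)
qed

text \<open>The squares in the two exponents differ by 4 y (x + a t); division by 2 t leaves 2 x y /
  t + 2 a y. The weight exp(2 a y) cancels the second summand, so that image and direct kernel agree
  at x = 0.\<close>

lemma bm_density_reflect:
  assumes "t > 0"
  shows "exp (2 * a * y) * bm_density a t (- y - x) = exp (- (2 * x * y / t)) * bm_density a t (y - x)"
proof -
  have "2 * a * y + - (- y - x - a * t)\<^sup>2 / (2 * t) = - (2 * x * y / t) + - (y - x - a * t)\<^sup>2 / (2 * t)"
    using assms by (simp add: field_simps power2_eq_square)
  then have "exp (2 * a * y) * exp (- (- y - x - a * t)\<^sup>2 / (2 * t))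
      = exp (- (2 * x * y / t)) * exp (- (y - x - a * t)\<^sup>2 / (2 * t))"
    by (simp only: exp_add[symmetric])
  then show ?thesis by (simp add: bm_density_def)
qed

text \<open>Two decisive facts can be read off this form: the slope is 0 at x = 0, and it is
  nonpositive for x, y \<ge> 0.\<close>

lemma refl_cdf1_eq:
  assumes "t > 0"
  shows "refl_cdf1 a y t x = - ((1 - exp (- (2 * x * y / t))) * bm_density a t (y - x))"
  using bm_density_reflect[OF assms, of a y x] by (simp add: refl_cdf1_def algebra_simps)

lemma refl_cdf1_zero: "t > 0 \<Longrightarrow> refl_cdf1 a y t 0 = 0"
  by (simp add: refl_cdf1_eq)

lemma refl_cdf1_nonpos:
  assumes "t > 0" "0 \<le> x" "0 \<le> y"
  shows "refl_cdf1 a y t x \<le> 0"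
  using assms bm_density_nonneg[of t a "y - x"] by (simp add: refl_cdf1_eq)

lemma bm_cdf_le_1: "bm_cdf a t z \<le> 1" and bm_cdf_nonneg: "0 \<le> bm_cdf a t z"
proof -
  interpret real_distribution std_normal_distribution by (rule real_dist_normal_dist)
  show "bm_cdf a t z \<le> 1" "0 \<le> bm_cdf a t z"
    by (auto simp: bm_cdf_def cdf_bounded_prob cdf_nonneg)
qed

lemma refl_cdf_le_1: "refl_cdf a y t x \<le> 1"
  using bm_cdf_le_1[of a t "y - x"] mult_nonneg_nonneg[OF _ bm_cdf_nonneg, of "exp (2 * a * y)" a t "- y - x"]
  by (simp add: refl_cdf_def)

text \<open>The function is nonincreasing on the half-line and tends to 0 at infinity.\<close>

lemma refl_cdf_nonneg:
  assumes "t > 0" "0 \<le> x" "0 \<le> y"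
  shows "0 \<le> refl_cdf a y t x"
proof -
  interpret real_distribution std_normal_distribution by (rule real_dist_normal_dist)
  have *: "((\<lambda>u. bm_cdf a t (c - u)) \<longlongrightarrow> 0) at_top" for c
  proof -
    have "filterlim (\<lambda>u. (c - u - a * t) / sqrt t) at_bot at_top"
      using assms by real_asymp
    from filterlim_compose[OF cdf_lim_at_bot this] show ?thesis by (simp add: bm_cdf_def)
  qed
  have lim: "(refl_cdf a y t \<longlongrightarrow> 0) at_top"
    using tendsto_diff[OF *[of y] tendsto_mult[OF tendsto_const *[of "-y"]], of "exp (2 * a * y)"]
    by (simp add: refl_cdf_def[abs_def])
  have "refl_cdf a y t u \<le> refl_cdf a y t x" if "x \<le> u" for u
  proof (rule DERIV_nonpos_imp_nonincreasing[OF that])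
    fix v assume "x \<le> v"
    then show "\<exists>z. (refl_cdf a y t has_real_derivative z) (at v) \<and> z \<le> 0"
      using refl_cdf_has_real_derivative[OF assms(1)] refl_cdf1_nonpos[of t v y a] assms by fastforce
  qed
  then show ?thesis
    by (intro tendsto_upperbound[OF lim]) (auto intro: eventually_at_top_linorderI[of x])
qed

section \<open>Even extension in space and the value function\<close>

text \<open>The vanishing slope excludes a kink at 0: there the difference quotient of the extension
  equals that of \<open>F\<close> at |h| up to sign, and convergence to 0 is insensitive to
  signs.\<close>

lemma DERIV_even_extension:
  fixes F F' :: "real \<Rightarrow> real"
  assumes "\<And>x. x \<ge> 0 \<Longrightarrow> (F has_real_derivative F' x) (at x)" and "F' 0 = 0"
  shows "((\<lambda>x. F \<bar>x\<bar>) has_real_derivative sgn x * F' \<bar>x\<bar>) (at x)"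
proof (cases "x = 0")
  case False
  have "((\<lambda>x::real. \<bar>x\<bar>) has_real_derivative sgn x) (at x)"
  proof (cases "x > 0")
    case True
    then show ?thesis
      by (auto intro: has_field_derivative_transform_within_open[OF DERIV_ident, of "{0<..}"])
  next
    case False
    with \<open>x \<noteq> 0\<close> show ?thesis
      by (auto intro: has_field_derivative_transform_within_open[OF DERIV_minus[OF DERIV_ident], of "{..<0}"])
  qed
  from DERIV_chain2[OF assms(1)[of "\<bar>x\<bar>"] this] show ?thesis by (simp add: mult.commute)
next
  case True
  have d: "((\<lambda>h. (F h - F 0) / h) \<longlongrightarrow> 0) (at 0)"
    using assms(1)[of 0] assms(2) by (simp add: DERIV_def)
  then have "((\<lambda>h. \<bar>(F h - F 0) / h\<bar>) \<longlongrightarrow> 0) (at 0)"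
    by (rule tendsto_rabs_zero)
  moreover have "filterlim (\<lambda>x::real. \<bar>x\<bar>) (at 0) (at 0)"
    by (rule filterlim_atI) (auto intro!: tendsto_eq_intros simp: eventually_at_filter)
  ultimately have "((\<lambda>h. \<bar>(F \<bar>h\<bar> - F 0) / \<bar>h\<bar>\<bar>) \<longlongrightarrow> 0) (at 0)"
    by (rule filterlim_compose)
  then have "((\<lambda>h. \<bar>(F \<bar>h\<bar> - F 0) / h\<bar>) \<longlongrightarrow> 0) (at 0)" by (simp add: abs_divide)
  then have "((\<lambda>h. (F \<bar>h\<bar> - F 0) / h) \<longlongrightarrow> 0) (at 0)" by (simp only: tendsto_rabs_zero_iff)
  then show ?thesis using True by (simp add: DERIV_def)
qed

text \<open>With \<open>F = refl_cdf1\<close> this differentiates the derivative of the even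
  extension once more; \<open>F 0 = 0\<close> absorbs the jump of sgn.\<close>

lemma DERIV_odd_extension:
  fixes F F' :: "real \<Rightarrow> real"
  assumes "\<And>x. x \<ge> 0 \<Longrightarrow> (F has_real_derivative F' x) (at x)" and "F 0 = 0"
  shows "((\<lambda>x. sgn x * F \<bar>x\<bar>) has_real_derivative F' \<bar>x\<bar>) (at x)"
proof -
  consider "x > 0" | "x < 0" | "x = 0" by linarith
  then show ?thesis
  proof cases
    case 1
    from assms(1)[of x] 1 show ?thesis
      by (auto intro: has_field_derivative_transform_within_open[of F _ _ "{0<..}"])
  next
    case 2
    have "((\<lambda>x. - F (- x)) has_real_derivative F' (- x)) (at x)"
      using DERIV_minus[OF DERIV_chain2[OF assms(1)[of "- x"] DERIV_minus[OF DERIV_ident]]] 2 by simp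
    then show ?thesis
      using 2 by (auto intro: has_field_derivative_transform_within_open[of "\<lambda>x. - F (- x)" _ _ "{..<0}"])
  next
    case 3
    have d: "((\<lambda>h. F h / h) \<longlongrightarrow> F' 0) (at 0)"
      using assms(1)[of 0] assms(2) by (simp add: DERIV_def)
    have "filterlim (\<lambda>x::real. \<bar>x\<bar>) (at 0) (at 0)"
      by (rule filterlim_atI) (auto intro!: tendsto_eq_intros simp: eventually_at_filter)
    from filterlim_compose[OF d this] have "((\<lambda>h. F \<bar>h\<bar> / \<bar>h\<bar>) \<longlongrightarrow> F' 0) (at 0)" .
    moreover have "F \<bar>h\<bar> / \<bar>h\<bar> = sgn h * F \<bar>h\<bar> / h" for h
      by (simp add: sgn_if)
    ultimately show ?thesis using 3 by (simp add: DERIV_def assms(2))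
  qed
qed

text \<open>The Lagrange remainder is h^2 / 2 times a difference of two values of \<open>k\<close>,
  which is at most 2 C and also at most C |h|. The cube is useful for small increments; the square
  keeps the bound integrable when only second moments exist.\<close>

lemma taylor2_bound:
  fixes f g k :: "real \<Rightarrow> real"
  assumes f: "\<And>x. (f has_real_derivative g x) (at x)"
    and g: "\<And>x. (g has_real_derivative k x) (at x)"
    and bd: "\<And>x. \<bar>k x\<bar> \<le> C" and lip: "\<And>x y. \<bar>k x - k y\<bar> \<le> C * \<bar>x - y\<bar>"
  shows "\<bar>f (x + h) - f x - h * g x - h\<^sup>2 / 2 * k x\<bar> \<le> C * min (h\<^sup>2) (\<bar>h\<bar> ^ 3)"
proof (cases "h = 0")
  case False
  define d where "d = (\<lambda>m::nat. if m = 0 then f else if m = 1 then g else k :: real \<Rightarrow> real)"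
  have "\<exists>t. (if x + h < x then x + h < t \<and> t < x else x < t \<and> t < x + h) \<and>
    f (x + h) = (\<Sum>m<2::nat. (d m x / fact m) * (x + h - x)^m) + (d 2 t / fact 2) * (x + h - x)^2"
    by (rule Taylor[where a = "min x (x + h)" and b = "max x (x + h)"])
      (use False f g in \<open>auto simp: d_def less_Suc_eq numeral_2_eq_2\<close>)
  then obtain t where t: "if x + h < x then x + h < t \<and> t < x else x < t \<and> t < x + h"
    and eq: "f (x + h) = f x + h * g x + k t / 2 * h\<^sup>2"
    by (auto simp: d_def numeral_2_eq_2 mult.commute simp del: One_nat_def)
  from t have t: "\<bar>t - x\<bar> \<le> \<bar>h\<bar>" by (auto split: if_splits)
  have "f (x + h) - f x - h * g x - h\<^sup>2 / 2 * k x = h\<^sup>2 / 2 * (k t - k x)"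
    unfolding eq by (simp add: algebra_simps)
  then have e: "\<bar>f (x + h) - f x - h * g x - h\<^sup>2 / 2 * k x\<bar> = h\<^sup>2 / 2 * \<bar>k t - k x\<bar>"
    by (simp only: abs_mult) simp
  have C0: "C \<ge> 0" using bd[of 0] by linarith
  have "h\<^sup>2 / 2 * \<bar>k t - k x\<bar> \<le> h\<^sup>2 / 2 * (2 * C)"
    using bd[of t] bd[of x] by (intro mult_left_mono) auto
  moreover have "h\<^sup>2 / 2 * \<bar>k t - k x\<bar> \<le> h\<^sup>2 / 2 * (C * \<bar>h\<bar>)"
    using lip[of t x] mult_left_mono[OF t C0] by (intro mult_left_mono) auto
  moreover have "h\<^sup>2 / 2 * (C * \<bar>h\<bar>) \<le> C * \<bar>h\<bar> ^ 3"
  proof -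
    have "\<bar>h\<bar> ^ 3 = h\<^sup>2 * \<bar>h\<bar>" by (simp add: power2_eq_square power3_eq_cube)
    moreover have "p / 2 * (C * q) \<le> C * (p * q)" if "0 \<le> C * (p * q)" for p q
      using that by (simp add: mult.left_commute)
    moreover have "0 \<le> C * (h\<^sup>2 * \<bar>h\<bar>)" using C0 by simp
    ultimately show ?thesis by metis
  qed
  ultimately show ?thesis unfolding e by (simp add: min_def mult.commute)
qed simp

text \<open>The function v(t, x) on the whole line. Its drift term a sgn(x) v_x appears below as
  \<open>a * refl_cdf1 a y t \<bar>x\<bar>\<close>: the two signs cancel, and at x = 0 both
  expressions vanish.\<close>

definition refl_val :: "real \<Rightarrow> real \<Rightarrow> real \<Rightarrow> real \<Rightarrow> real" where
  "refl_val a y t x = refl_cdf a y t \<bar>x\<bar>"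

definition refl_val1 :: "real \<Rightarrow> real \<Rightarrow> real \<Rightarrow> real \<Rightarrow> real" where
  "refl_val1 a y t x = sgn x * refl_cdf1 a y t \<bar>x\<bar>"

definition refl_val2 :: "real \<Rightarrow> real \<Rightarrow> real \<Rightarrow> real \<Rightarrow> real" where
  "refl_val2 a y t x = refl_cdf2 a y t \<bar>x\<bar>"

lemma refl_val_has_real_derivative:
  "t > 0 \<Longrightarrow> (refl_val a y t has_real_derivative refl_val1 a y t x) (at x)"
  unfolding refl_val_def[abs_def] refl_val1_def
  by (intro DERIV_even_extension refl_cdf_has_real_derivative refl_cdf1_zero)

lemma refl_val1_has_real_derivative:
  "t > 0 \<Longrightarrow> (refl_val1 a y t has_real_derivative refl_val2 a y t x) (at x)"
  unfolding refl_val1_def[abs_def] refl_val2_def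
  by (intro DERIV_odd_extension refl_cdf1_has_real_derivative refl_cdf1_zero)

lemma refl_val_0_1:
  assumes "t > 0" "0 \<le> y"
  shows "0 \<le> refl_val a y t x" "refl_val a y t x \<le> 1"
  using assms by (auto simp: refl_val_def intro: refl_cdf_nonneg refl_cdf_le_1)

text \<open>These are the regularity data consumed by one round of the replacement argument. The
  last estimate is a Taylor expansion in time, with v_t already replaced by means of the backward
  equation.\<close>

lemma refl_val_bounds:
  assumes "0 < \<delta>" "\<delta> \<le> T"
  obtains C where "C > 0"
    "\<And>t x. t \<in> {\<delta>..T} \<Longrightarrow> \<bar>refl_val1 a y t x\<bar> \<le> C"
    "\<And>t x. t \<in> {\<delta>..T} \<Longrightarrow> \<bar>refl_val2 a y t x\<bar> \<le> C"
    "\<And>t x x'. t \<in> {\<delta>..T} \<Longrightarrow> \<bar>refl_val2 a y t x - refl_val2 a y t x'\<bar> \<le> C * \<bar>x - x'\<bar>"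
    "\<And>t s x. \<lbrakk>t \<in> {\<delta>..T}; s \<ge> 0; t + s \<le> T\<rbrakk> \<Longrightarrow>
      \<bar>refl_val a y (t + s) x - refl_val a y t x
        - s * (refl_val2 a y t x / 2 + a * refl_cdf1 a y t \<bar>x\<bar>)\<bar> \<le> C * s\<^sup>2"
proof -
  obtain C where C: "C > 0"
    "\<And>t z. t \<in> {\<delta>..T} \<Longrightarrow> \<bar>bm_density a t z\<bar> \<le> C"
    "\<And>t z. t \<in> {\<delta>..T} \<Longrightarrow> \<bar>bm_density1 a t z\<bar> \<le> C"
    "\<And>t z. t \<in> {\<delta>..T} \<Longrightarrow> \<bar>bm_density2 a t z\<bar> \<le> C"
    "\<And>t z. t \<in> {\<delta>..T} \<Longrightarrow> \<bar>bm_tderiv2 a t z\<bar> \<le> C"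
    using bm_density_bounds[OF assms, of a] by metis
  define E where "E = exp (2 * a * y)"
  have E0: "E > 0" by (simp add: E_def)
  have comb: "\<bar>p - E * q\<bar> \<le> C * (1 + E)" if "\<bar>p\<bar> \<le> C" "\<bar>q\<bar> \<le> C" for p q
  proof -
    have "\<bar>E * q\<bar> \<le> E * C" using that E0 by (simp add: abs_mult)
    with that show ?thesis by (simp add: algebra_simps)
  qed
  show ?thesis
  proof (rule that[of "C * (1 + E)"])
    show "0 < C * (1 + E)" using C(1) E0 by (simp add: add_pos_pos)
  next
    fix t x assume t: "t \<in> {\<delta>..T}"
    have "\<bar>refl_val1 a y t x\<bar> \<le> \<bar>refl_cdf1 a y t \<bar>x\<bar>\<bar>" by (simp add: refl_val1_def abs_mult sgn_if)
    also have "\<dots> \<le> C * (1 + E)"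
      using comb[OF C(2)[OF t, of "y - \<bar>x\<bar>"] C(2)[OF t, of "- y - \<bar>x\<bar>"]]
      by (simp add: refl_cdf1_def E_def abs_minus_commute)
    finally show "\<bar>refl_val1 a y t x\<bar> \<le> C * (1 + E)" .
    show "\<bar>refl_val2 a y t x\<bar> \<le> C * (1 + E)"
      using comb[OF C(3)[OF t, of "y - \<bar>x\<bar>"] C(3)[OF t, of "- y - \<bar>x\<bar>"]]
      by (simp add: refl_val2_def refl_cdf2_def E_def)
  next
    fix t x x' assume t: "t \<in> {\<delta>..T}"
    then have t0: "t > 0" using assms by auto
    have lip: "\<bar>bm_density1 a t u - bm_density1 a t v\<bar> \<le> C * \<bar>u - v\<bar>" for u v
    proof -
      have "norm (bm_density1 a t u - bm_density1 a t v) \<le> C * norm (u - v)"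
        by (rule field_differentiable_bound[of UNIV "bm_density1 a t" "bm_density2 a t"])
          (use C(4)[OF t] bm_density1_has_real_derivative[OF t0] in auto)
      then show ?thesis by simp
    qed
    have "refl_val2 a y t x - refl_val2 a y t x' =
      (bm_density1 a t (y - \<bar>x\<bar>) - bm_density1 a t (y - \<bar>x'\<bar>)) -
      E * (bm_density1 a t (- y - \<bar>x\<bar>) - bm_density1 a t (- y - \<bar>x'\<bar>))"
      by (simp add: refl_val2_def refl_cdf2_def E_def algebra_simps)
    also have "\<bar>\<dots>\<bar> \<le> C * \<bar>\<bar>x\<bar> - \<bar>x'\<bar>\<bar> + E * (C * \<bar>\<bar>x\<bar> - \<bar>x'\<bar>\<bar>)"
    proof (rule order_trans[OF abs_triangle_ineq4 add_mono])
      show "\<bar>bm_density1 a t (y - \<bar>x\<bar>) - bm_density1 a t (y - \<bar>x'\<bar>)\<bar> \<le> C * \<bar>\<bar>x\<bar> - \<bar>x'\<bar>\<bar>"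
        using lip[of "y - \<bar>x\<bar>" "y - \<bar>x'\<bar>"] by (simp add: abs_minus_commute)
      show "\<bar>E * (bm_density1 a t (- y - \<bar>x\<bar>) - bm_density1 a t (- y - \<bar>x'\<bar>))\<bar> \<le> E * (C * \<bar>\<bar>x\<bar> - \<bar>x'\<bar>\<bar>)"
        using lip[of "- y - \<bar>x\<bar>" "- y - \<bar>x'\<bar>"] E0 by (simp add: abs_mult abs_minus_commute)
    qed
    also have "\<dots> = C * (1 + E) * \<bar>\<bar>x\<bar> - \<bar>x'\<bar>\<bar>" by (simp add: algebra_simps)
    \<comment> \<open>The map from x to |x| is 1-Lipschitz, so a kink of \<open>refl_val2\<close> at
      0 does not spoil the Lipschitz bound.\<close>
    also have "\<dots> \<le> C * (1 + E) * \<bar>x - x'\<bar>"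
      using C(1) E0 abs_triangle_ineq3[of x x'] by (intro mult_left_mono) auto
    finally show "\<bar>refl_val2 a y t x - refl_val2 a y t x'\<bar> \<le> C * (1 + E) * \<bar>x - x'\<bar>" .
  next
    fix t s x assume t: "t \<in> {\<delta>..T}" and s: "s \<ge> 0" "t + s \<le> T"
    show "\<bar>refl_val a y (t + s) x - refl_val a y t x
        - s * (refl_val2 a y t x / 2 + a * refl_cdf1 a y t \<bar>x\<bar>)\<bar> \<le> C * (1 + E) * s\<^sup>2"
    proof (cases "s = 0")
      case False
      with s have s0: "s > 0" by simp
      define q where "q = (\<lambda>t. refl_cdf2 a y t \<bar>x\<bar> / 2 + a * refl_cdf1 a y t \<bar>x\<bar>)"
      define k where "k = (\<lambda>t. bm_tderiv2 a t (y - \<bar>x\<bar>) - E * bm_tderiv2 a t (- y - \<bar>x\<bar>))"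
      define d where "d = (\<lambda>m::nat. if m = 0 then \<lambda>t. refl_cdf a y t \<bar>x\<bar> else if m = 1 then q else k)"
      have "\<exists>r. (if t + s < t then t + s < r \<and> r < t else t < r \<and> r < t + s) \<and>
        refl_cdf a y (t + s) \<bar>x\<bar> = (\<Sum>m<2::nat. (d m t / fact m) * (t + s - t)^m) + (d 2 r / fact 2) * (t + s - t)^2"
      proof (rule Taylor[where a = t and b = "t + s"])
        show "\<forall>m u. m < 2 \<and> t \<le> u \<and> u \<le> t + s \<longrightarrow> (d m has_real_derivative d (Suc m) u) (at u)"
          using t assms refl_cdf_has_tderiv refl_cdf_has_tderiv2
          by (auto simp: d_def less_Suc_eq numeral_2_eq_2 q_def k_def E_def)
      qed (use s0 in \<open>auto simp: d_def\<close>)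
      then obtain r where r: "t < r" "r < t + s"
        and eq: "refl_cdf a y (t + s) \<bar>x\<bar> = refl_cdf a y t \<bar>x\<bar> + q t * s + k r / 2 * s\<^sup>2"
        using s0 by (auto simp: d_def numeral_2_eq_2 simp del: One_nat_def)
      have rT: "r \<in> {\<delta>..T}" using r t s by auto
      have "\<bar>k r\<bar> \<le> C * (1 + E)" unfolding k_def by (intro comb C(5) rT)
      then have "s\<^sup>2 * \<bar>k r\<bar> \<le> s\<^sup>2 * (C * (1 + E))" by (intro mult_left_mono) auto
      moreover have *: "refl_val a y (t + s) x - refl_val a y t x
        - s * (refl_val2 a y t x / 2 + a * refl_cdf1 a y t \<bar>x\<bar>) = s\<^sup>2 * k r / 2"
        unfolding refl_val_def eq refl_val2_def q_def by simp
      moreover have "0 \<le> s\<^sup>2 * \<bar>k r\<bar>" by simp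
      moreover have "\<bar>s\<^sup>2 * k r / 2\<bar> = s\<^sup>2 * \<bar>k r\<bar> / 2" by (simp add: abs_mult)
      ultimately show ?thesis unfolding * mult.commute[of "C * (1 + E)"] by linarith
    qed simp
  qed
qed

section \<open>Independence of the next reward from all earlier ones\<close>

lemma (in prob_space) indep_set_mono_right:
  "indep_set A B \<Longrightarrow> B' \<subseteq> B \<Longrightarrow> indep_set A B'"
  unfolding indep_sets2_eq by blast

text \<open>Let a, b, c be events of \<open>U (Suc m)\<close>, of the first \<open>m\<close> entries
  of \<open>U\<close>, and of those of \<open>V\<close>. Independence of the two sequences gives
  P(abc) = P(ab) P(c) and P(bc) = P(b) P(c); independence within \<open>U\<close> gives P(ab) = P(a)
  P(b). Hence P(abc) = P(a) P(bc), and the events bc form an intersection-stable generator.\<close>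

lemma (in prob_space) indep_set_next_round:
  fixes U V :: "nat \<Rightarrow> 'a \<Rightarrow> real"
  assumes U: "indep_vars (\<lambda>_. borel) U {1..}"
    and UV: "indep_var (PiM {1..} (\<lambda>_. borel)) (\<lambda>\<omega>. \<lambda>i\<in>{1..}. U i \<omega>)
      (PiM {1..} (\<lambda>_. borel)) (\<lambda>\<omega>. \<lambda>i\<in>{1..}. V i \<omega>)"
  shows "indep_set (sigma_sets (space M) {U (Suc m) -` A \<inter> space M | A. A \<in> sets borel})
    (sigma_sets (space M) (\<Union>i\<in>{1..m}. {U i -` A \<inter> space M | A. A \<in> sets borel}
       \<union> {V i -` A \<inter> space M | A. A \<in> sets borel}))"
proof -
  let ?P = "PiM {1..m} (\<lambda>_. borel :: real measure)"
  let ?Q = "PiM {1..} (\<lambda>_. borel :: real measure)"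
  define pU where "pU = (\<lambda>\<omega>. \<lambda>i\<in>{1..m}. U i \<omega>)"
  define pV where "pV = (\<lambda>\<omega>. \<lambda>i\<in>{1..m}. V i \<omega>)"
  define sU where "sU = (\<lambda>\<omega>. \<lambda>i\<in>{1..}. U i \<omega>)"
  define sV where "sV = (\<lambda>\<omega>. \<lambda>i\<in>{1..}. V i \<omega>)"
  have s: "sU \<in> measurable M ?Q" "sV \<in> measurable M ?Q"
    using UV by (auto simp: indep_var_eq sU_def sV_def)
  have res: "(\<lambda>f. restrict f {1..m}) \<in> measurable ?Q ?P"
    by (intro measurable_restrict_subset) auto
  have comp: "(\<lambda>f. f i) \<in> borel_measurable ?Q" if "i \<ge> 1" for i
    using that by (intro measurable_component_singleton) auto
  have pU: "pU = (\<lambda>\<omega>. restrict (sU \<omega>) {1..m})" and pV: "pV = (\<lambda>\<omega>. restrict (sV \<omega>) {1..m})"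
    by (auto simp: pU_def pV_def sU_def sV_def fun_eq_iff restrict_def)
  have Ui: "U i = (\<lambda>\<omega>. sU \<omega> i)" and Vi: "V i = (\<lambda>\<omega>. sV \<omega> i)" if "i \<ge> 1" for i
    using that by (auto simp: sU_def sV_def)
  have Um: "U i \<in> borel_measurable M" and Vm: "V i \<in> borel_measurable M" if "i \<ge> 1" for i
    unfolding Ui[OF that] Vi[OF that] by (rule measurable_compose[OF _ comp[OF that]], rule s)+
  have pUm: "pU \<in> measurable M ?P" and pVm: "pV \<in> measurable M ?P"
    unfolding pU pV by (rule measurable_compose[OF _ res], rule s)+
  let ?A = "{U (Suc m) -` A \<inter> space M | A. A \<in> sets borel}"
  let ?B = "{pU -` A \<inter> space M | A. A \<in> sets ?P}"
  let ?C = "{pV -` A \<inter> space M | A. A \<in> sets ?P}"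
  let ?G = "{b \<inter> c | b c. b \<in> ?B \<and> c \<in> ?C}"
  have AB: "prob (a \<inter> b) = prob a * prob b" if "a \<in> ?A" "b \<in> ?B" for a b
  proof -
    let ?P1 = "PiM {Suc m} (\<lambda>_. borel :: real measure)"
    define p1 where "p1 = (\<lambda>\<omega>. \<lambda>i\<in>{Suc m}. U i \<omega>)"
    have i1: "indep_var ?P1 p1 ?P pU"
      unfolding pU_def p1_def by (rule indep_var_restrict[OF U]) auto
    from that(1) obtain E where E: "a = U (Suc m) -` E \<inter> space M" "E \<in> sets borel" by auto
    have "a = p1 -` ((\<lambda>f. f (Suc m)) -` E \<inter> space ?P1) \<inter> space M"
      unfolding E p1_def by (auto simp: space_PiM)
    moreover have "(\<lambda>f. f (Suc m)) -` E \<inter> space ?P1 \<in> sets ?P1"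
      
    proof (rule measurable_sets[OF _ E(2)])
      show "(\<lambda>f. f (Suc m)) \<in> borel_measurable ?P1"
        by (rule measurable_component_singleton) simp
    qed
    ultimately have "a \<in> {p1 -` A \<inter> space M |A. A \<in> sets ?P1}" by blast
    then show ?thesis
      using i1 that(2) unfolding indep_var_eq
      by (intro indep_setD[of "sigma_sets (space M) {p1 -` A \<inter> space M |A. A \<in> sets ?P1}"
            "sigma_sets (space M) {pU -` A \<inter> space M |A. A \<in> sets ?P}"])
        (blast intro: sigma_sets.Basic)+
  qed
  \<comment> \<open>Stated for an arbitrary event of the whole sequence \<open>U\<close>, because it
    is used both for \<open>a \<inter> b\<close> and for \<open>b\<close> alone.\<close>
  have SC: "prob (sU -` D \<inter> space M \<inter> c) = prob (sU -` D \<inter> space M) * prob c" if "D \<in> sets ?Q" "c \<in> ?C" for D c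
  proof -
    from that obtain E where E: "c = pV -` E \<inter> space M" "E \<in> sets ?P" by auto
    have "c = sV -` ((\<lambda>f. restrict f {1..m}) -` E \<inter> space ?Q) \<inter> space M"
      using measurable_space[OF s(2)] unfolding E pV by auto
    moreover have "(\<lambda>f. restrict f {1..m}) -` E \<inter> space ?Q \<in> sets ?Q"
      by (rule measurable_sets[OF res E(2)])
    ultimately have "c \<in> {sV -` A \<inter> space M |A. A \<in> sets ?Q}" by blast
    then show ?thesis
      using UV that(1) unfolding indep_var_eq sU_def[symmetric] sV_def[symmetric]
      by (intro indep_setD[of "sigma_sets (space M) {sU -` A \<inter> space M |A. A \<in> sets ?Q}"
            "sigma_sets (space M) {sV -` A \<inter> space M |A. A \<in> sets ?Q}"])
        (blast intro: sigma_sets.Basic)+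
  qed
  have pre: "\<exists>D\<in>sets ?Q. b = sU -` D \<inter> space M" if "b \<in> ?B" for b
  proof -
    from that obtain E where E: "b = pU -` E \<inter> space M" "E \<in> sets ?P" by auto
    have "b = sU -` ((\<lambda>f. restrict f {1..m}) -` E \<inter> space ?Q) \<inter> space M"
      using measurable_space[OF s(1)] unfolding E pU by auto
    moreover have "(\<lambda>f. restrict f {1..m}) -` E \<inter> space ?Q \<in> sets ?Q"
      by (rule measurable_sets[OF res E(2)])
    ultimately show ?thesis by blast
  qed
  have preA: "\<exists>D\<in>sets ?Q. a = sU -` D \<inter> space M" if "a \<in> ?A" for a
  proof -
    from that obtain E where E: "a = U (Suc m) -` E \<inter> space M" "E \<in> sets borel" by auto
    have "a = sU -` ((\<lambda>f. f (Suc m)) -` E \<inter> space ?Q) \<inter> space M"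
      using measurable_space[OF s(1)] unfolding E Ui[of "Suc m", simplified] by auto
    moreover have "(\<lambda>f. f (Suc m)) -` E \<inter> space ?Q \<in> sets ?Q"
      using comp[of "Suc m"] E by (auto intro: measurable_sets)
    ultimately show ?thesis by blast
  qed
  have ind: "indep_set ?A ?G"
  proof (rule indep_setI)
    show "?A \<subseteq> events" using Um[of "Suc m"] by auto
    show "?G \<subseteq> events" using pUm pVm by (auto intro!: sets.Int measurable_sets)
  next
    fix a g assume a: "a \<in> ?A" and "g \<in> ?G"
    then obtain b c where g: "g = b \<inter> c" "b \<in> ?B" "c \<in> ?C" by blast
    obtain D1 where D1: "D1 \<in> sets ?Q" "a = sU -` D1 \<inter> space M" using preA[OF a] by auto
    obtain D2 where D2: "D2 \<in> sets ?Q" "b = sU -` D2 \<inter> space M" using pre[OF g(2)] by auto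
    have ab: "a \<inter> b = sU -` (D1 \<inter> D2) \<inter> space M" using D1 D2 by auto
    have "prob (a \<inter> g) = prob (sU -` (D1 \<inter> D2) \<inter> space M \<inter> c)" unfolding ab[symmetric] g by (simp add: Int_assoc)
    also have "\<dots> = prob (a \<inter> b) * prob c" using SC[of "D1 \<inter> D2" c] D1 D2 g unfolding ab by auto
    also have "\<dots> = prob a * (prob b * prob c)" using AB[OF a g(2)] by simp
    also have "prob b * prob c = prob g" using SC[OF D2(1) g(3)] unfolding g D2 by simp
    finally show "prob (a \<inter> g) = prob a * prob g" .
  qed
  have stab: "Int_stable {X -` A \<inter> space M | A. A \<in> sets N}" for X :: "'a \<Rightarrow> 'b" and N :: "'b measure"
  proof (rule Int_stableI)
    fix a b assume "a \<in> {X -` A \<inter> space M | A. A \<in> sets N}" "b \<in> {X -` A \<inter> space M | A. A \<in> sets N}"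
    then obtain A B where "a = X -` A \<inter> space M" "b = X -` B \<inter> space M" "A \<in> sets N" "B \<in> sets N" by auto
    then have "a \<inter> b = X -` (A \<inter> B) \<inter> space M" "A \<inter> B \<in> sets N" by auto
    then show "a \<inter> b \<in> {X -` A \<inter> space M | A. A \<in> sets N}" by blast
  qed
  have stabG: "Int_stable ?G"
  proof (rule Int_stableI)
    fix g g' assume "g \<in> ?G" "g' \<in> ?G"
    then obtain b c b' c' where g: "g = b \<inter> c" "b \<in> ?B" "c \<in> ?C" "g' = b' \<inter> c'" "b' \<in> ?B" "c' \<in> ?C" by blast
    have "b \<inter> b' \<in> ?B" using g stab[of pU ?P] unfolding Int_stable_def by blast
    moreover have "c \<inter> c' \<in> ?C" using g stab[of pV ?P] unfolding Int_stable_def by blast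
    moreover have "g \<inter> g' = (b \<inter> b') \<inter> (c \<inter> c')" using g by auto
    ultimately show "g \<inter> g' \<in> ?G" by blast
  qed
  have sig: "indep_set (sigma_sets (space M) ?A) (sigma_sets (space M) ?G)"
    by (rule indep_set_sigma_sets[OF ind stab stabG])
  \<comment> \<open>An event of a single coordinate is a rectangle whose other side is
    \<open>space M\<close>, so the sigma-algebra generated by the rectangles is large enough and
    independence is inherited.\<close>
  have "(\<Union>i\<in>{1..m}. {U i -` A \<inter> space M | A. A \<in> sets borel}
       \<union> {V i -` A \<inter> space M | A. A \<in> sets borel}) \<subseteq> ?G"
  proof -
    have topB: "space M \<in> ?B" "space M \<in> ?C"
      using measurable_space[OF pUm] measurable_space[OF pVm]
      by (auto intro!: exI[of _ "space ?P"])
    have compP: "(\<lambda>f. f i) \<in> borel_measurable ?P" if "i \<in> {1..m}" for i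
      using that by (intro measurable_component_singleton) auto
    have memU: "U i -` A \<inter> space M \<in> ?B" and memV: "V i -` A \<inter> space M \<in> ?C"
      if "i \<in> {1..m}" "A \<in> sets borel" for i A
    proof -
      have "U i -` A \<inter> space M = pU -` ((\<lambda>f. f i) -` A \<inter> space ?P) \<inter> space M"
        "V i -` A \<inter> space M = pV -` ((\<lambda>f. f i) -` A \<inter> space ?P) \<inter> space M"
        using that measurable_space[OF pUm] measurable_space[OF pVm] by (auto simp: pU_def pV_def)
      moreover have "(\<lambda>f. f i) -` A \<inter> space ?P \<in> sets ?P"
        using compP[OF that(1)] that(2) by (rule measurable_sets)
      ultimately show "U i -` A \<inter> space M \<in> ?B" "V i -` A \<inter> space M \<in> ?C" by blast+
    qed
    show ?thesis
    proof (rule UN_least, rule Un_least; safe)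
      fix i A assume i: "i \<in> {1..m}" and A: "A \<in> sets (borel :: real measure)"
      show "\<exists>b c. U i -` A \<inter> space M = b \<inter> c \<and> b \<in> ?B \<and> c \<in> ?C"
        using memU[OF i A] topB by (intro exI[of _ "U i -` A \<inter> space M"] exI[of _ "space M"]) auto
      show "\<exists>b c. V i -` A \<inter> space M = b \<inter> c \<and> b \<in> ?B \<and> c \<in> ?C"
        using memV[OF i A] topB by (intro exI[of _ "space M"] exI[of _ "V i -` A \<inter> space M"]) auto
    qed
  qed
  then have "sigma_sets (space M) (\<Union>i\<in>{1..m}. {U i -` A \<inter> space M | A. A \<in> sets borel}
       \<union> {V i -` A \<inter> space M | A. A \<in> sets borel}) \<subseteq> sigma_sets (space M) ?G"
    by (rule sigma_sets_mono')
  with sig show ?thesis by (rule indep_set_mono_right)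
qed

section \<open>Measurability with respect to the history\<close>

lemma sets_history:
  "sets (history M WL WR \<theta> n) = sigma_sets (space M)
    (\<Union>i\<in>{1..n}. {reward WL WR \<theta> i -` A \<inter> space M | A. A \<in> sets borel})"
  unfolding history_def by (rule sets_measure_of) auto

lemma space_history [simp]: "space (history M WL WR \<theta> n) = space M"
  unfolding history_def by (rule space_measure_of) auto

lemma sets_history_mono:
  "m \<le> n \<Longrightarrow> sets (history M WL WR \<theta> m) \<subseteq> sets (history M WL WR \<theta> n)"
  unfolding sets_history by (intro sigma_sets_mono' UN_mono) auto

lemma reward_measurable_history:
  "i \<in> {1..n} \<Longrightarrow> reward WL WR \<theta> i \<in> borel_measurable (history M WL WR \<theta> n)"
proof -
  assume "i \<in> {1..n}"
  then have "{reward WL WR \<theta> i -` A \<inter> space M | A. A \<in> sets borel} \<subseteq>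
      (\<Union>i\<in>{1..n}. {reward WL WR \<theta> i -` A \<inter> space M | A. A \<in> sets borel})"
    by (rule UN_upper)
  also have "\<dots> \<subseteq> sets (history M WL WR \<theta> n)"
    unfolding sets_history by (rule sigma_sets_superset_generator)
  finally have sub: "{reward WL WR \<theta> i -` A \<inter> space M | A. A \<in> sets borel} \<subseteq> sets (history M WL WR \<theta> n)" .
  show ?thesis by (rule measurableI; simp; use sub in blast)
qed

lemma measurable_sets_mono:
  assumes "f \<in> measurable M N" "sets M \<subseteq> sets M'" "space M = space M'"
  shows "f \<in> measurable M' N"
  using assms unfolding measurable_def by auto

text \<open>Valid for every strategy, because a conditional expectation is by construction
  measurable for the conditioning sigma-algebra. This is what allows
  \<open>nonanticipating_threshold\<close> to be proved without circularity.\<close>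

lemma T_stat_measurable_history:
  "T_stat M \<sigma> WL WR \<theta> m n \<in> borel_measurable (history M WL WR \<theta> m)"
proof -
  have 1: "reward WL WR \<theta> i \<in> borel_measurable (history M WL WR \<theta> m)" if "i \<in> {1..m}" for i
    using that by (rule reward_measurable_history)
  have 2: "real_cond_exp M (history M WL WR \<theta> (i - 1)) (reward WL WR \<theta> i)
      \<in> borel_measurable (history M WL WR \<theta> m)" if "i \<in> {1..m}" for i
    using that by (intro measurable_sets_mono[OF borel_measurable_cond_exp] sets_history_mono) auto
  show ?thesis
    unfolding T_stat_def[abs_def]
    by (intro borel_measurable_add borel_measurable_times borel_measurable_sum borel_measurable_diff
        borel_measurable_const 1 2) auto
qed

section \<open>The bandit model: full past and admissibility\<close>

locale two_armed_bandit = prob_space M for M :: "'a measure" +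
  fixes XL XR :: "'a \<Rightarrow> real" and WL WR :: "nat \<Rightarrow> 'a \<Rightarrow> real" and \<mu>L \<mu>R \<sigma> :: real
  assumes XL: "integrable M XL" "integrable M (\<lambda>\<omega>. (XL \<omega>)\<^sup>2)"
    and XR: "integrable M XR" "integrable M (\<lambda>\<omega>. (XR \<omega>)\<^sup>2)"
    and means: "\<mu>L = expectation XL" "\<mu>R = expectation XR"
    and \<sigma>_pos: "\<sigma> > 0"
    and variances: "variance XL = \<sigma>\<^sup>2" "variance XR = \<sigma>\<^sup>2"
    and distr_WL: "\<And>i. i \<ge> 1 \<Longrightarrow> distr M borel (WL i) = distr M borel XL"
    and distr_WR: "\<And>i. i \<ge> 1 \<Longrightarrow> distr M borel (WR i) = distr M borel XR"
    and indep_WL: "indep_vars (\<lambda>_. borel) WL {1..}"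
    and indep_WR: "indep_vars (\<lambda>_. borel) WR {1..}"
    and indep_WL_WR: "indep_var
           (PiM {1..} (\<lambda>_. borel)) (\<lambda>\<omega>. \<lambda>i\<in>{1..}. WL i \<omega>)
           (PiM {1..} (\<lambda>_. borel)) (\<lambda>\<omega>. \<lambda>i\<in>{1..}. WR i \<omega>)"
begin

lemma W_measurable:
  assumes "i \<ge> 1"
  shows "WL i \<in> borel_measurable M" "WR i \<in> borel_measurable M"
  using indep_WL indep_WR assms by (auto simp: indep_vars_def)

lemma indep_WR_WL: "indep_var
           (PiM {1..} (\<lambda>_. borel)) (\<lambda>\<omega>. \<lambda>i\<in>{1..}. WR i \<omega>)
           (PiM {1..} (\<lambda>_. borel)) (\<lambda>\<omega>. \<lambda>i\<in>{1..}. WL i \<omega>)"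
proof -
  have "indep_set B A" if "indep_set A B" for A B
    using that unfolding indep_sets2_eq by (metis Int_commute mult.commute)
  then show ?thesis using indep_WL_WR unfolding indep_var_eq by blast
qed

lemma W_expectation:
  fixes f :: "real \<Rightarrow> real"
  assumes "i \<ge> 1" "f \<in> borel_measurable borel"
  shows "(\<integral>\<omega>. f (WL i \<omega>) \<partial>M) = (\<integral>\<omega>. f (XL \<omega>) \<partial>M)"
    and "(\<integral>\<omega>. f (WR i \<omega>) \<partial>M) = (\<integral>\<omega>. f (XR \<omega>) \<partial>M)"
    and "integrable M (\<lambda>\<omega>. f (WL i \<omega>)) \<longleftrightarrow> integrable M (\<lambda>\<omega>. f (XL \<omega>))"
    and "integrable M (\<lambda>\<omega>. f (WR i \<omega>)) \<longleftrightarrow> integrable M (\<lambda>\<omega>. f (XR \<omega>))"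
proof -
  have m: "XL \<in> borel_measurable M" "XR \<in> borel_measurable M" using XL XR by auto
  note W = W_measurable[OF assms(1)]
  show "(\<integral>\<omega>. f (WL i \<omega>) \<partial>M) = (\<integral>\<omega>. f (XL \<omega>) \<partial>M)"
    using integral_distr[OF W(1) assms(2)] integral_distr[OF m(1) assms(2)] distr_WL[OF assms(1)] by simp
  show "(\<integral>\<omega>. f (WR i \<omega>) \<partial>M) = (\<integral>\<omega>. f (XR \<omega>) \<partial>M)"
    using integral_distr[OF W(2) assms(2)] integral_distr[OF m(2) assms(2)] distr_WR[OF assms(1)] by simp
  show "integrable M (\<lambda>\<omega>. f (WL i \<omega>)) \<longleftrightarrow> integrable M (\<lambda>\<omega>. f (XL \<omega>))"
    using integrable_distr_eq[OF W(1) assms(2)] integrable_distr_eq[OF m(1) assms(2)] distr_WL[OF assms(1)] by simp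
  show "integrable M (\<lambda>\<omega>. f (WR i \<omega>)) \<longleftrightarrow> integrable M (\<lambda>\<omega>. f (XR \<omega>))"
    using integrable_distr_eq[OF W(2) assms(2)] integrable_distr_eq[OF m(2) assms(2)] distr_WR[OF assms(1)] by simp
qed

lemma square_integrable_shift:
  fixes X :: "'a \<Rightarrow> real"
  assumes "integrable M X" "integrable M (\<lambda>\<omega>. (X \<omega>)\<^sup>2)"
  shows "integrable M (\<lambda>\<omega>. (X \<omega> - \<mu>)\<^sup>2)"
  using assms by (simp add: power2_diff)

lemma W_moments:
  assumes "i \<ge> 1"
  shows "integrable M (WL i)" "integrable M (WR i)"
    "expectation (WL i) = \<mu>L" "expectation (WR i) = \<mu>R"
    "integrable M (\<lambda>\<omega>. (WL i \<omega> - \<mu>L)\<^sup>2)" "integrable M (\<lambda>\<omega>. (WR i \<omega> - \<mu>R)\<^sup>2)"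
    "expectation (\<lambda>\<omega>. (WL i \<omega> - \<mu>L)\<^sup>2) = \<sigma>\<^sup>2" "expectation (\<lambda>\<omega>. (WR i \<omega> - \<mu>R)\<^sup>2) = \<sigma>\<^sup>2"
  using W_expectation[OF assms, of "\<lambda>x. x"] XL XR means variances
    W_expectation(1,3)[OF assms, of "\<lambda>x. (x - \<mu>L)\<^sup>2"] W_expectation(2,4)[OF assms, of "\<lambda>x. (x - \<mu>R)\<^sup>2"]
    square_integrable_shift[OF XL, of \<mu>L] square_integrable_shift[OF XR, of \<mu>R]
  by auto

text \<open>Contains the rewards of both arms, including those of arms not played. Unlike the
  history it does not depend on the strategy, and the next reward of either arm is independent of
  it.\<close>

definition past :: "nat \<Rightarrow> 'a measure" where
  "past m = sigma (space M) (\<Union>i\<in>{1..m}. {WL i -` A \<inter> space M | A. A \<in> sets borel}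
       \<union> {WR i -` A \<inter> space M | A. A \<in> sets borel})"

lemma sets_past: "sets (past m) = sigma_sets (space M)
    (\<Union>i\<in>{1..m}. {WL i -` A \<inter> space M | A. A \<in> sets borel}
       \<union> {WR i -` A \<inter> space M | A. A \<in> sets borel})"
  unfolding past_def by (rule sets_measure_of) auto

lemma space_past [simp]: "space (past m) = space M"
  unfolding past_def by (rule space_measure_of) auto

lemma sets_past_mono: "m \<le> n \<Longrightarrow> sets (past m) \<subseteq> sets (past n)"
  unfolding sets_past by (intro sigma_sets_mono' UN_mono) auto

lemma subalgebra_past: "subalgebra M (past m)"
proof -
  have "(\<Union>i\<in>{1..m}. {WL i -` A \<inter> space M | A. A \<in> sets borel}
       \<union> {WR i -` A \<inter> space M | A. A \<in> sets borel}) \<subseteq> sets M"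
    using W_measurable by auto
  then show ?thesis
    unfolding subalgebra_def sets_past space_past by (intro conjI refl sets.sigma_sets_subset)
qed

lemma W_measurable_past:
  assumes "i \<in> {1..m}"
  shows "WL i \<in> borel_measurable (past m)" "WR i \<in> borel_measurable (past m)"
proof -
  have "{WL i -` A \<inter> space M | A. A \<in> sets borel} \<union> {WR i -` A \<inter> space M | A. A \<in> sets borel}
      \<subseteq> (\<Union>i\<in>{1..m}. {WL i -` A \<inter> space M | A. A \<in> sets borel}
       \<union> {WR i -` A \<inter> space M | A. A \<in> sets borel})"
    using assms by (rule UN_upper)
  also have "\<dots> \<subseteq> sets (past m)" unfolding sets_past by (rule sigma_sets_superset_generator)
  finally have sub: "{WL i -` A \<inter> space M | A. A \<in> sets borel} \<union> {WR i -` A \<inter> space M | A. A \<in> sets borel}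
    \<subseteq> sets (past m)" .
  show "WL i \<in> borel_measurable (past m)" "WR i \<in> borel_measurable (past m)"
    by (rule measurableI; simp; use sub in blast)+
qed

lemma indep_past:
  "indep_set (sigma_sets (space M) {WL (Suc m) -` A \<inter> space M | A. A \<in> sets borel}) (sets (past m))"
  "indep_set (sigma_sets (space M) {WR (Suc m) -` A \<inter> space M | A. A \<in> sets borel}) (sets (past m))"
proof -
  show "indep_set (sigma_sets (space M) {WL (Suc m) -` A \<inter> space M | A. A \<in> sets borel}) (sets (past m))"
    unfolding sets_past by (rule indep_set_next_round[OF indep_WL indep_WL_WR])
  have "sets (past m) = sigma_sets (space M)
    (\<Union>i\<in>{1..m}. {WR i -` A \<inter> space M | A. A \<in> sets borel}
       \<union> {WL i -` A \<inter> space M | A. A \<in> sets borel})"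
    unfolding sets_past by (intro arg_cong[where f = "sigma_sets (space M)"] SUP_cong refl Un_commute)
  then show "indep_set (sigma_sets (space M) {WR (Suc m) -` A \<inter> space M | A. A \<in> sets borel}) (sets (past m))"
    using indep_set_next_round[OF indep_WR indep_WR_WL] by simp
qed

text \<open>A product rule for fresh rewards against past factors; it takes the place of
  conditioning on the past in the one-round expansion.\<close>

lemma expectation_past_mult:
  fixes f :: "real \<Rightarrow> real"
  assumes X: "X \<in> borel_measurable (past m)" "integrable M X" and f: "f \<in> borel_measurable borel"
  shows "integrable M (\<lambda>\<omega>. f (WL (Suc m) \<omega>)) \<Longrightarrow>
      integrable M (\<lambda>\<omega>. f (WL (Suc m) \<omega>) * X \<omega>) \<and>
      expectation (\<lambda>\<omega>. f (WL (Suc m) \<omega>) * X \<omega>) = expectation (\<lambda>\<omega>. f (WL (Suc m) \<omega>)) * expectation X"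
    and "integrable M (\<lambda>\<omega>. f (WR (Suc m) \<omega>)) \<Longrightarrow>
      integrable M (\<lambda>\<omega>. f (WR (Suc m) \<omega>) * X \<omega>) \<and>
      expectation (\<lambda>\<omega>. f (WR (Suc m) \<omega>) * X \<omega>) = expectation (\<lambda>\<omega>. f (WR (Suc m) \<omega>)) * expectation X"
proof -
  have gen: "integrable M (\<lambda>\<omega>. f (W \<omega>)) \<Longrightarrow> integrable M (\<lambda>\<omega>. f (W \<omega>) * X \<omega>) \<and>
      expectation (\<lambda>\<omega>. f (W \<omega>) * X \<omega>) = expectation (\<lambda>\<omega>. f (W \<omega>)) * expectation X"
    if W: "W \<in> borel_measurable M"
      "indep_set (sigma_sets (space M) {W -` A \<inter> space M | A. A \<in> sets borel}) (sets (past m))" for W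
  proof -
    assume int: "integrable M (\<lambda>\<omega>. f (W \<omega>))"
    have "sigma_sets (space M) {X -` A \<inter> space M |A. A \<in> sets borel} \<subseteq> sets (past m)"
    proof -
      have "{X -` A \<inter> space M |A. A \<in> sets borel} \<subseteq> sets (past m)"
        using measurable_sets[OF X(1)] by auto
      from sets.sigma_sets_subset[OF this] show ?thesis by simp
    qed
    then have "indep_set (sigma_sets (space M) {W -` A \<inter> space M | A. A \<in> sets borel})
        (sigma_sets (space M) {X -` A \<inter> space M |A. A \<in> sets borel})"
      by (rule indep_set_mono_right[OF W(2)])
    then have "indep_var borel W borel X"
      using W(1) X(2) unfolding indep_var_eq by auto
    from indep_var_compose[OF this f, of "\<lambda>x. x" borel]
    have "indep_var borel (\<lambda>\<omega>. f (W \<omega>)) borel X" by (simp add: o_def)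
    from indep_var_integrable[OF this int X(2)] indep_var_lebesgue_integral[OF this int X(2)]
    show ?thesis by simp
  qed
  show "integrable M (\<lambda>\<omega>. f (WL (Suc m) \<omega>)) \<Longrightarrow>
      integrable M (\<lambda>\<omega>. f (WL (Suc m) \<omega>) * X \<omega>) \<and>
      expectation (\<lambda>\<omega>. f (WL (Suc m) \<omega>) * X \<omega>) = expectation (\<lambda>\<omega>. f (WL (Suc m) \<omega>)) * expectation X"
    by (rule gen[OF W_measurable(1) indep_past(1)]) auto
  show "integrable M (\<lambda>\<omega>. f (WR (Suc m) \<omega>)) \<Longrightarrow>
      integrable M (\<lambda>\<omega>. f (WR (Suc m) \<omega>) * X \<omega>) \<and>
      expectation (\<lambda>\<omega>. f (WR (Suc m) \<omega>) * X \<omega>) = expectation (\<lambda>\<omega>. f (WR (Suc m) \<omega>)) * expectation X"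
    by (rule gen[OF W_measurable(2) indep_past(2)]) auto
qed

text \<open>Admissibility without the requirement that the choices be random variables on
  \<open>M\<close>; \<open>admissible_iff\<close> recovers the latter.\<close>

definition nonanticipating :: "(nat \<Rightarrow> 'a \<Rightarrow> nat) \<Rightarrow> bool" where
  "nonanticipating \<theta> \<longleftrightarrow>
    (\<forall>n\<ge>1. \<theta> n \<in> measurable (history M WL WR \<theta> (n - 1)) (count_space {1, 2}))"

text \<open>A history is generated by rewards that depend on the choices, so its events need not lie
  in \<open>M\<close> a priori. Strong induction resolves this: the choice in round \<open>i\<close>
  is measurable for the history up to \<open>i - 1\<close>, hence for the past up to
  \<open>i - 1\<close>, and therefore the reward of round \<open>i\<close> is measurable for the
  past up to \<open>i\<close>.\<close>

lemma history_subset_past: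
  assumes "nonanticipating \<theta>"
  shows "sets (history M WL WR \<theta> n) \<subseteq> sets (past n)"
proof (induction n rule: less_induct)
  case (less n)
  have "reward WL WR \<theta> i \<in> borel_measurable (past n)" if i: "i \<in> {1..n}" for i
  proof -
    have "sets (history M WL WR \<theta> (i - 1)) \<subseteq> sets (past (i - 1))"
      using i by (intro less) auto
    also have "\<dots> \<subseteq> sets (past n)" using i by (intro sets_past_mono) auto
    finally have sub: "sets (history M WL WR \<theta> (i - 1)) \<subseteq> sets (past n)" .
    have "\<theta> i \<in> measurable (history M WL WR \<theta> (i - 1)) (count_space {1, 2})"
      using assms i unfolding nonanticipating_def atLeastAtMost_iff by blast
    from measurable_sets_mono[OF this sub]
    have [measurable]: "\<theta> i \<in> measurable (past n) (count_space {1, 2})" by simp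
    have [measurable]: "WL i \<in> borel_measurable (past n)" "WR i \<in> borel_measurable (past n)"
      using W_measurable_past i by auto
    have "Measurable.pred (past n) (\<lambda>\<omega>. \<theta> i \<omega> = 1)" by measurable
    then show ?thesis unfolding reward_def[abs_def] by measurable
  qed
  from measurable_sets[OF this]
  have "(\<Union>i\<in>{1..n}. {reward WL WR \<theta> i -` A \<inter> space M | A. A \<in> sets borel}) \<subseteq> sets (past n)"
    by (intro UN_least) auto
  then show ?case
    unfolding sets_history using sets.sigma_sets_subset[of _ "past n"] by simp
qed

lemma subalgebra_history: "nonanticipating \<theta> \<Longrightarrow> subalgebra M (history M WL WR \<theta> n)"
  using history_subset_past[of \<theta> n] subalgebra_past[of n] unfolding subalgebra_def by auto

lemma choice_measurable:
  assumes "nonanticipating \<theta>"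
  shows "\<theta> (Suc m) \<in> measurable (history M WL WR \<theta> m) (count_space {1, 2})"
    "\<theta> (Suc m) \<in> measurable (past m) (count_space {1, 2})"
    "\<theta> (Suc m) \<in> measurable M (count_space {1, 2})"
proof -
  show 1: "\<theta> (Suc m) \<in> measurable (history M WL WR \<theta> m) (count_space {1, 2})"
    using assms unfolding nonanticipating_def by (metis diff_Suc_1 le_add1 plus_1_eq_Suc)
  show 2: "\<theta> (Suc m) \<in> measurable (past m) (count_space {1, 2})"
    by (rule measurable_sets_mono[OF 1 history_subset_past[OF assms]]) simp
  show "\<theta> (Suc m) \<in> measurable M (count_space {1, 2})"
    using 2 subalgebra_past measurable_from_subalg by blast
qed

lemma admissible_iff: "\<theta> \<in> admissible_strategies M WL WR \<longleftrightarrow> nonanticipating \<theta>"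
proof -
  have "sampling_strategy M \<theta>" if "nonanticipating \<theta>"
    unfolding sampling_strategy_def
  proof safe
    fix n :: nat assume "1 \<le> n"
    then show "\<theta> n \<in> measurable M (count_space {1, 2})"
      using choice_measurable(3)[OF that, of "n - 1"] by simp
  qed
  then show ?thesis by (auto simp: admissible_strategies_def nonanticipating_def)
qed

lemma nonanticipating_threshold:
  "nonanticipating (threshold_strategy M \<sigma> WL WR \<mu>u \<mu>l n c)"
  unfolding nonanticipating_def
proof safe
  fix m :: nat assume m: "1 \<le> m"
  let ?\<theta> = "threshold_strategy M \<sigma> WL WR \<mu>u \<mu>l n c"
  have [measurable]: "T_stat M \<sigma> WL WR ?\<theta> (m - 1) n \<in> borel_measurable (history M WL WR ?\<theta> (m - 1))"
    by (rule T_stat_measurable_history)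
  have "?\<theta> m = (\<lambda>\<omega>. if T_stat M \<sigma> WL WR ?\<theta> (m - 1) n \<omega>
      \<le> c - (1 - real (m - 1) / real n) * ((\<mu>u + \<mu>l) / 2) then 1 else 2)"
    by (rule ext) (rule threshold_strategy_rec[OF m])
  also have "\<dots> \<in> measurable (history M WL WR ?\<theta> (m - 1)) (count_space {1, 2})"
    by measurable
  finally show "?\<theta> m \<in> measurable (history M WL WR ?\<theta> (m - 1)) (count_space {1, 2})" .
qed

end

section \<open>Second-order expansion of one round\<close>

context two_armed_bandit
begin

text \<open>The choice is determined by the past, so \<open>Q\<close> splits into past-measurable
  parts on the two choice events. On each part the fresh reward is independent of the factor and may
  be replaced by its mean.\<close>

lemma expectation_choice_mult:
  fixes fL fR :: "real \<Rightarrow> real"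
  assumes \<theta>: "nonanticipating \<theta>"
    and Q: "Q \<in> borel_measurable (past m)" "\<And>\<omega>. \<bar>Q \<omega>\<bar> \<le> B"
    and f: "fL \<in> borel_measurable borel" "fR \<in> borel_measurable borel"
    and int: "integrable M (\<lambda>\<omega>. fL (WL (Suc m) \<omega>))" "integrable M (\<lambda>\<omega>. fR (WR (Suc m) \<omega>))"
  shows "integrable M (\<lambda>\<omega>. Q \<omega> * (if \<theta> (Suc m) \<omega> = 1 then fL (WL (Suc m) \<omega>) else fR (WR (Suc m) \<omega>)))"
    and "expectation (\<lambda>\<omega>. Q \<omega> * (if \<theta> (Suc m) \<omega> = 1 then fL (WL (Suc m) \<omega>) else fR (WR (Suc m) \<omega>)))
      = expectation (\<lambda>\<omega>. Q \<omega> * (if \<theta> (Suc m) \<omega> = 1 then expectation (\<lambda>\<omega>. fL (WL (Suc m) \<omega>))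
          else expectation (\<lambda>\<omega>. fR (WR (Suc m) \<omega>))))"
proof -
  note [measurable] = choice_measurable(2)[OF \<theta>, of m] Q(1)
  have p[measurable]: "Measurable.pred (past m) (\<lambda>\<omega>. \<theta> (Suc m) \<omega> = 1)" by measurable
  define Q1 where "Q1 = (\<lambda>\<omega>. if \<theta> (Suc m) \<omega> = 1 then Q \<omega> else 0)"
  define Q2 where "Q2 = (\<lambda>\<omega>. if \<theta> (Suc m) \<omega> = 1 then 0 else Q \<omega>)"
  have m: "Q1 \<in> borel_measurable (past m)" "Q2 \<in> borel_measurable (past m)"
    unfolding Q1_def Q2_def by measurable
  have i: "integrable M Q1" "integrable M Q2"
    using m[THEN measurable_from_subalg[OF subalgebra_past]] Q(2) order_trans[OF abs_ge_zero Q(2)]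
    by (auto intro!: integrable_const_bound[of _ B] simp: Q1_def Q2_def)
  have eq: "Q \<omega> * (if \<theta> (Suc m) \<omega> = 1 then u else v) = u * Q1 \<omega> + v * Q2 \<omega>" for \<omega> u v
    by (simp add: Q1_def Q2_def)
  note L = expectation_past_mult(1)[OF m(1) i(1) f(1) int(1)]
  note R = expectation_past_mult(2)[OF m(2) i(2) f(2) int(2)]
  show "integrable M (\<lambda>\<omega>. Q \<omega> * (if \<theta> (Suc m) \<omega> = 1 then fL (WL (Suc m) \<omega>) else fR (WR (Suc m) \<omega>)))"
    unfolding eq using L R by (intro Bochner_Integration.integrable_add) auto
  show "expectation (\<lambda>\<omega>. Q \<omega> * (if \<theta> (Suc m) \<omega> = 1 then fL (WL (Suc m) \<omega>) else fR (WR (Suc m) \<omega>)))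
      = expectation (\<lambda>\<omega>. Q \<omega> * (if \<theta> (Suc m) \<omega> = 1 then expectation (\<lambda>\<omega>. fL (WL (Suc m) \<omega>))
          else expectation (\<lambda>\<omega>. fR (WR (Suc m) \<omega>))))"
    unfolding eq using L R i by simp
qed

text \<open>The defining integral identity over a history event is
  \<open>expectation_choice_mult\<close> with the indicator of that event as
  \<open>Q\<close>.\<close>

lemma cond_exp_reward:
  assumes \<theta>: "nonanticipating \<theta>"
  shows "AE \<omega> in M. real_cond_exp M (history M WL WR \<theta> m) (reward WL WR \<theta> (Suc m)) \<omega>
    = (if \<theta> (Suc m) \<omega> = 1 then \<mu>L else \<mu>R)"
proof -
  interpret H: finite_measure_subalgebra M "history M WL WR \<theta> m"
    by unfold_locales (rule subalgebra_history[OF \<theta>])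
  note [measurable] = choice_measurable(1)[OF \<theta>, of m]
  have p[measurable]: "Measurable.pred (history M WL WR \<theta> m) (\<lambda>\<omega>. \<theta> (Suc m) \<omega> = 1)" by measurable
  have mm: "(\<lambda>\<omega>. if \<theta> (Suc m) \<omega> = 1 then \<mu>L else \<mu>R) \<in> borel_measurable (history M WL WR \<theta> m)"
    by measurable
  have W: "integrable M (WL (Suc m))" "integrable M (WR (Suc m))" using W_moments[of "Suc m"] by auto
  show ?thesis
  proof (rule H.real_cond_exp_charact)
    fix A assume A: "A \<in> sets (history M WL WR \<theta> m)"
    then have "A \<in> sets (past m)" using history_subset_past[OF \<theta>] by blast
    then have "(indicator A :: 'a \<Rightarrow> real) \<in> borel_measurable (past m)" by measurable
    from expectation_choice_mult(2)[OF \<theta> this, of 1 "\<lambda>x. x" "\<lambda>x. x"] W W_moments[of "Suc m"]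
    show "(\<integral>x\<in>A. reward WL WR \<theta> (Suc m) x \<partial>M) = (\<integral>x\<in>A. (if \<theta> (Suc m) x = 1 then \<mu>L else \<mu>R) \<partial>M)"
      by (simp add: set_lebesgue_integral_def reward_def cong: if_cong)
  next
    show "integrable M (reward WL WR \<theta> (Suc m))"
    proof -
      have "(\<lambda>_. 1 :: real) \<in> borel_measurable (past m)" by simp
      from expectation_choice_mult(1)[OF \<theta> this, of 1 "\<lambda>x. x" "\<lambda>x. x", OF _ _ _ W]
      moreover have "reward WL WR \<theta> (Suc m) = (\<lambda>\<omega>. if \<theta> (Suc m) \<omega> = 1 then WL (Suc m) \<omega> else WR (Suc m) \<omega>)"
        by (simp add: reward_def fun_eq_iff)
      ultimately show ?thesis by simp
    qed
    show "integrable M (\<lambda>\<omega>. if \<theta> (Suc m) \<omega> = 1 then \<mu>L else \<mu>R)"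
      using measurable_from_subalg[OF subalgebra_history[OF \<theta>] mm]
      by (intro integrable_const_bound[of _ "\<bar>\<mu>L\<bar> + \<bar>\<mu>R\<bar>"]) auto
  qed (rule mm)
qed

text \<open>With \<open>A\<close> bounding the drifts, A + (1 + 1/\<sigma>) |X - \<mu>| bounds sqrt
  n times the increment of one round, since 1/n \<le> 1 / sqrt n. The expectation is the resulting
  majorant of n times min(h^2, |h|^3); it tends to 0 by dominated convergence using second moments
  only.\<close>

definition lindeberg :: "real \<Rightarrow> ('a \<Rightarrow> real) \<Rightarrow> real \<Rightarrow> nat \<Rightarrow> real" where
  "lindeberg A X \<mu> n = expectation (\<lambda>\<omega>. (A + (1 + 1 / \<sigma>) * \<bar>X \<omega> - \<mu>\<bar>)\<^sup>2
     * min 1 ((A + (1 + 1 / \<sigma>) * \<bar>X \<omega> - \<mu>\<bar>) / sqrt n))"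

lemma lindeberg_integrable:
  fixes n :: nat
  assumes "A \<ge> 0" "integrable M X" "integrable M (\<lambda>\<omega>. (X \<omega>)\<^sup>2)"
  shows "integrable M (\<lambda>\<omega>. (A + (1 + 1 / \<sigma>) * \<bar>X \<omega> - \<mu>\<bar>)\<^sup>2)"
    and "integrable M (\<lambda>\<omega>. (A + (1 + 1 / \<sigma>) * \<bar>X \<omega> - \<mu>\<bar>)\<^sup>2
     * min 1 ((A + (1 + 1 / \<sigma>) * \<bar>X \<omega> - \<mu>\<bar>) / sqrt n))"
proof -
  define r where "r = 1 + 1 / \<sigma>"
  have r: "r \<ge> 0" using \<sigma>_pos by (simp add: r_def)
  have [measurable]: "X \<in> borel_measurable M" using assms by auto
  have "(\<lambda>\<omega>. (A + r * \<bar>X \<omega> - \<mu>\<bar>)\<^sup>2) = (\<lambda>\<omega>. A\<^sup>2 + 2 * A * r * \<bar>X \<omega> - \<mu>\<bar> + r\<^sup>2 * (X \<omega> - \<mu>)\<^sup>2)"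
    by (simp add: power2_sum power_mult_distrib mult.assoc fun_eq_iff)
  moreover have "integrable M (\<lambda>\<omega>. A\<^sup>2 + 2 * A * r * \<bar>X \<omega> - \<mu>\<bar> + r\<^sup>2 * (X \<omega> - \<mu>)\<^sup>2)"
    using assms square_integrable_shift[OF assms(2,3), of \<mu>]
    by (intro Bochner_Integration.integrable_add integrable_mult_right integrable_abs
        Bochner_Integration.integrable_diff) auto
  ultimately show 1: "integrable M (\<lambda>\<omega>. (A + (1 + 1 / \<sigma>) * \<bar>X \<omega> - \<mu>\<bar>)\<^sup>2)"
    by (simp add: r_def)
  show "integrable M (\<lambda>\<omega>. (A + (1 + 1 / \<sigma>) * \<bar>X \<omega> - \<mu>\<bar>)\<^sup>2
     * min 1 ((A + (1 + 1 / \<sigma>) * \<bar>X \<omega> - \<mu>\<bar>) / sqrt n))"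
    unfolding r_def[symmetric]
  proof (rule Bochner_Integration.integrable_bound[OF 1[folded r_def]], measurable, rule AE_I2)
    fix \<omega>
    have "0 \<le> min 1 ((A + r * \<bar>X \<omega> - \<mu>\<bar>) / sqrt n)" using r assms(1) by (auto intro!: divide_nonneg_nonneg add_nonneg_nonneg)
    then show "norm ((A + r * \<bar>X \<omega> - \<mu>\<bar>)\<^sup>2 * min 1 ((A + r * \<bar>X \<omega> - \<mu>\<bar>) / sqrt n))
        \<le> norm ((A + r * \<bar>X \<omega> - \<mu>\<bar>)\<^sup>2)"
      by (auto simp: abs_mult intro!: mult_left_le)
  qed
qed

lemma lindeberg_tendsto_0:
  assumes "A \<ge> 0" "integrable M X" "integrable M (\<lambda>\<omega>. (X \<omega>)\<^sup>2)"
  shows "lindeberg A X \<mu> \<longlonglongrightarrow> 0"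
proof -
  have [measurable]: "X \<in> borel_measurable M" using assms by auto
  have nn: "A + (1 + 1 / \<sigma>) * \<bar>X \<omega> - \<mu>\<bar> \<ge> 0" for \<omega> using assms(1) \<sigma>_pos by simp
  have "(\<lambda>n. expectation (\<lambda>\<omega>. (A + (1 + 1 / \<sigma>) * \<bar>X \<omega> - \<mu>\<bar>)\<^sup>2
     * min 1 ((A + (1 + 1 / \<sigma>) * \<bar>X \<omega> - \<mu>\<bar>) / sqrt (real n)))) \<longlonglongrightarrow> expectation (\<lambda>\<omega>. 0)"
  proof (rule integral_dominated_convergence[OF _ _ lindeberg_integrable(1)[OF assms, of \<mu>]])
    show "AE \<omega> in M. (\<lambda>n. (A + (1 + 1 / \<sigma>) * \<bar>X \<omega> - \<mu>\<bar>)\<^sup>2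
     * min 1 ((A + (1 + 1 / \<sigma>) * \<bar>X \<omega> - \<mu>\<bar>) / sqrt (real n))) \<longlonglongrightarrow> 0"
    proof (rule AE_I2)
      fix \<omega>
      define Y where "Y = A + (1 + 1 / \<sigma>) * \<bar>X \<omega> - \<mu>\<bar>"
      have "(\<lambda>n. Y / sqrt (real n)) \<longlonglongrightarrow> 0" by real_asymp
      from tendsto_mult[OF tendsto_const tendsto_min[OF tendsto_const this], of "Y\<^sup>2" 1]
      show "(\<lambda>n. (A + (1 + 1 / \<sigma>) * \<bar>X \<omega> - \<mu>\<bar>)\<^sup>2
     * min 1 ((A + (1 + 1 / \<sigma>) * \<bar>X \<omega> - \<mu>\<bar>) / sqrt (real n))) \<longlonglongrightarrow> 0"
        by (simp add: Y_def)
    qed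
    show "AE \<omega> in M. norm ((A + (1 + 1 / \<sigma>) * \<bar>X \<omega> - \<mu>\<bar>)\<^sup>2
     * min 1 ((A + (1 + 1 / \<sigma>) * \<bar>X \<omega> - \<mu>\<bar>) / sqrt (real n))) \<le> (A + (1 + 1 / \<sigma>) * \<bar>X \<omega> - \<mu>\<bar>)\<^sup>2" for n
    proof (rule AE_I2)
      fix \<omega>
      have "0 \<le> min 1 ((A + (1 + 1 / \<sigma>) * \<bar>X \<omega> - \<mu>\<bar>) / sqrt (real n))" using nn[of \<omega>] by auto
      then show "norm ((A + (1 + 1 / \<sigma>) * \<bar>X \<omega> - \<mu>\<bar>)\<^sup>2
         * min 1 ((A + (1 + 1 / \<sigma>) * \<bar>X \<omega> - \<mu>\<bar>) / sqrt (real n))) \<le> (A + (1 + 1 / \<sigma>) * \<bar>X \<omega> - \<mu>\<bar>)\<^sup>2"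
        by (auto simp: abs_mult intro!: mult_left_le)
    qed
  qed measurable
  then show ?thesis by (simp add: lindeberg_def[abs_def])
qed

text \<open>Up to a constant, n times the error of one round: the Taylor remainder for either arm,
  the squared drift, and the excess of n times the variance of the increment over 1.\<close>

definition step_error :: "real \<Rightarrow> nat \<Rightarrow> real" where
  "step_error A n = lindeberg A XL \<mu>L n + lindeberg A XR \<mu>R n + A\<^sup>2 / n + 2 * \<sigma> / sqrt n + \<sigma>\<^sup>2 / n"

lemma step_error_tendsto_0:
  assumes "A \<ge> 0"
  shows "step_error A \<longlonglongrightarrow> 0"
proof -
  have "(\<lambda>n. A\<^sup>2 / real n) \<longlonglongrightarrow> 0" "(\<lambda>n. 2 * \<sigma> / sqrt (real n)) \<longlonglongrightarrow> 0" "(\<lambda>n. \<sigma>\<^sup>2 / real n) \<longlonglongrightarrow> 0"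
    by real_asymp+
  from tendsto_add[OF tendsto_add[OF tendsto_add[OF tendsto_add[OF
    lindeberg_tendsto_0[OF assms XL, of \<mu>L] lindeberg_tendsto_0[OF assms XR, of \<mu>R]] this(1)] this(2)] this(3)]
  show ?thesis by (simp add: step_error_def[abs_def])
qed

lemma min_square_cube_le:
  fixes h q :: real
  assumes "\<bar>h\<bar> \<le> q"
  shows "min (h\<^sup>2) (\<bar>h\<bar> ^ 3) \<le> q\<^sup>2 * min 1 q"
proof -
  have "h\<^sup>2 \<le> q\<^sup>2" using power_mono[OF assms, of 2] by simp
  moreover have "\<bar>h\<bar> ^ 3 \<le> q ^ 3" using power_mono[OF assms, of 3] by simp
  moreover have "q ^ 3 = q\<^sup>2 * q" by (simp add: power2_eq_square power3_eq_cube)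
  ultimately show ?thesis by (auto simp: min_def)
qed

text \<open>The increment is h = D/n + \<kappa> \<xi> with \<open>D\<close> known from the past and
  \<open>\<xi>\<close> the centred fresh reward. In expectation the linear term leaves D g / n and
  the quadratic term leaves k / (2n), because \<kappa>^2 \<sigma>^2 is nearly 1/n. The assumptions
  on \<open>S\<close> are only almost sure since they come from conditional expectations.\<close>

lemma one_step_expectation:
  fixes f g k :: "real \<Rightarrow> real"
  assumes \<theta>: "nonanticipating \<theta>" and n: "n \<ge> 1"
    and X: "X \<in> borel_measurable (past m)"
    and f: "\<And>x. (f has_real_derivative g x) (at x)" and f1: "\<And>x. \<bar>f x\<bar> \<le> 1"
    and g: "\<And>x. (g has_real_derivative k x) (at x)" and gC: "\<And>x. \<bar>g x\<bar> \<le> C"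
    and kC: "\<And>x. \<bar>k x\<bar> \<le> C" and kL: "\<And>x y. \<bar>k x - k y\<bar> \<le> C * \<bar>x - y\<bar>"
    and A: "\<bar>\<mu>L - \<beta>\<bar> \<le> A" "\<bar>\<mu>R - \<beta>\<bar> \<le> A"
    and S: "S \<in> borel_measurable M"
      "AE \<omega> in M. S \<omega> = X \<omega> + (if \<theta> (Suc m) \<omega> = 1 then \<mu>L - \<beta> else \<mu>R - \<beta>) / n
        + (1 / n + 1 / (\<sigma> * sqrt n)) * (if \<theta> (Suc m) \<omega> = 1 then WL (Suc m) \<omega> - \<mu>L else WR (Suc m) \<omega> - \<mu>R)"
  shows "\<bar>expectation (\<lambda>\<omega>. f (S \<omega>)) - expectation (\<lambda>\<omega>. f (X \<omega>))
    - expectation (\<lambda>\<omega>. (if \<theta> (Suc m) \<omega> = 1 then \<mu>L - \<beta> else \<mu>R - \<beta>) * g (X \<omega>) + k (X \<omega>) / 2) / n\<bar>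
    \<le> C * step_error A n / n"
proof -
  have n0: "real n > 0" using n by simp
  \<comment> \<open>A reward enters \<open>T_stat\<close> twice, with weight 1/n in the average and
    1/(\<sigma> sqrt n) in the normalised sum.\<close>
  define \<kappa> where "\<kappa> = 1 / n + 1 / (\<sigma> * sqrt n)"
  define D where "D = (\<lambda>\<omega>. (if \<theta> (Suc m) \<omega> = 1 then \<mu>L - \<beta> else \<mu>R - \<beta>))"
  define \<xi> where "\<xi> = (\<lambda>\<omega>. if \<theta> (Suc m) \<omega> = 1 then WL (Suc m) \<omega> - \<mu>L else WR (Suc m) \<omega> - \<mu>R)"
  define h where "h = (\<lambda>\<omega>. D \<omega> / n + \<kappa> * \<xi> \<omega>)"
  have A0: "A \<ge> 0" using A(1) by linarith
  have C0: "C \<ge> 0" using kC[of 0] by linarith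
  have \<kappa>0: "\<kappa> \<ge> 0" using \<sigma>_pos by (simp add: \<kappa>_def)
  have sqrtn: "sqrt n \<ge> 1" "sqrt n > 0" using n by auto
  have sqrt_le: "sqrt n \<le> n" using mult_left_mono[OF sqrtn(1), of "sqrt n"] by simp
  have \<kappa>le: "\<kappa> \<le> (1 + 1 / \<sigma>) / sqrt n"
  proof -
    have "1 / real n \<le> 1 / sqrt n" using sqrt_le sqrtn by (intro divide_left_mono) auto
    then show ?thesis by (simp add: \<kappa>_def add_divide_distrib mult.commute)
  qed
  have contf: "continuous_on UNIV f" and contg: "continuous_on UNIV g"
    by (auto intro!: DERIV_continuous_on f g)
  have contk: "continuous_on UNIV k"
  proof -
    have "C-lipschitz_on UNIV k" using kL C0 by (auto simp: lipschitz_on_def dist_real_def)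
    then show ?thesis by (rule lipschitz_on_continuous_on)
  qed
  note [measurable] = borel_measurable_continuous_onI[OF contf] borel_measurable_continuous_onI[OF contg]
    borel_measurable_continuous_onI[OF contk]
  note sub = measurable_from_subalg[OF subalgebra_past]
  have XM[measurable]: "X \<in> borel_measurable M" by (rule sub[OF X])
  note [measurable] = X S(1) choice_measurable(2,3)[OF \<theta>, of m]
  have [measurable]: "WL (Suc m) \<in> borel_measurable M" "WR (Suc m) \<in> borel_measurable M"
    using W_measurable[of "Suc m"] by auto
  have [measurable]: "Measurable.pred (past m) (\<lambda>\<omega>. \<theta> (Suc m) \<omega> = 1)" "Measurable.pred M (\<lambda>\<omega>. \<theta> (Suc m) \<omega> = 1)"
    by measurable
  have Dm[measurable]: "D \<in> borel_measurable (past m)" "D \<in> borel_measurable M" unfolding D_def by measurable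
  have [measurable]: "\<xi> \<in> borel_measurable M" unfolding \<xi>_def by measurable
  have [measurable]: "h \<in> borel_measurable M" unfolding h_def by measurable
  have DA: "\<bar>D \<omega>\<bar> \<le> A" for \<omega> using A by (simp add: D_def)
  have gX[measurable]: "(\<lambda>\<omega>. g (X \<omega>)) \<in> borel_measurable (past m)" by measurable
  have kX[measurable]: "(\<lambda>\<omega>. k (X \<omega>)) \<in> borel_measurable (past m)" by measurable
  have W: "integrable M (WL (Suc m))" "integrable M (WR (Suc m))" "expectation (WL (Suc m)) = \<mu>L"
    "expectation (WR (Suc m)) = \<mu>R" "integrable M (\<lambda>\<omega>. (WL (Suc m) \<omega> - \<mu>L)\<^sup>2)"
    "integrable M (\<lambda>\<omega>. (WR (Suc m) \<omega> - \<mu>R)\<^sup>2)"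
    "expectation (\<lambda>\<omega>. (WL (Suc m) \<omega> - \<mu>L)\<^sup>2) = \<sigma>\<^sup>2" "expectation (\<lambda>\<omega>. (WR (Suc m) \<omega> - \<mu>R)\<^sup>2) = \<sigma>\<^sup>2"
    using W_moments[of "Suc m"] by auto
  \<comment> \<open>Whichever arm is played, \<open>\<xi>\<close> has mean 0 and variance
    \<sigma>^2. Against a bounded past-measurable factor the linear term therefore disappears, and
    in \<open>quad\<close> the square turns into \<sigma>^2.\<close>
  have lin: "integrable M (\<lambda>\<omega>. Q \<omega> * \<xi> \<omega>)" "expectation (\<lambda>\<omega>. Q \<omega> * \<xi> \<omega>) = 0"
    if "Q \<in> borel_measurable (past m)" "\<And>\<omega>. \<bar>Q \<omega>\<bar> \<le> B" for Q B
    using expectation_choice_mult[OF \<theta> that, of "\<lambda>x. x - \<mu>L" "\<lambda>x. x - \<mu>R"] W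
    by (simp_all add: \<xi>_def prob_space cong: if_cong)
  have quad: "integrable M (\<lambda>\<omega>. Q \<omega> * (\<xi> \<omega>)\<^sup>2)" "expectation (\<lambda>\<omega>. Q \<omega> * (\<xi> \<omega>)\<^sup>2) = \<sigma>\<^sup>2 * expectation Q"
    if "Q \<in> borel_measurable (past m)" "\<And>\<omega>. \<bar>Q \<omega>\<bar> \<le> B" for Q B
    using expectation_choice_mult[OF \<theta> that, of "\<lambda>x. (x - \<mu>L)\<^sup>2" "\<lambda>x. (x - \<mu>R)\<^sup>2"] W
    by (simp_all add: \<xi>_def if_distrib[of "\<lambda>x. x\<^sup>2"] mult.commute cong: if_cong)
  have bdd: "integrable M Q" if "Q \<in> borel_measurable M" "\<And>\<omega>. \<bar>Q \<omega>\<bar> \<le> B" for Q :: "'a \<Rightarrow> real" and B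
    using that by (intro integrable_const_bound[of _ B]) auto
  have ifX: "integrable M (\<lambda>\<omega>. f (X \<omega>))" and ifh: "integrable M (\<lambda>\<omega>. f (X \<omega> + h \<omega>))"
    and ikX: "integrable M (\<lambda>\<omega>. k (X \<omega>))"
    by (rule bdd; measurable; (rule f1 kC))+
  have bDg: "\<bar>D \<omega> * g (X \<omega>)\<bar> \<le> A * C" for \<omega>
    unfolding abs_mult by (intro mult_mono DA gC A0) auto
  have bDk: "\<bar>k (X \<omega>) * D \<omega>\<bar> \<le> C * A" for \<omega>
    unfolding abs_mult by (intro mult_mono DA kC C0) auto
  have D2: "(D \<omega>)\<^sup>2 \<le> A\<^sup>2" for \<omega> using power_mono[OF DA, of \<omega> 2] by simp
  have bDDk: "\<bar>k (X \<omega>) * (D \<omega>)\<^sup>2\<bar> \<le> C * A\<^sup>2" for \<omega>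
    unfolding abs_mult using D2[of \<omega>] by (intro mult_mono kC C0) auto
  have iDg: "integrable M (\<lambda>\<omega>. D \<omega> * g (X \<omega>))" by (rule bdd[OF _ bDg]) measurable
  have iDDk: "integrable M (\<lambda>\<omega>. k (X \<omega>) * (D \<omega>)\<^sup>2)" by (rule bdd[OF _ bDDk]) measurable
  note gxi = lin[OF gX gC]
  have kDm: "(\<lambda>\<omega>. k (X \<omega>) * D \<omega>) \<in> borel_measurable (past m)" by measurable
  note kDxi = lin[OF kDm bDk]
  note kxi = quad[OF kX kC]
  define R where "R = (\<lambda>\<omega>. f (X \<omega> + h \<omega>) - f (X \<omega>) - h \<omega> * g (X \<omega>) - (h \<omega>)\<^sup>2 / 2 * k (X \<omega>))"
  have hg: "h \<omega> * g (X \<omega>) = 1 / n * (D \<omega> * g (X \<omega>)) + \<kappa> * (g (X \<omega>) * \<xi> \<omega>)" for \<omega>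
    by (simp add: h_def algebra_simps)
  have hk: "(h \<omega>)\<^sup>2 / 2 * k (X \<omega>) = 1 / (2 * (real n)\<^sup>2) * (k (X \<omega>) * (D \<omega>)\<^sup>2)
      + \<kappa> / n * ((k (X \<omega>) * D \<omega>) * \<xi> \<omega>) + \<kappa>\<^sup>2 / 2 * (k (X \<omega>) * (\<xi> \<omega>)\<^sup>2)" for \<omega>
    using n0 by (simp add: h_def field_simps power2_eq_square)
  have ihg: "integrable M (\<lambda>\<omega>. h \<omega> * g (X \<omega>))"
    and Ehg: "expectation (\<lambda>\<omega>. h \<omega> * g (X \<omega>)) = 1 / n * expectation (\<lambda>\<omega>. D \<omega> * g (X \<omega>))"
    unfolding hg using gxi iDg by simp_all
  have ihk: "integrable M (\<lambda>\<omega>. (h \<omega>)\<^sup>2 / 2 * k (X \<omega>))"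
    and Ehk: "expectation (\<lambda>\<omega>. (h \<omega>)\<^sup>2 / 2 * k (X \<omega>)) =
      1 / (2 * (real n)\<^sup>2) * expectation (\<lambda>\<omega>. k (X \<omega>) * (D \<omega>)\<^sup>2) + \<kappa>\<^sup>2 / 2 * (\<sigma>\<^sup>2 * expectation (\<lambda>\<omega>. k (X \<omega>)))"
    unfolding hk using kDxi kxi iDDk by simp_all
  have ER: "expectation R = expectation (\<lambda>\<omega>. f (X \<omega> + h \<omega>)) - expectation (\<lambda>\<omega>. f (X \<omega>))
     - expectation (\<lambda>\<omega>. h \<omega> * g (X \<omega>)) - expectation (\<lambda>\<omega>. (h \<omega>)\<^sup>2 / 2 * k (X \<omega>))"
    and iR: "integrable M R"
    unfolding R_def using ifX ifh ihg ihk by (simp_all add: Bochner_Integration.integral_diff)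
  define \<psi> where "\<psi> = (\<lambda>\<mu> x. (A + (1 + 1 / \<sigma>) * \<bar>x - \<mu>\<bar>)\<^sup>2 * min 1 ((A + (1 + 1 / \<sigma>) * \<bar>x - \<mu>\<bar>) / sqrt n))"
  have [measurable]: "\<psi> \<mu> \<in> borel_measurable borel" for \<mu> unfolding \<psi>_def by measurable
  have \<psi>L: "integrable M (\<lambda>\<omega>. \<psi> \<mu>L (WL (Suc m) \<omega>))" "expectation (\<lambda>\<omega>. \<psi> \<mu>L (WL (Suc m) \<omega>)) = lindeberg A XL \<mu>L n"
    using W_expectation(1,3)[of "Suc m" "\<psi> \<mu>L"] lindeberg_integrable(2)[OF A0 XL, of \<mu>L n]
    by (simp_all add: \<psi>_def lindeberg_def)
  have \<psi>R: "integrable M (\<lambda>\<omega>. \<psi> \<mu>R (WR (Suc m) \<omega>))" "expectation (\<lambda>\<omega>. \<psi> \<mu>R (WR (Suc m) \<omega>)) = lindeberg A XR \<mu>R n"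
    using W_expectation(2,4)[of "Suc m" "\<psi> \<mu>R"] lindeberg_integrable(2)[OF A0 XR, of \<mu>R n]
    by (simp_all add: \<psi>_def lindeberg_def)
  have lnn: "lindeberg A XL \<mu>L n \<ge> 0" "lindeberg A XR \<mu>R n \<ge> 0"
    using A0 \<sigma>_pos by (auto simp: lindeberg_def intro!: Bochner_Integration.integral_nonneg)
  \<comment> \<open>Majorant of n times min(h^2, |h|^3) for the arm actually played. Its mean is at
    most the sum of the means for the two arms, a bound independent of the strategy.\<close>
  define \<Lambda> where "\<Lambda> = (\<lambda>\<omega>. if \<theta> (Suc m) \<omega> = 1 then \<psi> \<mu>L (WL (Suc m) \<omega>) else \<psi> \<mu>R (WR (Suc m) \<omega>))"
  have i\<Lambda>: "integrable M \<Lambda>" and E\<Lambda>: "expectation \<Lambda> \<le> lindeberg A XL \<mu>L n + lindeberg A XR \<mu>R n"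
  proof -
    have c: "\<bar>1 :: real\<bar> \<le> 1" by simp
    note e = expectation_choice_mult[OF \<theta> borel_measurable_const c _ _ \<psi>L(1) \<psi>R(1)]
    show "integrable M \<Lambda>" using e(1) unfolding \<Lambda>_def by simp
    have "expectation \<Lambda> = expectation (\<lambda>\<omega>. if \<theta> (Suc m) \<omega> = 1 then lindeberg A XL \<mu>L n else lindeberg A XR \<mu>R n)"
      using e(2) \<psi>L(2) \<psi>R(2) unfolding \<Lambda>_def by (simp cong: if_cong)
    also have "\<dots> \<le> expectation (\<lambda>\<omega>. lindeberg A XL \<mu>L n + lindeberg A XR \<mu>R n)"
      by (intro integral_mono bdd[of _ "lindeberg A XL \<mu>L n + lindeberg A XR \<mu>R n"]) (use lnn in auto)
    finally show "expectation \<Lambda> \<le> lindeberg A XL \<mu>L n + lindeberg A XR \<mu>R n" by (simp add: prob_space)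
  qed
  have R\<Lambda>: "\<bar>R \<omega>\<bar> \<le> C / n * \<Lambda> \<omega>" for \<omega>
  proof -
    define Y where "Y = A + (1 + 1 / \<sigma>) * \<bar>\<xi> \<omega>\<bar>"
    have "\<bar>h \<omega>\<bar> \<le> \<bar>D \<omega> / n\<bar> + \<bar>\<kappa> * \<xi> \<omega>\<bar>" unfolding h_def by (rule abs_triangle_ineq)
    also have "\<bar>D \<omega> / n\<bar> \<le> A / sqrt n"
    proof -
      have "\<bar>D \<omega>\<bar> / n \<le> A / sqrt n" using DA[of \<omega>] A0 sqrtn sqrt_le by (intro frac_le) auto
      then show ?thesis by simp
    qed
    also have "\<bar>\<kappa> * \<xi> \<omega>\<bar> \<le> (1 + 1 / \<sigma>) / sqrt n * \<bar>\<xi> \<omega>\<bar>"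
      using mult_right_mono[OF \<kappa>le, of "\<bar>\<xi> \<omega>\<bar>"] \<kappa>0 by (simp add: abs_mult)
    finally have "\<bar>h \<omega>\<bar> \<le> Y / sqrt n" by (simp add: Y_def add_divide_distrib[of A])
    from min_square_cube_le[OF this]
    have "min ((h \<omega>)\<^sup>2) (\<bar>h \<omega>\<bar> ^ 3) \<le> (Y / sqrt n)\<^sup>2 * min 1 (Y / sqrt n)" .
    also have "\<dots> = \<Lambda> \<omega> / n"
      by (simp add: \<Lambda>_def \<psi>_def Y_def \<xi>_def power_divide)
    finally have m: "min ((h \<omega>)\<^sup>2) (\<bar>h \<omega>\<bar> ^ 3) \<le> \<Lambda> \<omega> / n" .
    have "\<bar>R \<omega>\<bar> \<le> C * min ((h \<omega>)\<^sup>2) (\<bar>h \<omega>\<bar> ^ 3)"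
      unfolding R_def by (rule taylor2_bound[OF f g kC kL])
    also have "\<dots> \<le> C * (\<Lambda> \<omega> / n)" using m C0 by (rule mult_left_mono)
    finally show ?thesis by simp
  qed
  have bR: "\<bar>expectation R\<bar> \<le> C / n * (lindeberg A XL \<mu>L n + lindeberg A XR \<mu>R n)"
  proof -
    have "\<bar>expectation R\<bar> \<le> expectation (\<lambda>\<omega>. \<bar>R \<omega>\<bar>)" by (rule integral_abs_bound)
    also have "\<dots> \<le> expectation (\<lambda>\<omega>. C / n * \<Lambda> \<omega>)"
      using iR i\<Lambda> R\<Lambda> by (intro integral_mono) auto
    also have "\<dots> = C / n * expectation \<Lambda>" by simp
    also have "\<dots> \<le> C / n * (lindeberg A XL \<mu>L n + lindeberg A XR \<mu>R n)"
      using E\<Lambda> C0 by (intro mult_left_mono) auto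
    finally show ?thesis .
  qed
  have bk: "\<bar>expectation (\<lambda>\<omega>. k (X \<omega>))\<bar> \<le> C"
  proof -
    have "\<bar>expectation (\<lambda>\<omega>. k (X \<omega>))\<bar> \<le> expectation (\<lambda>\<omega>. \<bar>k (X \<omega>)\<bar>)" by (rule integral_abs_bound)
    also have "\<dots> \<le> expectation (\<lambda>\<omega>. C)" using ikX kC by (intro integral_mono) auto
    finally show ?thesis by (simp add: prob_space)
  qed
  have bDD: "\<bar>expectation (\<lambda>\<omega>. k (X \<omega>) * (D \<omega>)\<^sup>2)\<bar> \<le> C * A\<^sup>2"
  proof -
    have "\<bar>expectation (\<lambda>\<omega>. k (X \<omega>) * (D \<omega>)\<^sup>2)\<bar> \<le> expectation (\<lambda>\<omega>. \<bar>k (X \<omega>) * (D \<omega>)\<^sup>2\<bar>)" by (rule integral_abs_bound)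
    also have "\<dots> \<le> expectation (\<lambda>\<omega>. C * A\<^sup>2)" using iDDk bDDk by (intro integral_mono) auto
    finally show ?thesis by (simp add: prob_space)
  qed
  \<comment> \<open>The variance of the random part exceeds 1/n through the weight 1/n of the
    average. The excess is of order n to the power -3/2, negligible even after n rounds.\<close>
  have \<kappa>2: "\<kappa>\<^sup>2 * \<sigma>\<^sup>2 - 1 / n = (2 * \<sigma> / sqrt n + \<sigma>\<^sup>2 / n) / n"
  proof -
    define s where "s = sqrt n"
    have s: "s > 0" "real n = s\<^sup>2" using sqrtn by (auto simp: s_def)
    show ?thesis unfolding \<kappa>_def s_def[symmetric] s(2) using s(1) \<sigma>_pos
      by (simp add: field_simps power2_eq_square)
  qed
  have ES: "expectation (\<lambda>\<omega>. f (S \<omega>)) = expectation (\<lambda>\<omega>. f (X \<omega> + h \<omega>))"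
    using S(2) by (intro integral_cong_AE) (auto simp: h_def D_def \<xi>_def \<kappa>_def add.assoc elim!: eventually_mono)
  have EDk: "expectation (\<lambda>\<omega>. D \<omega> * g (X \<omega>) + k (X \<omega>) / 2)
      = expectation (\<lambda>\<omega>. D \<omega> * g (X \<omega>)) + expectation (\<lambda>\<omega>. k (X \<omega>)) / 2"
    using iDg ikX by simp
  have "expectation (\<lambda>\<omega>. f (S \<omega>)) - expectation (\<lambda>\<omega>. f (X \<omega>)) - expectation (\<lambda>\<omega>. D \<omega> * g (X \<omega>) + k (X \<omega>) / 2) / n
    = expectation R + 1 / (2 * (real n)\<^sup>2) * expectation (\<lambda>\<omega>. k (X \<omega>) * (D \<omega>)\<^sup>2)
      + (\<kappa>\<^sup>2 * \<sigma>\<^sup>2 - 1 / n) / 2 * expectation (\<lambda>\<omega>. k (X \<omega>))"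
    unfolding ER ES EDk Ehg Ehk using n0 by (simp add: field_simps)
  also have "\<bar>\<dots>\<bar> \<le> C / n * (lindeberg A XL \<mu>L n + lindeberg A XR \<mu>R n)
      + 1 / (2 * (real n)\<^sup>2) * (C * A\<^sup>2) + (\<kappa>\<^sup>2 * \<sigma>\<^sup>2 - 1 / n) / 2 * C"
  proof (intro order_trans[OF abs_triangle_ineq] add_mono bR)
    show "\<bar>1 / (2 * (real n)\<^sup>2) * expectation (\<lambda>\<omega>. k (X \<omega>) * (D \<omega>)\<^sup>2)\<bar> \<le> 1 / (2 * (real n)\<^sup>2) * (C * A\<^sup>2)"
      using mult_left_mono[OF bDD, of "1 / (2 * (real n)\<^sup>2)"] by (simp add: abs_mult)
    have "0 \<le> (\<kappa>\<^sup>2 * \<sigma>\<^sup>2 - 1 / n) / 2" unfolding \<kappa>2 using \<sigma>_pos by simp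
    then show "\<bar>(\<kappa>\<^sup>2 * \<sigma>\<^sup>2 - 1 / n) / 2 * expectation (\<lambda>\<omega>. k (X \<omega>))\<bar> \<le> (\<kappa>\<^sup>2 * \<sigma>\<^sup>2 - 1 / n) / 2 * C"
      unfolding abs_mult using bk by (intro mult_mono) auto
  qed
  also have "\<dots> \<le> C * step_error A n / n"
  proof -
    have e: "C * step_error A n / n - (C / n * (lindeberg A XL \<mu>L n + lindeberg A XR \<mu>R n)
      + 1 / (2 * (real n)\<^sup>2) * (C * A\<^sup>2) + (\<kappa>\<^sup>2 * \<sigma>\<^sup>2 - 1 / n) / 2 * C)
      = C / n * (A\<^sup>2 / n / 2 + (2 * \<sigma> / sqrt n + \<sigma>\<^sup>2 / n) / 2)"
      unfolding \<kappa>2 step_error_def by (simp add: algebra_simps power2_eq_square add_divide_distrib)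
    have "0 \<le> C / n * (A\<^sup>2 / n / 2 + (2 * \<sigma> / sqrt n + \<sigma>\<^sup>2 / n) / 2)"
      using C0 \<sigma>_pos by (intro mult_nonneg_nonneg add_nonneg_nonneg divide_nonneg_nonneg) auto
    with e show ?thesis by linarith
  qed
  finally show ?thesis unfolding D_def .
qed

section \<open>Summation over the rounds\<close>

text \<open>Adding the drift \<open>\<beta>\<close> of the remaining rounds turns the moving
  threshold into the fixed level 0, so that the threshold rule depends on the sign of this process.
  It starts at \<open>\<beta> - c\<close> and ends at T - c.\<close>

definition centred_stat :: "(nat \<Rightarrow> 'a \<Rightarrow> nat) \<Rightarrow> nat \<Rightarrow> real \<Rightarrow> real \<Rightarrow> nat \<Rightarrow> 'a \<Rightarrow> real" where
  "centred_stat \<theta> n \<beta> c m \<omega> = T_stat M \<sigma> WL WR \<theta> m n \<omega> + (1 - real m / real n) * \<beta> - c"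

lemma centred_stat_measurable:
  assumes "nonanticipating \<theta>"
  shows "centred_stat \<theta> n \<beta> c m \<in> borel_measurable (past m)" "centred_stat \<theta> n \<beta> c m \<in> borel_measurable M"
proof -
  have "T_stat M \<sigma> WL WR \<theta> m n \<in> borel_measurable (past m)"
    by (rule measurable_sets_mono[OF T_stat_measurable_history history_subset_past[OF assms]]) simp
  then show *: "centred_stat \<theta> n \<beta> c m \<in> borel_measurable (past m)"
    unfolding centred_stat_def[abs_def] by measurable
  show "centred_stat \<theta> n \<beta> c m \<in> borel_measurable M"
    by (rule measurable_from_subalg[OF subalgebra_past *])
qed

lemma centred_stat_step:
  assumes \<theta>: "nonanticipating \<theta>" and n: "n \<ge> 1"
  shows "AE \<omega> in M. centred_stat \<theta> n \<beta> c (Suc m) \<omega> = centred_stat \<theta> n \<beta> c m \<omega>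
        + (if \<theta> (Suc m) \<omega> = 1 then \<mu>L - \<beta> else \<mu>R - \<beta>) / n
        + (1 / n + 1 / (\<sigma> * sqrt n)) * (if \<theta> (Suc m) \<omega> = 1 then WL (Suc m) \<omega> - \<mu>L else WR (Suc m) \<omega> - \<mu>R)"
  using cond_exp_reward[OF \<theta>, of m]
proof (rule eventually_mono)
  fix \<omega>
  assume c: "real_cond_exp M (history M WL WR \<theta> m) (reward WL WR \<theta> (Suc m)) \<omega>
    = (if \<theta> (Suc m) \<omega> = 1 then \<mu>L else \<mu>R)"
  define s where "s = sqrt n"
  define Z where "Z = reward WL WR \<theta> (Suc m) \<omega>"
  define \<mu> where "\<mu> = (if \<theta> (Suc m) \<omega> = 1 then \<mu>L else \<mu>R)"
  have s: "s > 0" using n by (simp add: s_def)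
  have n0: "real n > 0" using n by simp
  have "T_stat M \<sigma> WL WR \<theta> (Suc m) n \<omega> = T_stat M \<sigma> WL WR \<theta> m n \<omega> + Z / n + (Z - \<mu>) / (\<sigma> * s)"
    unfolding T_stat_def using c by (simp add: distrib_left Z_def \<mu>_def s_def)
  then have "centred_stat \<theta> n \<beta> c (Suc m) \<omega> - centred_stat \<theta> n \<beta> c m \<omega> = Z / n + (Z - \<mu>) / (\<sigma> * s) - \<beta> / n"
    by (simp add: centred_stat_def add_divide_distrib algebra_simps)
  also have "\<dots> = (\<mu> - \<beta>) / n + (1 / n + 1 / (\<sigma> * s)) * (Z - \<mu>)"
    by (simp add: diff_divide_distrib algebra_simps)
  finally show "centred_stat \<theta> n \<beta> c (Suc m) \<omega> = centred_stat \<theta> n \<beta> c m \<omega>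
        + (if \<theta> (Suc m) \<omega> = 1 then \<mu>L - \<beta> else \<mu>R - \<beta>) / n
        + (1 / n + 1 / (\<sigma> * sqrt n)) * (if \<theta> (Suc m) \<omega> = 1 then WL (Suc m) \<omega> - \<mu>L else WR (Suc m) \<omega> - \<mu>R)"
    by (simp add: Z_def \<mu>_def s_def reward_def split: if_splits)
qed

text \<open>\<open>t\<close> is \<delta> plus the time left after the round. The change of v is
  split into a move in space at fixed time \<open>t\<close>, given by
  \<open>one_step_expectation\<close>, and a move in time at fixed position. What survives is the
  drift of the chosen arm minus the feedback drift, multiplied by the slope.\<close>

lemma refl_val_one_step:
  fixes c :: real
  assumes \<theta>: "nonanticipating \<theta>" and m: "m < n"
    and \<delta>: "\<delta> > 0" and y: "y \<ge> 0" and \<mu>: "\<mu>L = \<beta> - a" "\<mu>R = \<beta> + a"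
    and C: "\<And>t x. t \<in> {\<delta>..1 + \<delta>} \<Longrightarrow> \<bar>refl_val1 a y t x\<bar> \<le> C"
    "\<And>t x. t \<in> {\<delta>..1 + \<delta>} \<Longrightarrow> \<bar>refl_val2 a y t x\<bar> \<le> C"
    "\<And>t x x'. t \<in> {\<delta>..1 + \<delta>} \<Longrightarrow> \<bar>refl_val2 a y t x - refl_val2 a y t x'\<bar> \<le> C * \<bar>x - x'\<bar>"
    "\<And>t s x. \<lbrakk>t \<in> {\<delta>..1 + \<delta>}; s \<ge> 0; t + s \<le> 1 + \<delta>\<rbrakk> \<Longrightarrow>
      \<bar>refl_val a y (t + s) x - refl_val a y t x
        - s * (refl_val2 a y t x / 2 + a * refl_cdf1 a y t \<bar>x\<bar>)\<bar> \<le> C * s\<^sup>2"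
  defines "t \<equiv> \<delta> + (1 - real (Suc m) / n)"
  defines "X \<equiv> centred_stat \<theta> n \<beta> c"
  shows "\<bar>expectation (\<lambda>\<omega>. refl_val a y t (X (Suc m) \<omega>))
      - expectation (\<lambda>\<omega>. refl_val a y (\<delta> + (1 - real m / n)) (X m \<omega>))
      - expectation (\<lambda>\<omega>. (if \<theta> (Suc m) \<omega> = 1 then - a else a) * refl_val1 a y t (X m \<omega>)
          - a * refl_cdf1 a y t \<bar>X m \<omega>\<bar>) / n\<bar>
    \<le> C * (step_error \<bar>a\<bar> n + 1 / n) / n"
proof -
  have n: "n \<ge> 1" and n0: "real n > 0" using m by auto
  have t: "t \<in> {\<delta>..1 + \<delta>}" using m n0 by (auto simp: t_def divide_le_eq)
  have t0: "t > 0" using t \<delta> by auto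
  have t1: "\<delta> + (1 - real m / n) = t + 1 / n" by (simp add: t_def add_divide_distrib)
  have t2: "t + 1 / n \<le> 1 + \<delta>" using n0 by (simp add: t1[symmetric])
  define u where "u = refl_val a y t"
  define g where "g = refl_val1 a y t"
  define k where "k = refl_val2 a y t"
  define r where "r = (\<lambda>x. refl_cdf1 a y t \<bar>x\<bar>)"
  define u' where "u' = refl_val a y (t + 1 / n)"
  have du: "(u has_real_derivative g x) (at x)" and dg: "(g has_real_derivative k x) (at x)"
    and du': "(u' has_real_derivative refl_val1 a y (t + 1 / n) x) (at x)" for x
    unfolding u_def g_def k_def u'_def
    by (intro refl_val_has_real_derivative refl_val1_has_real_derivative, use t0 n0 in \<open>simp add: add_pos_pos\<close>)+
  have "continuous_on UNIV (refl_cdf1 a y t)"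
    by (rule DERIV_continuous_on[where D = "refl_cdf2 a y t"]) (use refl_cdf1_has_real_derivative[OF t0] in simp)
  then have rm[measurable]: "r \<in> borel_measurable borel"
    unfolding r_def using borel_measurable_continuous_onI[of "refl_cdf1 a y t"] by measurable
  have um[measurable]: "u \<in> borel_measurable borel" "g \<in> borel_measurable borel" "u' \<in> borel_measurable borel"
    using du dg du' by (auto intro!: borel_measurable_continuous_onI DERIV_continuous_on)
  have km[measurable]: "k \<in> borel_measurable borel"
  proof -
    have "C \<ge> 0" using C(1)[OF t, of 0] by linarith
    then have "C-lipschitz_on UNIV k" using C(3)[OF t] by (auto simp: lipschitz_on_def dist_real_def k_def)
    then show ?thesis by (intro borel_measurable_continuous_onI lipschitz_on_continuous_on)
  qed
  have [measurable]: "X m \<in> borel_measurable M"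
    unfolding X_def by (rule centred_stat_measurable[OF \<theta>])
  note [measurable] = choice_measurable(3)[OF \<theta>, of m]
  have bdd: "integrable M Q" if "Q \<in> borel_measurable M" "\<And>\<omega>. \<bar>Q \<omega>\<bar> \<le> B" for Q :: "'a \<Rightarrow> real" and B
    using that by (intro integrable_const_bound[of _ B]) auto
  have rC: "\<bar>r x\<bar> \<le> C" for x
  proof -
    have "\<bar>r x\<bar> = \<bar>g x\<bar>"
      using refl_cdf1_zero[OF t0] by (cases "x = 0") (auto simp: r_def g_def refl_val1_def abs_mult sgn_if)
    then show ?thesis using C(1)[OF t] by (simp add: g_def)
  qed
  have u01: "\<bar>u x\<bar> \<le> 1" "\<bar>u' x\<bar> \<le> 1" for x
    using refl_val_0_1[OF t0 y] refl_val_0_1[of "t + 1 / n", OF _ y] t0 n0 by (auto simp: u_def u'_def add_pos_pos)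
  have gC: "\<bar>g x\<bar> \<le> C" and kC: "\<bar>k x\<bar> \<le> C" for x using C(1,2)[OF t] by (auto simp: g_def k_def)
  define D where "D = (\<lambda>\<omega>. if \<theta> (Suc m) \<omega> = 1 then - a else a)"
  have Dm[measurable]: "D \<in> borel_measurable M" unfolding D_def by measurable
  have iu: "integrable M (\<lambda>\<omega>. u (X m \<omega>))" and iu': "integrable M (\<lambda>\<omega>. u' (X m \<omega>))"
    and ik: "integrable M (\<lambda>\<omega>. k (X m \<omega>))" and ir: "integrable M (\<lambda>\<omega>. r (X m \<omega>))"
    by (rule bdd; measurable; (rule u01 kC rC))+
  have iDg: "integrable M (\<lambda>\<omega>. D \<omega> * g (X m \<omega>))"
  proof (rule bdd)
    show "\<bar>D \<omega> * g (X m \<omega>)\<bar> \<le> \<bar>a\<bar> * C" for \<omega>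
      unfolding abs_mult by (intro mult_mono gC) (auto simp: D_def)
  qed measurable
  have 1: "\<bar>expectation (\<lambda>\<omega>. u (X (Suc m) \<omega>)) - expectation (\<lambda>\<omega>. u (X m \<omega>))
    - expectation (\<lambda>\<omega>. D \<omega> * g (X m \<omega>) + k (X m \<omega>) / 2) / n\<bar> \<le> C * step_error \<bar>a\<bar> n / n"
  proof -
    have kL: "\<bar>k x - k x'\<bar> \<le> C * \<bar>x - x'\<bar>" for x x' using C(3)[OF t] by (simp add: k_def)
    have A: "\<bar>\<mu>L - \<beta>\<bar> \<le> \<bar>a\<bar>" "\<bar>\<mu>R - \<beta>\<bar> \<le> \<bar>a\<bar>" using \<mu> by auto
    have "D = (\<lambda>\<omega>. if \<theta> (Suc m) \<omega> = 1 then \<mu>L - \<beta> else \<mu>R - \<beta>)" using \<mu> by (auto simp: D_def)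
    with one_step_expectation[OF \<theta> n centred_stat_measurable(1)[OF \<theta>] du u01(1) dg gC kC kL A
        centred_stat_measurable(2)[OF \<theta>] centred_stat_step[OF \<theta> n]]
    show ?thesis by (simp add: X_def)
  qed
  have 2: "\<bar>expectation (\<lambda>\<omega>. u' (X m \<omega>)) - expectation (\<lambda>\<omega>. u (X m \<omega>))
     - expectation (\<lambda>\<omega>. k (X m \<omega>) / 2 + a * r (X m \<omega>)) / n\<bar> \<le> C * (1 / n)\<^sup>2"
  proof -
    let ?F = "\<lambda>\<omega>. u' (X m \<omega>) - u (X m \<omega>) - 1 / n * (k (X m \<omega>) / 2 + a * r (X m \<omega>))"
    have iF: "integrable M ?F" using iu iu' ik ir by auto
    have "\<bar>expectation ?F\<bar> \<le> expectation (\<lambda>\<omega>. \<bar>?F \<omega>\<bar>)" by (rule integral_abs_bound)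
    also have "\<dots> \<le> expectation (\<lambda>\<omega>. C * (1 / n)\<^sup>2)"
      using iF C(4)[OF t _ t2] n0
      by (intro integral_mono integrable_abs) (auto simp: u'_def u_def k_def r_def)
    finally show ?thesis using iu iu' ik ir by (simp add: prob_space)
  qed
  \<comment> \<open>Half the second derivative from the spatial expansion cancels against the one
    supplied by the backward equation.\<close>
  have 3: "expectation (\<lambda>\<omega>. D \<omega> * g (X m \<omega>) - a * r (X m \<omega>)) =
    expectation (\<lambda>\<omega>. D \<omega> * g (X m \<omega>) + k (X m \<omega>) / 2) - expectation (\<lambda>\<omega>. k (X m \<omega>) / 2 + a * r (X m \<omega>))"
    using iDg ik ir by simp
  have "\<bar>expectation (\<lambda>\<omega>. u (X (Suc m) \<omega>)) - expectation (\<lambda>\<omega>. u' (X m \<omega>))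
      - expectation (\<lambda>\<omega>. D \<omega> * g (X m \<omega>) - a * r (X m \<omega>)) / n\<bar>
    \<le> C * step_error \<bar>a\<bar> n / n + C * (1 / n)\<^sup>2"
    unfolding 3 diff_divide_distrib using 1 2 by linarith
  also have "\<dots> = C * (step_error \<bar>a\<bar> n + 1 / n) / n"
    by (simp add: algebra_simps add_divide_distrib power2_eq_square)
  finally show ?thesis unfolding t1 by (simp add: u_def u'_def D_def g_def r_def)
qed

lemma telescoping_bound:
  fixes e G :: "nat \<Rightarrow> real"
  assumes "\<And>m. m < n \<Longrightarrow> \<bar>e (Suc m) - e m - G m\<bar> \<le> q"
  shows "\<bar>e n - e 0 - (\<Sum>m<n. G m)\<bar> \<le> n * q"
proof -
  have "e n - e 0 - (\<Sum>m<n. G m) = (\<Sum>m<n. e (Suc m) - e m - G m)"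
    by (simp only: sum_subtractf[of "\<lambda>m. e (Suc m) - e m"] sum_lessThan_telescope)
  also have "\<bar>\<dots>\<bar> \<le> (\<Sum>m<n. q)"
    by (intro order_trans[OF sum_abs] sum_mono) (use assms in auto)
  finally show ?thesis by simp
qed

text \<open>The weight \<open>w\<close> has the sign opposite to \<open>a\<close> or is degenerate,
  which lets one inequality serve maximisation for both signs. \<open>C\<close> is fixed before the
  strategy and \<open>n\<close>, so the estimate survives the supremum over strategies.\<close>

lemma refl_val_final:
  assumes \<delta>: "\<delta> > 0" and y: "y \<ge> 0" and \<mu>: "\<mu>L = \<beta> - a" "\<mu>R = \<beta> + a"
  obtains C where "C > 0"
    "\<And>\<theta> n w. nonanticipating \<theta> \<Longrightarrow> n \<ge> 1 \<Longrightarrow> a * w \<le> 0 \<Longrightarrow>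
      w * expectation (\<lambda>\<omega>. refl_val a y \<delta> (T_stat M \<sigma> WL WR \<theta> n n \<omega> - c))
        \<le> w * refl_val a y (1 + \<delta>) (\<beta> - c) + \<bar>w\<bar> * C * (step_error \<bar>a\<bar> n + 1 / n)"
    "\<And>n \<mu>u \<mu>l. n \<ge> 1 \<Longrightarrow> (\<mu>u + \<mu>l) / 2 = \<beta> \<Longrightarrow>
      \<bar>expectation (\<lambda>\<omega>. refl_val a y \<delta>
          (T_stat M \<sigma> WL WR (threshold_strategy M \<sigma> WL WR \<mu>u \<mu>l n c) n n \<omega> - c))
        - refl_val a y (1 + \<delta>) (\<beta> - c)\<bar> \<le> C * (step_error \<bar>a\<bar> n + 1 / n)"
proof -
  have "\<delta> \<le> 1 + \<delta>" by simp
  then obtain C where C0: "C > 0" and C: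
    "\<And>t x. t \<in> {\<delta>..1 + \<delta>} \<Longrightarrow> \<bar>refl_val1 a y t x\<bar> \<le> C"
    "\<And>t x. t \<in> {\<delta>..1 + \<delta>} \<Longrightarrow> \<bar>refl_val2 a y t x\<bar> \<le> C"
    "\<And>t x x'. t \<in> {\<delta>..1 + \<delta>} \<Longrightarrow> \<bar>refl_val2 a y t x - refl_val2 a y t x'\<bar> \<le> C * \<bar>x - x'\<bar>"
    "\<And>t s x. \<lbrakk>t \<in> {\<delta>..1 + \<delta>}; s \<ge> 0; t + s \<le> 1 + \<delta>\<rbrakk> \<Longrightarrow>
      \<bar>refl_val a y (t + s) x - refl_val a y t x
        - s * (refl_val2 a y t x / 2 + a * refl_cdf1 a y t \<bar>x\<bar>)\<bar> \<le> C * s\<^sup>2"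
    using refl_val_bounds[OF \<delta>, of "1 + \<delta>" a y] by metis
  \<comment> \<open>Drift of the chosen arm minus the feedback drift a sgn(x), times v_x: what one
    round loses or gains against the threshold rule, up to the factor 1/n.\<close>
  define gap where "gap = (\<lambda>\<theta> n m \<omega>.
    (if \<theta> (Suc m) \<omega> = (1::nat) then - a else a) * refl_val1 a y (\<delta> + (1 - real (Suc m) / real n)) (centred_stat \<theta> n \<beta> c m \<omega>)
      - a * refl_cdf1 a y (\<delta> + (1 - real (Suc m) / real n)) \<bar>centred_stat \<theta> n \<beta> c m \<omega>\<bar>)"
  have main: "\<bar>expectation (\<lambda>\<omega>. refl_val a y \<delta> (T_stat M \<sigma> WL WR \<theta> n n \<omega> - c))
      - refl_val a y (1 + \<delta>) (\<beta> - c) - (\<Sum>m<n. expectation (gap \<theta> n m) / n)\<bar>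
      \<le> C * (step_error \<bar>a\<bar> n + 1 / n)"
    if \<theta>: "nonanticipating \<theta>" and n: "n \<ge> 1" for \<theta> n
  proof -
    define e where "e = (\<lambda>m. expectation (\<lambda>\<omega>. refl_val a y (\<delta> + (1 - real m / n)) (centred_stat \<theta> n \<beta> c m \<omega>)))"
    have "\<bar>e n - e 0 - (\<Sum>m<n. expectation (gap \<theta> n m) / n)\<bar> \<le> n * (C * (step_error \<bar>a\<bar> n + 1 / n) / n)"
      by (rule telescoping_bound) (unfold e_def gap_def, rule refl_val_one_step[OF \<theta> _ \<delta> y \<mu> C])
    moreover have "e n = expectation (\<lambda>\<omega>. refl_val a y \<delta> (T_stat M \<sigma> WL WR \<theta> n n \<omega> - c))"
      using n by (simp add: e_def centred_stat_def)
    moreover have "e 0 = refl_val a y (1 + \<delta>) (\<beta> - c)"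
      by (simp add: e_def centred_stat_def T_stat_def prob_space add.commute)
    ultimately show ?thesis using n by simp
  qed
  have r1: "refl_cdf1 a y (\<delta> + (1 - real (Suc m) / n)) \<bar>x\<bar> \<le> 0" if "m < n" for m n :: nat and x
  proof -
    have "\<delta> + (1 - real (Suc m) / n) > 0"
      using that \<delta> by (intro add_pos_nonneg) (auto simp: divide_le_eq)
    then show ?thesis by (intro refl_cdf1_nonpos) (use y in auto)
  qed
  have r0: "refl_cdf1 a y (\<delta> + (1 - real (Suc m) / n)) 0 = 0" if "m < n" for m n :: nat
  proof -
    have "\<delta> + (1 - real (Suc m) / n) > 0"
      using that \<delta> by (intro add_pos_nonneg) (auto simp: divide_le_eq)
    then show ?thesis by (rule refl_cdf1_zero)
  qed
  show ?thesis
  proof (rule that[OF C0])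
    fix \<theta> and n :: nat and w :: real assume \<theta>: "nonanticipating \<theta>" and n: "n \<ge> 1" and aw: "a * w \<le> 0"
    have gw: "w * expectation (gap \<theta> n m) \<le> 0" if m: "m < n" for m
    proof -
      have "w * gap \<theta> n m \<omega> \<le> 0" for \<omega>
      proof -
        define x where "x = centred_stat \<theta> n \<beta> c m \<omega>"
        define \<rho> where "\<rho> = refl_cdf1 a y (\<delta> + (1 - real (Suc m) / n)) \<bar>x\<bar>"
        have p: "(a * w) * \<rho> \<ge> 0" using r1[OF m, of x] aw by (simp add: \<rho>_def mult_nonpos_nonpos)
        \<comment> \<open>If the chosen drift matches the sign of \<open>x\<close>, the two terms
          cancel; otherwise they add up. At x = 0 both vanish, whatever arm is chosen.\<close>
        consider "x = 0" | "gap \<theta> n m \<omega> = 0" | "gap \<theta> n m \<omega> = - 2 * a * \<rho>"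
          unfolding gap_def refl_val1_def x_def[symmetric] \<rho>_def by (cases "x = 0"; cases "x > 0"; cases "\<theta> (Suc m) \<omega> = 1") auto
        then show ?thesis
        proof cases
          case 1
          then show ?thesis using r0[OF m] by (simp add: gap_def refl_val1_def x_def)
        next
          case 3
          have "w * gap \<theta> n m \<omega> = - 2 * ((a * w) * \<rho>)" unfolding 3 by simp
          with p show ?thesis by linarith
        qed simp
      qed
      then have "expectation (\<lambda>\<omega>. - (w * gap \<theta> n m \<omega>)) \<ge> 0" by (intro Bochner_Integration.integral_nonneg) simp
      then show ?thesis by simp
    qed
    have "w * (\<Sum>m<n. expectation (gap \<theta> n m) / n) = (\<Sum>m<n. w * expectation (gap \<theta> n m) / n)"
      by (simp add: sum_distrib_left)
    also have "\<dots> \<le> 0" using gw by (intro sum_nonpos divide_nonpos_nonneg) auto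
    finally have s: "w * (\<Sum>m<n. expectation (gap \<theta> n m) / n) \<le> 0" .
    define E where "E = expectation (\<lambda>\<omega>. refl_val a y \<delta> (T_stat M \<sigma> WL WR \<theta> n n \<omega> - c))"
    have "w * (E - refl_val a y (1 + \<delta>) (\<beta> - c) - (\<Sum>m<n. expectation (gap \<theta> n m) / n))
        \<le> \<bar>w\<bar> * \<bar>E - refl_val a y (1 + \<delta>) (\<beta> - c) - (\<Sum>m<n. expectation (gap \<theta> n m) / n)\<bar>"
      unfolding abs_mult[symmetric] by (rule abs_ge_self)
    also have "\<dots> \<le> \<bar>w\<bar> * (C * (step_error \<bar>a\<bar> n + 1 / n))"
      unfolding E_def by (rule mult_left_mono[OF main[OF \<theta> n]]) simp
    finally have "w * (E - refl_val a y (1 + \<delta>) (\<beta> - c) - (\<Sum>m<n. expectation (gap \<theta> n m) / n))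
        \<le> \<bar>w\<bar> * (C * (step_error \<bar>a\<bar> n + 1 / n))" .
    then show "w * expectation (\<lambda>\<omega>. refl_val a y \<delta> (T_stat M \<sigma> WL WR \<theta> n n \<omega> - c))
        \<le> w * refl_val a y (1 + \<delta>) (\<beta> - c) + \<bar>w\<bar> * C * (step_error \<bar>a\<bar> n + 1 / n)"
      unfolding E_def[symmetric] using s by (simp only: right_diff_distrib mult.assoc)
  next
    fix n :: nat and \<mu>u \<mu>l assume n: "n \<ge> 1" and \<beta>: "(\<mu>u + \<mu>l) / 2 = \<beta>"
    define \<theta> where "\<theta> = threshold_strategy M \<sigma> WL WR \<mu>u \<mu>l n c"
    \<comment> \<open>The threshold rule picks drift -a for x \<le> 0 and a for x > 0, which is the
      feedback drift except at x = 0, where the slope is zero.\<close>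
    have "gap \<theta> n m \<omega> = 0" if m: "m < n" for m \<omega>
    proof -
      have "\<theta> (Suc m) \<omega> = (if centred_stat \<theta> n \<beta> c m \<omega> \<le> 0 then 1 else 2)"
        unfolding \<theta>_def using threshold_strategy_rec[of "Suc m" M \<sigma> WL WR \<mu>u \<mu>l n c \<omega>]
        by (simp add: \<beta> centred_stat_def)
      then show ?thesis using r0[OF m] by (simp add: gap_def refl_val1_def sgn_if)
    qed
    then have "(\<Sum>m<n. expectation (gap \<theta> n m) / n) = 0"
      by (intro sum.neutral) (auto simp: cong: Bochner_Integration.integral_cong)
    with main[of \<theta> n] n nonanticipating_threshold
    show "\<bar>expectation (\<lambda>\<omega>. refl_val a y \<delta>
          (T_stat M \<sigma> WL WR (threshold_strategy M \<sigma> WL WR \<mu>u \<mu>l n c) n n \<omega> - c))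
        - refl_val a y (1 + \<delta>) (\<beta> - c)\<bar> \<le> C * (step_error \<bar>a\<bar> n + 1 / n)"
      by (simp add: \<theta>_def)
  qed
qed

end

section \<open>Approximation by weighted level indicators\<close>

text \<open>The weights are the decrements of \<psi> along an equally spaced grid, hence
  nonnegative, and \<open>L\<close> is its value at the last grid point. Both the equal spacing and
  the bound \<epsilon> on each weight matter later: a smoothed indicator is inaccurate near its
  jump, but only one jump of weight at most \<epsilon> can be close to a given point.\<close>

lemma antimono_step_approximation:
  fixes \<psi> :: "real \<Rightarrow> real"
  assumes cont: "continuous_on {0..} \<psi>" and anti: "antimono_on {0..} \<psi>"
    and lim: "(\<psi> \<longlongrightarrow> l) at_top" and \<epsilon>: "\<epsilon> > 0"
  obtains L h w and N :: nat where "h > 0"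
    "\<And>k. 0 \<le> w k" "\<And>k. k < N \<Longrightarrow> w k \<le> \<epsilon>"
    "\<And>z. z \<ge> 0 \<Longrightarrow> \<bar>\<psi> z - (L + (\<Sum>k<N. w k * (if z \<le> h * (real k + 1) then 1 else 0)))\<bar> \<le> \<epsilon>"
proof -
  have mono: "\<psi> v \<le> \<psi> u" if "0 \<le> u" "u \<le> v" for u v
    using anti that by (auto simp: monotone_on_def)
  have "\<forall>\<^sub>F z in at_top. dist (\<psi> z) l < \<epsilon> / 2" using \<epsilon> by (intro tendstoD[OF lim]) simp
  then obtain R0 where R0: "\<And>z. z \<ge> R0 \<Longrightarrow> dist (\<psi> z) l < \<epsilon> / 2" by (auto simp: eventually_at_top_linorder)
  define R where "R = max R0 1"
  have R: "R > 0" by (simp add: R_def)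
  have tail: "\<bar>\<psi> u - \<psi> v\<bar> \<le> \<epsilon>" if "u \<ge> R" "v \<ge> R" for u v
  proof -
    have "R0 \<le> u" "R0 \<le> v" using that by (auto simp: R_def)
    from R0[OF this(1)] R0[OF this(2)] show ?thesis unfolding dist_real_def by linarith
  qed
  have "uniformly_continuous_on {0..R + 1} \<psi>"
    using cont by (intro compact_uniformly_continuous continuous_on_subset[OF cont]) auto
  then obtain d where d: "d > 0"
    "\<And>u v. u \<in> {0..R + 1} \<Longrightarrow> v \<in> {0..R + 1} \<Longrightarrow> dist v u < d \<Longrightarrow> dist (\<psi> v) (\<psi> u) < \<epsilon>"
    using \<epsilon> unfolding uniformly_continuous_on_def by metis
  \<comment> \<open>\<open>d / 2\<close> makes the spacing strictly smaller than \<open>d\<close>;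
    the cap 1 keeps the last grid point in [0, R + 1], where uniform continuity is
    available.\<close>
  define h where "h = min (d / 2) 1"
  have h: "h > 0" "h < d" "h \<le> 1" using d by (auto simp: h_def)
  define N where "N = nat \<lceil>R / h\<rceil>"
  have "0 \<le> R / h" using R h by simp
  then have "0 \<le> \<lceil>R / h\<rceil>" by simp
  then have N: "real N \<ge> R / h" "real N < R / h + 1" unfolding N_def by linarith+
  have NR: "h * real N \<ge> R" "h * real N \<le> R + 1"
    using N h by (auto simp: field_simps)
  define w where "w = (\<lambda>k. \<psi> (h * real k) - \<psi> (h * (real k + 1)))"
  have w0: "0 \<le> w k" for k unfolding w_def using mono[of "h * real k" "h * (real k + 1)"] h by simp
  have w1: "w k \<le> \<epsilon>" if "k < N" for k
  proof -
    have "h * (real k + 1) \<le> h * real N" using that h by (intro mult_left_mono) auto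
    then have m: "h * (real k + 1) \<in> {0..R + 1}" "h * real k \<in> {0..R + 1}" using NR h by (auto simp: algebra_simps)
    have "dist (h * (real k + 1)) (h * real k) < d" using h by (simp add: dist_real_def algebra_simps)
    from d(2)[OF m(2,1) this] show ?thesis by (simp add: w_def dist_real_def)
  qed
  \<comment> \<open>With \<open>n\<close> levels the approximation is good on [0, h n] with base
    value \<psi>(h n), and the sum vanishes beyond. One more level lowers the base by
    \<open>w n\<close>, which the new indicator restores to the left.\<close>
  have key: "(z \<le> h * real n \<longrightarrow> \<bar>\<psi> z - (\<psi> (h * real n) + (\<Sum>k<n. w k * (if z \<le> h * (real k + 1) then 1 else 0)))\<bar> \<le> \<epsilon>) \<and>
      (h * real n < z \<longrightarrow> (\<Sum>k<n. w k * (if z \<le> h * (real k + 1) then 1 else 0)) = 0)"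
    if "n \<le> N" "z \<ge> 0" for n z
    using that(1)
  proof (induction n)
    case 0
    then show ?case using that(2) \<epsilon> by auto
  next
    case (Suc n)
    define S where "S = (\<Sum>k<n. w k * (if z \<le> h * (real k + 1) then 1 else 0))"
    have IH: "z \<le> h * real n \<Longrightarrow> \<bar>\<psi> z - (\<psi> (h * real n) + S)\<bar> \<le> \<epsilon>" "h * real n < z \<Longrightarrow> S = 0"
      using Suc by (auto simp: S_def)
    have hs: "h * real (Suc n) = h * (real n + 1)" by (simp add: add.commute)
    have lt: "h * real n < h * (real n + 1)" using h by simp
    have eq: "(\<Sum>k<Suc n. w k * (if z \<le> h * (real k + 1) then 1 else 0)) =
        S + w n * (if z \<le> h * (real n + 1) then 1 else 0)"
      by (simp add: S_def)
    have wn: "\<psi> (h * (real n + 1)) + w n = \<psi> (h * real n)" by (simp add: w_def)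
    consider "z \<le> h * real n" | "h * real n < z" "z \<le> h * (real n + 1)" | "h * (real n + 1) < z" by linarith
    then show ?case
    proof cases
      case 1
      then have "z \<le> h * (real n + 1)" using lt by linarith
      then show ?thesis using IH(1)[OF 1] wn unfolding hs eq by (simp add: algebra_simps)
    next
      case 2
      have "\<psi> z \<le> \<psi> (h * real n)" "\<psi> (h * (real n + 1)) \<le> \<psi> z"
        using 2 h that(2) by (auto intro!: mono)
      then have "\<bar>\<psi> z - \<psi> (h * real n)\<bar> \<le> \<epsilon>" using w1[of n] Suc(2) by (simp add: w_def)
      then show ?thesis using 2 IH(2)[OF 2(1)] wn unfolding hs eq by simp
    next
      case 3
      then have "h * real n < z" using lt by linarith
      then show ?thesis using 3 IH(2) unfolding hs eq by simp
    qed
  qed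
  show ?thesis
  proof (rule that[of h w N "\<psi> (h * real N)"])
    fix z :: real assume z: "z \<ge> 0"
    show "\<bar>\<psi> z - (\<psi> (h * real N) + (\<Sum>k<N. w k * (if z \<le> h * (real k + 1) then 1 else 0)))\<bar> \<le> \<epsilon>"
    proof (cases "z \<le> h * real N")
      case True
      then show ?thesis using key[of N z] z by simp
    next
      case False
      then show ?thesis using key[of N z] z tail[of z "h * real N"] NR by simp
    qed
  qed (use h w0 w1 in auto)
qed

text \<open>Uniformity in \<open>z\<close> comes from monotonicity of \<open>bm_cdf\<close>: away
  from the jump the direct term is controlled by its values at -\<rho> and \<rho>, and the image
  term by its value at z = 0. All three bounds converge as time tends to 0.\<close>

lemma refl_cdf_tendsto_indicator:
  assumes y: "y > 0" and \<rho>: "\<rho> > 0" and \<epsilon>: "\<epsilon> > 0"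
  shows "\<forall>\<^sub>F \<delta> in at_right 0. \<forall>z\<ge>0. \<rho> \<le> \<bar>z - y\<bar> \<longrightarrow> \<bar>refl_cdf a y \<delta> z - (if z \<le> y then 1 else 0)\<bar> \<le> \<epsilon>"
proof -
  interpret real_distribution std_normal_distribution by (rule real_dist_normal_dist)
  have l: "((\<lambda>\<delta>. bm_cdf a \<delta> (- u)) \<longlongrightarrow> 0) (at_right 0)" if "u > 0" for u
  proof -
    have "filterlim (\<lambda>\<delta>. (- u - a * \<delta>) / sqrt \<delta>) at_bot (at_right 0)" using that by real_asymp
    from filterlim_compose[OF cdf_lim_at_bot this] show ?thesis by (simp add: bm_cdf_def)
  qed
  have "filterlim (\<lambda>\<delta>. (\<rho> - a * \<delta>) / sqrt \<delta>) at_top (at_right 0)" using \<rho> by real_asymp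
  from filterlim_compose[OF cdf_lim_at_top_prob this]
  have r: "((\<lambda>\<delta>. bm_cdf a \<delta> \<rho>) \<longlongrightarrow> 1) (at_right 0)" by (simp add: bm_cdf_def)
  have "((\<lambda>\<delta>. bm_cdf a \<delta> (- \<rho>) + (1 - bm_cdf a \<delta> \<rho>) + exp (2 * a * y) * bm_cdf a \<delta> (- y)) \<longlongrightarrow>
      0 + (1 - 1) + exp (2 * a * y) * 0) (at_right 0)"
    by (intro tendsto_intros l r y \<rho>)
  then have "((\<lambda>\<delta>. bm_cdf a \<delta> (- \<rho>) + (1 - bm_cdf a \<delta> \<rho>) + exp (2 * a * y) * bm_cdf a \<delta> (- y)) \<longlongrightarrow> 0) (at_right 0)"
    by simp
  then have "\<forall>\<^sub>F \<delta> in at_right 0. bm_cdf a \<delta> (- \<rho>) + (1 - bm_cdf a \<delta> \<rho>) + exp (2 * a * y) * bm_cdf a \<delta> (- y) < \<epsilon>"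
    using \<epsilon> by (rule order_tendstoD)
  moreover have "\<forall>\<^sub>F \<delta> in at_right (0::real). \<delta> > 0" by (rule eventually_at_right_less)
  ultimately show ?thesis
  proof eventually_elim
    case (elim \<delta>)
    have mono: "bm_cdf a \<delta> u \<le> bm_cdf a \<delta> v" if "u \<le> v" for u v
      unfolding bm_cdf_def using that elim(2) by (intro cdf_nondecreasing divide_right_mono) auto
    show ?case
    proof (intro allI impI)
      fix z :: real assume z: "z \<ge> 0" "\<rho> \<le> \<bar>z - y\<bar>"
      have e: "0 \<le> exp (2 * a * y) * bm_cdf a \<delta> (- y - z)"
        "exp (2 * a * y) * bm_cdf a \<delta> (- y - z) \<le> exp (2 * a * y) * bm_cdf a \<delta> (- y)"
        using mono[of "- y - z" "- y"] z bm_cdf_nonneg by auto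
      note b = bm_cdf_le_1[of a \<delta> "y - z"] bm_cdf_nonneg[of a \<delta> "y - z"] bm_cdf_nonneg[of a \<delta> "- \<rho>"] bm_cdf_le_1[of a \<delta> \<rho>]
      show "\<bar>refl_cdf a y \<delta> z - (if z \<le> y then 1 else 0)\<bar> \<le> \<epsilon>"
      proof (cases "z \<le> y")
        case True
        then have "bm_cdf a \<delta> \<rho> \<le> bm_cdf a \<delta> (y - z)" using z by (intro mono) auto
        then show ?thesis using e b elim(1) unfolding refl_cdf_def if_P[OF True] by linarith
      next
        case False
        then have "bm_cdf a \<delta> (y - z) \<le> bm_cdf a \<delta> (- \<rho>)" using z by (intro mono) auto
        moreover have "0 \<le> refl_cdf a y \<delta> z" using elim z y by (intro refl_cdf_nonneg) auto
        moreover have "0 \<le> exp (2 * a * y) * bm_cdf a \<delta> (- y)" using e by linarith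
        ultimately show ?thesis using False e b elim(1) unfolding refl_cdf_def if_not_P[OF False] by linarith
      qed
    qed
  qed
qed

text \<open>The same weights serve for sharp indicators, which are integrated against the limit law,
  and for \<open>refl_val\<close> at small times, to which the bandit estimates apply. The error 3
  \<epsilon> is one \<epsilon> for the step function, one for the jump close to |x|, and one for all
  other levels together.\<close>

lemma refl_val_approximation:
  fixes \<psi> :: "real \<Rightarrow> real"
  assumes cont: "continuous_on {0..} \<psi>" and anti: "antimono_on {0..} \<psi>"
    and lim: "(\<psi> \<longlongrightarrow> l) at_top" and \<epsilon>: "\<epsilon> > 0"
  obtains L y w and N :: nat where
    "\<And>k. 0 \<le> w k" "\<And>k. 0 < y k"
    "\<And>x. \<bar>\<psi> \<bar>x\<bar> - (L + (\<Sum>k<N. w k * indicator {- y k..y k} x))\<bar> \<le> \<epsilon>"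
    "\<forall>\<^sub>F \<delta> in at_right 0. \<forall>x. \<bar>\<psi> \<bar>x\<bar> - (L + (\<Sum>k<N. w k * refl_val a (y k) \<delta> x))\<bar> \<le> 3 * \<epsilon>"
proof -
  obtain L h w and N :: nat where h: "h > 0" and w0: "\<And>k. 0 \<le> w k" and w1: "\<And>k. k < N \<Longrightarrow> w k \<le> \<epsilon>"
    and ap: "\<And>z. z \<ge> 0 \<Longrightarrow> \<bar>\<psi> z - (L + (\<Sum>k<N. w k * (if z \<le> h * (real k + 1) then 1 else 0)))\<bar> \<le> \<epsilon>"
    by (rule antimono_step_approximation[OF cont anti lim \<epsilon>]) (rule that)
  define y where "y = (\<lambda>k::nat. h * (real k + 1))"
  have y0: "y k > 0" for k using h by (simp add: y_def)
  define W where "W = (\<Sum>k<N. w k)"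
  have W: "W \<ge> 0" unfolding W_def by (intro sum_nonneg w0)
  \<comment> \<open>Weighted by all levels this adds up to at most \<epsilon>; the summand 1 covers
    total weight 0.\<close>
  define \<epsilon>' where "\<epsilon>' = \<epsilon> / (1 + W)"
  have \<epsilon>': "\<epsilon>' > 0" using \<epsilon> W by (simp add: \<epsilon>'_def add_pos_nonneg)
  have W\<epsilon>: "W * \<epsilon>' \<le> \<epsilon>" using W \<epsilon> by (simp add: \<epsilon>'_def field_simps add_pos_nonneg)
  have ap': "\<bar>\<psi> \<bar>x\<bar> - (L + (\<Sum>k<N. w k * (if \<bar>x\<bar> \<le> y k then 1 else 0)))\<bar> \<le> \<epsilon>" for x
    using ap[of "\<bar>x\<bar>"] by (simp add: y_def)
  show ?thesis
  proof (rule that[of w y L N])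
    show "\<bar>\<psi> \<bar>x\<bar> - (L + (\<Sum>k<N. w k * indicator {- y k..y k} x))\<bar> \<le> \<epsilon>" for x
    proof -
      have "indicator {- y k..y k} x = (if \<bar>x\<bar> \<le> y k then 1 else 0 :: real)" for k by (auto simp: indicator_def)
      then show ?thesis using ap'[of x] by simp
    qed
    have "\<forall>\<^sub>F \<delta> in at_right 0. \<forall>k\<in>{..<N}. \<forall>z\<ge>0. h / 2 \<le> \<bar>z - y k\<bar> \<longrightarrow>
        \<bar>refl_cdf a (y k) \<delta> z - (if z \<le> y k then 1 else 0)\<bar> \<le> \<epsilon>'"
      using h y0 \<epsilon>' by (intro eventually_ball_finite ballI refl_cdf_tendsto_indicator) auto
    moreover have "\<forall>\<^sub>F \<delta> in at_right (0::real). \<delta> > 0" by (rule eventually_at_right_less)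
    ultimately show "\<forall>\<^sub>F \<delta> in at_right 0. \<forall>x. \<bar>\<psi> \<bar>x\<bar> - (L + (\<Sum>k<N. w k * refl_val a (y k) \<delta> x))\<bar> \<le> 3 * \<epsilon>"
    proof eventually_elim
      case (elim \<delta>)
      show ?case
      proof
        fix x
        \<comment> \<open>The levels too close to |x| for the uniform convergence. Distinct levels
          are at least \<open>h\<close> apart, so there is at most one.\<close>
        define B where "B = {k\<in>{..<N}. \<bar>\<bar>x\<bar> - y k\<bar> < h / 2}"
        have "card B \<le> 1"
        proof (rule card_le_Suc0_iff_eq[THEN iffD2, unfolded One_nat_def[symmetric]])
          show "\<forall>i\<in>B. \<forall>j\<in>B. i = j"
          proof (intro ballI)
            fix i j assume "i \<in> B" "j \<in> B"
            then have "\<bar>\<bar>x\<bar> - y i\<bar> < h / 2" "\<bar>\<bar>x\<bar> - y j\<bar> < h / 2" unfolding B_def by blast+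
            then have "\<bar>y i - y j\<bar> < h" by linarith
            then have "h * \<bar>real i - real j\<bar> < h * 1"
              using h by (simp add: y_def abs_mult flip: right_diff_distrib)
            then have "\<bar>real i - real j\<bar> < 1" using h by (simp only: mult_less_cancel_left_pos)
            then show "i = j" by linarith
          qed
        qed (simp add: B_def)
        then have B\<epsilon>: "(\<Sum>k\<in>B. w k) \<le> \<epsilon>"
        proof -
          have "(\<Sum>k\<in>B. w k) \<le> real (card B) * \<epsilon>" by (rule sum_bounded_above) (auto simp: B_def intro: w1)
          also have "\<dots> \<le> 1 * \<epsilon>" using \<open>card B \<le> 1\<close> \<epsilon> by (intro mult_right_mono) auto
          finally show ?thesis by simp
        qed
        have t: "\<bar>w k * refl_val a (y k) \<delta> x - w k * (if \<bar>x\<bar> \<le> y k then 1 else 0)\<bar>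
            \<le> w k * \<epsilon>' + (if k \<in> B then w k else 0)" if k: "k < N" for k
        proof -
          have "\<bar>refl_val a (y k) \<delta> x - (if \<bar>x\<bar> \<le> y k then 1 else 0)\<bar> \<le> \<epsilon>' + (if k \<in> B then 1 else 0)"
          proof (cases "k \<in> B")
            case True
            then show ?thesis using refl_val_0_1[OF elim(2), of "y k" a x] y0[of k] \<epsilon>' by auto
          next
            case False
            then have "h / 2 \<le> \<bar>\<bar>x\<bar> - y k\<bar>" using k by (auto simp: B_def)
            then show ?thesis using elim(1) k False by (auto simp: refl_val_def)
          qed
          from mult_left_mono[OF this w0[of k]] show ?thesis
            using w0[of k] by (simp only: right_diff_distrib[symmetric] abs_mult) (auto simp: distrib_left)
        qed
        have "\<bar>(\<Sum>k<N. w k * refl_val a (y k) \<delta> x) - (\<Sum>k<N. w k * (if \<bar>x\<bar> \<le> y k then 1 else 0))\<bar>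
            \<le> (\<Sum>k<N. w k * \<epsilon>' + (if k \<in> B then w k else 0))"
          unfolding sum_subtractf[symmetric] by (intro order_trans[OF sum_abs] sum_mono) (use t in auto)
        also have "\<dots> = W * \<epsilon>' + (\<Sum>k\<in>B. w k)"
        proof -
          have "{..<N} \<inter> B = B" by (auto simp: B_def)
          then show ?thesis by (simp add: sum.distrib W_def sum_distrib_right sum.If_cases)
        qed
        also have "\<dots> \<le> 2 * \<epsilon>" using B\<epsilon> W\<epsilon> by linarith
        finally show "\<bar>\<psi> \<bar>x\<bar> - (L + (\<Sum>k<N. w k * refl_val a (y k) \<delta> x))\<bar> \<le> 3 * \<epsilon>"
          using ap'[of x] by linarith
      qed
    qed
  qed (use w0 y0 in auto)
qed

section \<open>The bandit density and its folding about c\<close>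

text \<open>The difference \<open>k\<close> has derivative -p(u) / u^2, with p the standard normal
  density, and tends to 0 at infinity, so it is nonnegative.\<close>

lemma mills_ratio_bound:
  assumes "m > 0"
  shows "m * std_normal_cdf (- m) \<le> std_normal_density m"
proof -
  interpret real_distribution std_normal_distribution by (rule real_dist_normal_dist)
  define k where "k = (\<lambda>m. std_normal_density m / m - std_normal_cdf (- m))"
  have dd: "(std_normal_density has_real_derivative - u * std_normal_density u) (at u)" for u
    unfolding std_normal_density_def[abs_def] by (auto intro!: derivative_eq_intros simp: field_simps)
  have even: "std_normal_density (- u) = std_normal_density u" for u
    by (simp add: std_normal_density_def)
  have dk: "(k has_real_derivative - std_normal_density u / u\<^sup>2) (at u)" if "u > 0" for u
  proof -
    have "(k has_real_derivative ((- u * std_normal_density u) * u - std_normal_density u * 1) / (u * u)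
        - std_normal_density (- u) * - 1) (at u)"
      unfolding k_def using that
      by (intro DERIV_diff DERIV_divide dd DERIV_ident DERIV_chain2[OF std_normal_cdf_has_real_derivative]
          DERIV_minus) auto
    then show ?thesis using that by (simp add: even field_simps power2_eq_square)
  qed
  have "((\<lambda>u. std_normal_density u / u) \<longlongrightarrow> 0) at_top"
    unfolding std_normal_density_def by real_asymp
  moreover have "((\<lambda>u. std_normal_cdf (- u)) \<longlongrightarrow> 0) at_top"
    by (rule filterlim_compose[OF cdf_lim_at_bot filterlim_uminus_at_bot_at_top])
  ultimately have "(k \<longlongrightarrow> 0 - 0) at_top" unfolding k_def by (rule tendsto_diff)
  then have lim: "(k \<longlongrightarrow> 0) at_top" by simp
  have "k u \<le> k m" if "m \<le> u" for u
  proof (rule DERIV_nonpos_imp_nonincreasing[OF that])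
    fix v assume "m \<le> v"
    then have "v > 0" using assms by simp
    then show "\<exists>z. (k has_real_derivative z) (at v) \<and> z \<le> 0"
      using dk[of v] by (intro exI conjI) auto
  qed
  then have "0 \<le> k m"
    by (intro tendsto_upperbound[OF lim]) (auto intro: eventually_at_top_linorderI[of m])
  then show ?thesis using assms by (simp add: k_def field_simps)
qed

text \<open>Needed because \<open>bandit_distributed\<close> passes the density through
  \<open>ennreal\<close>, which would truncate negative values. For \<alpha> > 0 put m = |c -
  \<beta>| + |y - c| + \<alpha>. Since \<alpha> \<le> m, the Mills bound replaces the normal tail by
  a Gaussian, and |y - \<beta>| \<le> |y - c| + |c - \<beta>| compares the exponents.\<close>

lemma bandit_density_nonneg: "0 \<le> bandit_density \<alpha> \<beta> c y"
proof -
  interpret real_distribution std_normal_distribution by (rule real_dist_normal_dist)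
  define z where "z = \<bar>y - c\<bar>"
  define x where "x = \<bar>c - \<beta>\<bar>"
  define m where "m = x + z + \<alpha>"
  have nn: "z \<ge> 0" "x \<ge> 0" by (auto simp: z_def x_def)
  have cd: "0 \<le> std_normal_cdf u" for u by (rule cdf_nonneg)
  show ?thesis
  proof (cases "\<alpha> \<le> 0")
    case True
    then have "\<alpha> * (exp (2 * \<alpha> * z) * std_normal_cdf (- x - z - \<alpha>)) \<le> 0"
      using cd by (intro mult_nonpos_nonneg) auto
    then have "\<alpha> * exp (2 * \<alpha> * z) * std_normal_cdf (- x - z - \<alpha>) \<le> 0" by (simp add: mult.assoc)
    moreover have "0 \<le> 1 / sqrt (2 * pi) * exp u" for u :: real by simp
    ultimately show ?thesis
      unfolding bandit_density_def z_def[symmetric] x_def[symmetric] by (simp add: order_trans)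
  next
    case False
    then have m: "m > 0" "\<alpha> \<le> m" using nn by (auto simp: m_def)
    have "\<alpha> * std_normal_cdf (- m) \<le> std_normal_density m"
      using mult_right_mono[OF m(2) cd[of "- m"]] mills_ratio_bound[OF m(1)] by linarith
    then have "exp (2 * \<alpha> * z) * (\<alpha> * std_normal_cdf (- m)) \<le> exp (2 * \<alpha> * z) * std_normal_density m"
      by (intro mult_left_mono) auto
    also have "\<dots> = 1 / sqrt (2 * pi) * exp (2 * \<alpha> * z + - m\<^sup>2 / 2)"
      unfolding std_normal_density_def exp_add by simp
    also have "\<dots> \<le> 1 / sqrt (2 * pi) * exp (- ((y - \<beta>)\<^sup>2 - 2 * \<alpha> * (z - x) + \<alpha>\<^sup>2) / 2)"
    proof -
      have "\<bar>y - \<beta>\<bar> \<le> z + x" by (simp add: z_def x_def)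
      then have sq: "(y - \<beta>)\<^sup>2 \<le> (z + x)\<^sup>2" using nn by (intro power2_le_iff_abs_le[THEN iffD2]) auto
      then have "2 * \<alpha> * z + - m\<^sup>2 / 2 \<le> - ((y - \<beta>)\<^sup>2 - 2 * \<alpha> * (z - x) + \<alpha>\<^sup>2) / 2"
      proof -
        have "m\<^sup>2 = (z + x)\<^sup>2 + 2 * \<alpha> * z + 2 * \<alpha> * x + \<alpha>\<^sup>2"
          by (simp add: m_def power2_eq_square algebra_simps)
        moreover have "2 * \<alpha> * (z - x) = 2 * \<alpha> * z - 2 * \<alpha> * x" by (simp add: algebra_simps)
        moreover have "M = Z + p + r + A \<Longrightarrow> q = p - r \<Longrightarrow> Y \<le> Z \<Longrightarrow> p + - M / 2 \<le> - (Y - q + A) / 2"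
          for p r M Z Y q A :: real by (simp add: field_simps)
        ultimately show ?thesis using sq by blast
      qed
      then show ?thesis by (intro mult_left_mono) auto
    qed
    finally have "\<alpha> * exp (2 * \<alpha> * z) * std_normal_cdf (- m) \<le> 1 / sqrt (2 * pi) * exp (- ((y - \<beta>)\<^sup>2 - 2 * \<alpha> * (z - x) + \<alpha>\<^sup>2) / 2)"
      by (simp add: mult.commute mult.left_commute)
    moreover have "- m = - x - z - \<alpha>" by (simp add: m_def)
    ultimately show ?thesis by (simp add: bandit_density_def z_def x_def)
  qed
qed

lemma continuous_bandit_density: "continuous_on S (bandit_density \<alpha> \<beta> c)"
proof -
  have "continuous_on UNIV std_normal_cdf"
    by (rule DERIV_continuous_on[where D = std_normal_density]) (use std_normal_cdf_has_real_derivative in simp)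
  note c = continuous_on_compose2[OF this]
  show ?thesis
    unfolding bandit_density_def[abs_def] by (auto intro!: continuous_intros c)
qed

text \<open>Differentiating in the level, at time 1, yields the density of |\<eta> - c|, that is,
  the bandit density folded about \<open>c\<close>. The tail term of the density arises from
  differentiating the weight exp(2 a z), and half of it sits on each side of
  \<open>c\<close>.\<close>

lemma refl_cdf_has_derivative_level:
  fixes a \<beta> c z :: real
  assumes z: "z \<ge> 0"
  shows "((\<lambda>z. refl_cdf a z 1 \<bar>\<beta> - c\<bar>) has_real_derivative
    bandit_density a \<beta> c (c + z) + bandit_density a \<beta> c (c - z)) (at z)"
proof -
  define x where "x = \<bar>\<beta> - c\<bar>"
  have 1: "((\<lambda>z. bm_cdf a 1 (z - x)) has_real_derivative bm_density a 1 (z - x) * 1) (at z)"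
    by (intro DERIV_chain2[OF bm_cdf_has_real_derivative]) (auto intro!: derivative_eq_intros)
  have 2: "((\<lambda>z. bm_cdf a 1 (- z - x)) has_real_derivative bm_density a 1 (- z - x) * - 1) (at z)"
    by (intro DERIV_chain2[OF bm_cdf_has_real_derivative]) (auto intro!: derivative_eq_intros)
  have 3: "((\<lambda>z. exp (2 * a * z)) has_real_derivative exp (2 * a * z) * (2 * a)) (at z)"
    by (intro DERIV_chain2[OF DERIV_exp]) (auto intro!: derivative_eq_intros)
  have e1: "exp (- ((z - x - a)\<^sup>2) / 2) = exp (- ((z - x)\<^sup>2 - 2 * a * (z - x) + a\<^sup>2) / 2)"
    by (rule arg_cong[where f = exp]) (simp add: power2_eq_square algebra_simps)
  have e2: "exp (2 * a * z) * exp (- ((- z - x - a)\<^sup>2) / 2) = exp (- ((- z - x)\<^sup>2 - 2 * a * (z - x) + a\<^sup>2) / 2)"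
    unfolding exp_add[symmetric] by (rule arg_cong[where f = exp]) (simp add: power2_eq_square field_simps)
  \<comment> \<open>Which of \<open>c + z\<close> and \<open>c - z\<close> corresponds to
    \<open>z - x\<close> depends on the sign of \<open>\<beta> - c\<close>; the folded sum is the
    same in either case.\<close>
  have sq: "(c + z - \<beta>)\<^sup>2 = (z - x)\<^sup>2 \<and> (c - z - \<beta>)\<^sup>2 = (- z - x)\<^sup>2 \<or>
      (c + z - \<beta>)\<^sup>2 = (- z - x)\<^sup>2 \<and> (c - z - \<beta>)\<^sup>2 = (z - x)\<^sup>2"
    unfolding x_def by (cases "\<beta> \<ge> c") (auto simp: power2_eq_square algebra_simps)
  have ax: "\<bar>c - \<beta>\<bar> = x" "\<bar>c + z - c\<bar> = z" "\<bar>c - z - c\<bar> = z" using z by (auto simp: x_def)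
  define \<Phi> where "\<Phi> = std_normal_cdf (- x - z - a)"
  have b: "bandit_density a \<beta> c (c + z) + bandit_density a \<beta> c (c - z) =
      1 / sqrt (2 * pi) * exp (- ((z - x - a)\<^sup>2) / 2)
      + 1 / sqrt (2 * pi) * (exp (2 * a * z) * exp (- ((- z - x - a)\<^sup>2) / 2)) - 2 * a * exp (2 * a * z) * \<Phi>"
    unfolding bandit_density_def ax e1 e2 \<Phi>_def[symmetric] using sq by auto
  have "(- z - x - a * 1) / sqrt 1 = - x - z - a" by simp
  then have c: "bm_cdf a 1 (- z - x) = \<Phi>" unfolding bm_cdf_def \<Phi>_def by (simp only:)
  have "((\<lambda>z. refl_cdf a z 1 x) has_real_derivative bm_density a 1 (z - x) * 1 -
      (exp (2 * a * z) * (2 * a) * bm_cdf a 1 (- z - x) + bm_density a 1 (- z - x) * - 1 * exp (2 * a * z))) (at z)"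
    unfolding refl_cdf_def by (intro DERIV_diff DERIV_mult 1 2 3)
  then show ?thesis unfolding b x_def[symmetric] c
    by (simp add: bm_density_def algebra_simps)
qed

lemma integral_bandit_density:
  assumes r: "r \<ge> 0"
  shows "integral {c - r..c + r} (bandit_density a \<beta> c) = refl_cdf a r 1 \<bar>\<beta> - c\<bar>"
proof -
  let ?f = "bandit_density a \<beta> c"
  \<comment> \<open>Starting at \<open>c - r - 1\<close> makes \<open>c - r\<close> an interior
    point, so that the derivative there is two-sided.\<close>
  define F where "F = (\<lambda>x. integral {c - r - 1..x} ?f)"
  have dF: "(F has_real_derivative ?f x) (at x)" if "x \<in> {c - r..c + r}" for x
  proof -
    have "((\<lambda>x. integral {c - r - 1..x} ?f) has_real_derivative ?f x) (at x within {c - r - 1..c + r + 1})"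
      using that by (intro integral_has_real_derivative continuous_bandit_density) auto
    moreover have "at x within {c - r - 1..c + r + 1} = at x" using that by (intro at_within_Icc_at) auto
    ultimately show ?thesis unfolding F_def by simp
  qed
  define D where "D = (\<lambda>z. F (c + z) - F (c - z) - refl_cdf a z 1 \<bar>\<beta> - c\<bar>)"
  have dD: "(D has_real_derivative 0) (at z)" if "0 \<le> z" "z \<le> r" for z
  proof -
    have "((\<lambda>z. F (c + z)) has_real_derivative ?f (c + z) * 1) (at z)"
      using that by (intro DERIV_chain2[OF dF]) (auto intro!: derivative_eq_intros)
    moreover have "((\<lambda>z. F (c - z)) has_real_derivative ?f (c - z) * - 1) (at z)"
      using that by (intro DERIV_chain2[OF dF]) (auto intro!: derivative_eq_intros)
    ultimately have "(D has_real_derivative ?f (c + z) * 1 - ?f (c - z) * - 1 - (?f (c + z) + ?f (c - z))) (at z)"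
      unfolding D_def using that by (intro DERIV_diff refl_cdf_has_derivative_level)
    then show ?thesis by simp
  qed
  have "D r = D 0"
  proof (cases "r = 0")
    case False
    with r have "r > 0" by simp
    then show ?thesis
      by (rule DERIV_isconst2[of 0 r D r])
        (use dD r in \<open>auto intro!: DERIV_atLeastAtMost_imp_continuous_on\<close>)
  qed simp
  \<comment> \<open>\<open>D 0 = 0\<close>, because at level 0 the direct and the image term of
    \<open>refl_cdf\<close> coincide.\<close>
  then have "F (c + r) - F (c - r) = refl_cdf a r 1 \<bar>\<beta> - c\<bar>"
    by (simp add: D_def refl_cdf_def)
  moreover have "F (c - r) + integral {c - r..c + r} ?f = F (c + r)"
    unfolding F_def using r
    by (intro Henstock_Kurzweil_Integration.integral_combine integrable_continuous_real continuous_bandit_density) auto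
  ultimately show ?thesis by simp
qed

text \<open>The number \<open>refl_val a r 1 (\<beta> - c)\<close> is what the sum over the rounds
  produces as \<delta> tends to 0; here it is recognised on the side of \<eta>.\<close>

lemma bandit_distributed_interval:
  assumes N: "prob_space N" and \<eta>: "bandit_distributed N \<eta> a \<beta> c" and r: "r \<ge> 0"
  shows "integrable N (\<lambda>\<omega>. indicator {- r..r} (\<eta> \<omega> - c) :: real)"
    and "(\<integral>\<omega>. indicator {- r..r} (\<eta> \<omega> - c) \<partial>N) = refl_val a r 1 (\<beta> - c)"
proof -
  interpret N: prob_space N by (rule N)
  have d: "distributed N lborel \<eta> (\<lambda>y. ennreal (bandit_density a \<beta> c y))"
    using \<eta> by (simp add: bandit_distributed_def)
  then have [measurable]: "\<eta> \<in> borel_measurable N" by (auto dest: distributed_measurable)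
  show "integrable N (\<lambda>\<omega>. indicator {- r..r} (\<eta> \<omega> - c) :: real)"
    by (rule N.integrable_const_bound[of _ 1]) (auto simp: indicator_def)
  have "(\<integral>y. bandit_density a \<beta> c y * indicator {- r..r} (y - c) \<partial>lborel) = (\<integral>\<omega>. indicator {- r..r} (\<eta> \<omega> - c) \<partial>N)"
    by (rule distributed_integral[OF d]) (auto simp: bandit_density_nonneg)
  moreover have "bandit_density a \<beta> c y * indicator {- r..r} (y - c) = indicator {c - r..c + r} y *\<^sub>R bandit_density a \<beta> c y" for y
    by (auto simp: indicator_def)
  moreover have "(\<integral>y. indicator {c - r..c + r} y *\<^sub>R bandit_density a \<beta> c y \<partial>lborel) = integral {c - r..c + r} (bandit_density a \<beta> c)"
    using set_borel_integral_eq_integral(2)[OF borel_integrable_atLeastAtMost'[OF continuous_bandit_density]]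
    by (simp add: set_lebesgue_integral_def)
  ultimately show "(\<integral>\<omega>. indicator {- r..r} (\<eta> \<omega> - c) \<partial>N) = refl_val a r 1 (\<beta> - c)"
    using integral_bandit_density[OF r] by (simp add: refl_val_def)
qed

section \<open>Passage to the limit\<close>

lemma (in prob_space) expectation_close:
  fixes F G :: "'a \<Rightarrow> real"
  assumes "integrable M F" "integrable M G" "\<And>\<omega>. \<bar>F \<omega> - G \<omega>\<bar> \<le> e"
  shows "\<bar>expectation F - expectation G\<bar> \<le> e"
proof -
  have "\<bar>expectation F - expectation G\<bar> = \<bar>expectation (\<lambda>\<omega>. F \<omega> - G \<omega>)\<bar>" using assms by simp
  also have "\<dots> \<le> expectation (\<lambda>\<omega>. \<bar>F \<omega> - G \<omega>\<bar>)" by (rule integral_abs_bound)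
  also have "\<dots> \<le> expectation (\<lambda>\<omega>. e)" using assms by (intro integral_mono) auto
  finally show ?thesis by (simp add: prob_space)
qed

text \<open>Monotonicity is assumed on the open half-line, whereas the step approximation starts at
  0; continuity from the right supplies the endpoint.\<close>

lemma antimono_on_closure:
  fixes \<psi> :: "real \<Rightarrow> real"
  assumes "continuous_on UNIV \<psi>" "antimono_on {0<..} \<psi>"
  shows "antimono_on {0..} \<psi>"
proof (rule monotone_onI)
  fix u v :: real assume uv: "u \<in> {0..}" "v \<in> {0..}" "u \<le> v"
  show "\<psi> v \<le> \<psi> u"
  proof (cases "0 < u \<or> v = 0")
    case True
    then show ?thesis using assms(2) uv by (auto simp: monotone_on_def)
  next
    case False
    with uv have u: "u = 0" "v > 0" by auto
    have "isCont \<psi> 0" using assms(1) by (simp add: continuous_on_eq_continuous_at)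
    then have "(\<psi> \<longlongrightarrow> \<psi> 0) (at_right 0)" by (simp add: isCont_def filterlim_at_split)
    moreover have "\<forall>\<^sub>F t in at_right 0. \<psi> v \<le> \<psi> t"
      using assms(2) u unfolding eventually_at_right_field monotone_on_def
      by (intro exI[of _ v]) auto
    ultimately have "\<psi> v \<le> \<psi> 0" by (rule tendsto_lowerbound) simp
    then show ?thesis using u by simp
  qed
qed

lemma refl_val_tendsto_time:
  "((\<lambda>\<delta>. refl_val a y (1 + \<delta>) x) \<longlongrightarrow> refl_val a y 1 x) (at_right 0)"
proof -
  have "isCont (\<lambda>t. refl_cdf a y t \<bar>x\<bar>) 1"
    by (rule DERIV_isCont[OF refl_cdf_has_tderiv]) simp
  then have "((\<lambda>t. refl_cdf a y t \<bar>x\<bar>) \<longlongrightarrow> refl_cdf a y 1 \<bar>x\<bar>) (nhds 1)"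
    by (simp add: continuous_at tendsto_nhds_iff)
  moreover have "filterlim (\<lambda>\<delta>::real. 1 + \<delta>) (nhds 1) (at_right 0)"
    by (auto intro!: tendsto_eq_intros)
  ultimately show ?thesis unfolding refl_val_def by (rule filterlim_compose)
qed

context two_armed_bandit
begin

text \<open>
  The two parts of the theorem are treated at once: \<open>s = 1\<close> when \<open>\<phi>\<close> decreases away from \<open>c\<close>,
  \<open>s = - 1\<close> when it increases, and in both cases arm 1 has drift \<open>- a\<close> and arm 2 drift \<open>a\<close>
  relative to \<open>\<beta>\<close>.
\<close>

lemma asymptotically_optimal:
  fixes N :: "'b measure" and \<eta> :: "'b \<Rightarrow> real" and \<phi> :: "real \<Rightarrow> real" and a \<beta> c s :: real
  assumes \<mu>: "\<mu>L = \<beta> - a" "\<mu>R = \<beta> + a" "(\<mu>u + \<mu>l) / 2 = \<beta>"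
    and N: "prob_space N" and \<eta>: "bandit_distributed N \<eta> a \<beta> c"
    and cont: "continuous_on UNIV \<phi>" and lim: "(\<phi> \<longlongrightarrow> l) at_top"
    and sym: "\<And>x. \<phi> (x + c) = \<phi> (- x + c)"
    and s: "s = 1 \<or> s = - 1" and anti: "antimono_on {c<..} (\<lambda>x. s * \<phi> x)" and as: "a * s \<le> 0"
  shows "(\<lambda>n. expectation (\<lambda>\<omega>. \<phi> (T_stat M \<sigma> WL WR (threshold_strategy M \<sigma> WL WR \<mu>u \<mu>l n c) n n \<omega>)))
        \<longlonglongrightarrow> prob_space.expectation N (\<lambda>\<omega>. \<phi> (\<eta> \<omega>))" (is "?thr \<longlonglongrightarrow> ?lim")
    and "(\<lambda>n. SUP \<theta>\<in>admissible_strategies M WL WR. expectation (\<lambda>\<omega>. \<phi> (T_stat M \<sigma> WL WR \<theta> n n \<omega>)))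
        \<longlonglongrightarrow> prob_space.expectation N (\<lambda>\<omega>. \<phi> (\<eta> \<omega>))" (is "?sup \<longlonglongrightarrow> ?lim")
proof -
  interpret N: prob_space N by (rule N)
  have [measurable]: "\<phi> \<in> borel_measurable borel" using cont by (rule borel_measurable_continuous_onI)
  have [measurable]: "\<eta> \<in> borel_measurable N"
    using \<eta> unfolding bandit_distributed_def by (auto dest: distributed_measurable)
  \<comment> \<open>Folding at \<open>c\<close> and multiplying by \<open>s\<close> reduces both
    cases to a nonincreasing function on the half-line.\<close>
  define \<psi> where "\<psi> = (\<lambda>z. s * \<phi> (z + c))"
  have ss: "s * s = 1" and abs_s: "\<bar>s\<bar> = 1" using s by auto
  have \<phi>\<psi>: "\<phi> x = s * \<psi> \<bar>x - c\<bar>" for x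
  proof -
    have "\<phi> (\<bar>x - c\<bar> + c) = \<phi> x" using sym[of "x - c"] by (cases "x \<ge> c") auto
    then show ?thesis using ss by (simp add: \<psi>_def flip: mult.assoc)
  qed
  have \<psi>cont: "continuous_on UNIV \<psi>"
    unfolding \<psi>_def by (intro continuous_intros continuous_on_compose2[OF cont]) auto
  have "antimono_on {0<..} \<psi>"
    using anti unfolding \<psi>_def monotone_on_def by auto
  then have \<psi>anti: "antimono_on {0..} \<psi>" by (rule antimono_on_closure[OF \<psi>cont])
  have "filterlim (\<lambda>z. z + c) at_top at_top"
    by real_asymp
  then have \<psi>lim: "(\<psi> \<longlongrightarrow> s * l) at_top"
    unfolding \<psi>_def by (intro tendsto_mult tendsto_const filterlim_compose[OF lim])
  note approx = refl_val_approximation[OF continuous_on_subset[OF \<psi>cont subset_UNIV] \<psi>anti \<psi>lim, of _ a]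
  \<comment> \<open>The step approximation with accuracy 1 bounds \<phi>. This gives integrability
    and makes the suprema over strategies bounded above.\<close>
  obtain B where B: "\<And>x. \<bar>\<phi> x\<bar> \<le> B"
  proof -
    obtain L y w and K :: nat where w: "\<And>k. 0 \<le> w k" and ap:
      "\<And>x. \<bar>\<psi> \<bar>x\<bar> - (L + (\<Sum>k<K. w k * indicator {- y k..y k} x))\<bar> \<le> 1"
      by (rule approx[OF zero_less_one]) (rule that)
    have "\<bar>\<phi> x\<bar> \<le> \<bar>L\<bar> + (\<Sum>k<K. w k) + 1" for x
    proof -
      have "\<bar>\<Sum>k<K. w k * indicator {- y k..y k} (x - c)\<bar> \<le> (\<Sum>k<K. w k)"
        using w by (intro order_trans[OF sum_abs] sum_mono) (auto simp: abs_mult indicator_def)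
      then have "\<bar>\<psi> \<bar>x - c\<bar>\<bar> \<le> \<bar>L\<bar> + (\<Sum>k<K. w k) + 1" using ap[of "x - c"] by linarith
      then show ?thesis unfolding \<phi>\<psi>[of x] abs_mult abs_s by simp
    qed
    then show thesis by (rule that)
  qed
  have TM: "T_stat M \<sigma> WL WR \<theta> m n \<in> borel_measurable M" if "nonanticipating \<theta>" for \<theta> m n
    by (rule measurable_from_subalg[OF subalgebra_history[OF that] T_stat_measurable_history])
  have i\<phi>: "integrable M (\<lambda>\<omega>. \<phi> (T_stat M \<sigma> WL WR \<theta> n n \<omega>))" if "nonanticipating \<theta>" for \<theta> n
    using TM[OF that] B by (intro integrable_const_bound[of _ B]) auto
  have b\<phi>: "expectation (\<lambda>\<omega>. \<phi> (T_stat M \<sigma> WL WR \<theta> n n \<omega>)) \<le> B" if "nonanticipating \<theta>" for \<theta> n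
    using B by (intro integral_le_const[OF i\<phi>[OF that]]) (auto simp: abs_le_iff)
  \<comment> \<open>The budget of 6 \<epsilon>: 3 for the approximation on the bandit side, 1 for
    \<open>err\<close>, 1 for moving the horizon from 1 + \<delta> to 1, and 1 for the approximation
    on the side of \<eta>.\<close>
  have core: "\<forall>\<^sub>F n in sequentially. \<bar>?thr n - ?lim\<bar> \<le> 6 * \<epsilon> \<and>
      (\<forall>\<theta>. nonanticipating \<theta> \<longrightarrow> expectation (\<lambda>\<omega>. \<phi> (T_stat M \<sigma> WL WR \<theta> n n \<omega>)) \<le> ?lim + 6 * \<epsilon>)"
    if \<epsilon>: "\<epsilon> > 0" for \<epsilon>
  proof -
    obtain L y w and K :: nat where w: "\<And>k. 0 \<le> w k" and y: "\<And>k. 0 < y k"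
      and ap1: "\<And>x. \<bar>\<psi> \<bar>x\<bar> - (L + (\<Sum>k<K. w k * indicator {- y k..y k} x))\<bar> \<le> \<epsilon>"
      and ap2: "\<forall>\<^sub>F \<delta> in at_right 0. \<forall>x. \<bar>\<psi> \<bar>x\<bar> - (L + (\<Sum>k<K. w k * refl_val a (y k) \<delta> x))\<bar> \<le> 3 * \<epsilon>"
      by (rule approx[OF \<epsilon>]) (rule that)
    have flip: "\<bar>\<phi> x - (s * L + (\<Sum>k<K. s * w k * f k))\<bar> = \<bar>\<psi> \<bar>x - c\<bar> - (L + (\<Sum>k<K. w k * f k))\<bar>" for x f
    proof -
      have "\<phi> x - (s * L + (\<Sum>k<K. s * w k * f k)) = s * (\<psi> \<bar>x - c\<bar> - (L + (\<Sum>k<K. w k * f k)))"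
        unfolding \<phi>\<psi>[of x] by (simp add: algebra_simps sum_distrib_left)
      then show ?thesis by (simp add: abs_mult abs_s)
    qed
    \<comment> \<open>Predicted mean of the approximant at horizon \<open>t\<close>:
      \<open>J 1\<close> belongs to \<eta>, \<open>J (1 + \<delta>)\<close> to the bandit started
      with the extra time \<delta>.\<close>
    define J where "J = (\<lambda>t. s * L + (\<Sum>k<K. s * w k * refl_val a (y k) t (\<beta> - c)))"
    have lim_close: "\<bar>?lim - J 1\<bar> \<le> \<epsilon>"
    proof -
      have ii: "integrable N (\<lambda>\<omega>. indicator {- y k..y k} (\<eta> \<omega> - c) :: real)" for k
        using bandit_distributed_interval(1)[OF N \<eta>, of "y k"] y[of k] by simp
      have ei: "N.expectation (\<lambda>\<omega>. indicator {- y k..y k} (\<eta> \<omega> - c)) = refl_val a (y k) 1 (\<beta> - c)" for k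
        using bandit_distributed_interval(2)[OF N \<eta>, of "y k"] y[of k] by simp
      have "\<bar>?lim - N.expectation (\<lambda>\<omega>. s * L + (\<Sum>k<K. s * w k * indicator {- y k..y k} (\<eta> \<omega> - c)))\<bar> \<le> \<epsilon>"
      proof (rule N.expectation_close)
        show "integrable N (\<lambda>\<omega>. \<phi> (\<eta> \<omega>))" using B by (intro N.integrable_const_bound[of _ B]) auto
        show "integrable N (\<lambda>\<omega>. s * L + (\<Sum>k<K. s * w k * indicator {- y k..y k} (\<eta> \<omega> - c)))"
          by (intro Bochner_Integration.integrable_add Bochner_Integration.integrable_sum integrable_mult_right ii) simp
        show "\<bar>\<phi> (\<eta> \<omega>) - (s * L + (\<Sum>k<K. s * w k * indicator {- y k..y k} (\<eta> \<omega> - c)))\<bar> \<le> \<epsilon>" for \<omega>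
          unfolding flip by (rule ap1)
      qed
      also have "N.expectation (\<lambda>\<omega>. s * L + (\<Sum>k<K. s * w k * indicator {- y k..y k} (\<eta> \<omega> - c))) = J 1"
      proof -
        have "N.expectation (\<lambda>\<omega>. u + (\<Sum>k<K. v k * F k \<omega>)) = u + (\<Sum>k<K. v k * N.expectation (F k))"
          if "\<And>k. integrable N (F k)" for u v and F :: "nat \<Rightarrow> 'b \<Rightarrow> real"
          using that by (simp add: N.prob_space)
        from this[OF ii] show ?thesis by (simp only: J_def ei)
      qed
      finally show ?thesis .
    qed
    have "((\<lambda>\<delta>. J (1 + \<delta>)) \<longlongrightarrow> J 1) (at_right 0)"
      unfolding J_def by (intro tendsto_intros refl_val_tendsto_time)
    then have "\<forall>\<^sub>F \<delta> in at_right 0. dist (J (1 + \<delta>)) (J 1) < \<epsilon>" using \<epsilon> by (rule tendstoD)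
    moreover have "\<forall>\<^sub>F \<delta> in at_right (0::real). \<delta> > 0" by (rule eventually_at_right_less)
    ultimately have "\<forall>\<^sub>F \<delta> in at_right 0. \<delta> > 0 \<and> dist (J (1 + \<delta>)) (J 1) < \<epsilon> \<and>
        (\<forall>x. \<bar>\<psi> \<bar>x\<bar> - (L + (\<Sum>k<K. w k * refl_val a (y k) \<delta> x))\<bar> \<le> 3 * \<epsilon>)"
      using ap2 by eventually_elim auto
    \<comment> \<open>\<delta> is fixed here, before \<open>n\<close> grows, because the constants
      \<open>C k\<close> depend on it.\<close>
    then obtain \<delta> where \<delta>: "\<delta> > 0" and J\<delta>: "\<bar>J (1 + \<delta>) - J 1\<bar> < \<epsilon>"
      and ap\<delta>: "\<And>x. \<bar>\<psi> \<bar>x\<bar> - (L + (\<Sum>k<K. w k * refl_val a (y k) \<delta> x))\<bar> \<le> 3 * \<epsilon>"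
      using eventually_happens'[of "at_right (0::real)"] by (auto simp: dist_real_def)
    define V where "V = (\<lambda>k \<theta> n. expectation (\<lambda>\<omega>. refl_val a (y k) \<delta> (T_stat M \<sigma> WL WR \<theta> n n \<omega> - c)))"
    have "\<forall>k. \<exists>C>0. (\<forall>\<theta> n v. nonanticipating \<theta> \<longrightarrow> n \<ge> 1 \<longrightarrow> a * v \<le> 0 \<longrightarrow>
        v * V k \<theta> n \<le> v * refl_val a (y k) (1 + \<delta>) (\<beta> - c) + \<bar>v\<bar> * C * (step_error \<bar>a\<bar> n + 1 / n)) \<and>
      (\<forall>n\<ge>1. \<bar>V k (threshold_strategy M \<sigma> WL WR \<mu>u \<mu>l n c) n - refl_val a (y k) (1 + \<delta>) (\<beta> - c)\<bar>
        \<le> C * (step_error \<bar>a\<bar> n + 1 / n))"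
    proof
      fix k
      show "\<exists>C>0. (\<forall>\<theta> n v. nonanticipating \<theta> \<longrightarrow> n \<ge> 1 \<longrightarrow> a * v \<le> 0 \<longrightarrow>
        v * V k \<theta> n \<le> v * refl_val a (y k) (1 + \<delta>) (\<beta> - c) + \<bar>v\<bar> * C * (step_error \<bar>a\<bar> n + 1 / n)) \<and>
      (\<forall>n\<ge>1. \<bar>V k (threshold_strategy M \<sigma> WL WR \<mu>u \<mu>l n c) n - refl_val a (y k) (1 + \<delta>) (\<beta> - c)\<bar>
        \<le> C * (step_error \<bar>a\<bar> n + 1 / n))"
        by (rule refl_val_final[OF \<delta> less_imp_le[OF y[of k]] \<mu>(1,2), of c]) (use \<mu>(3) in \<open>unfold V_def, blast\<close>)
    qed
    then obtain C where C0: "\<And>k. C k > 0" and C1: "\<And>k \<theta> n v. nonanticipating \<theta> \<Longrightarrow> n \<ge> 1 \<Longrightarrow> a * v \<le> 0 \<Longrightarrow>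
        v * V k \<theta> n \<le> v * refl_val a (y k) (1 + \<delta>) (\<beta> - c) + \<bar>v\<bar> * C k * (step_error \<bar>a\<bar> n + 1 / n)"
      and C2: "\<And>k n. n \<ge> 1 \<Longrightarrow> \<bar>V k (threshold_strategy M \<sigma> WL WR \<mu>u \<mu>l n c) n - refl_val a (y k) (1 + \<delta>) (\<beta> - c)\<bar>
        \<le> C k * (step_error \<bar>a\<bar> n + 1 / n)"
      by metis
    define err where "err = (\<lambda>n. \<Sum>k<K. w k * C k * (step_error \<bar>a\<bar> n + 1 / real n))"
    have "err \<longlonglongrightarrow> (\<Sum>k<K. w k * C k * (0 + 0))"
      unfolding err_def by (intro tendsto_intros step_error_tendsto_0 lim_inverse_n' abs_ge_zero)
    then have err0: "\<forall>\<^sub>F n in sequentially. err n < \<epsilon>"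
      using \<epsilon> by (intro order_tendstoD(2)[of err]) auto
    have E\<phi>: "\<bar>expectation (\<lambda>\<omega>. \<phi> (T_stat M \<sigma> WL WR \<theta> n n \<omega>)) - (s * L + (\<Sum>k<K. s * w k * V k \<theta> n))\<bar> \<le> 3 * \<epsilon>"
      if \<theta>: "nonanticipating \<theta>" for \<theta> n
    proof -
      have iV: "integrable M (\<lambda>\<omega>. refl_val a (y k) \<delta> (T_stat M \<sigma> WL WR \<theta> n n \<omega> - c))" for k
      proof -
        have "continuous_on UNIV (refl_val a (y k) \<delta>)"
          by (rule DERIV_continuous_on[where D = "refl_val1 a (y k) \<delta>"])
            (use refl_val_has_real_derivative[OF \<delta>] in simp)
        note [measurable] = borel_measurable_continuous_onI[OF this] TM[OF \<theta>]
        show ?thesis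
          using refl_val_0_1[OF \<delta> less_imp_le[OF y[of k]]] by (intro integrable_const_bound[of _ 1]) auto
      qed
      have "\<bar>expectation (\<lambda>\<omega>. \<phi> (T_stat M \<sigma> WL WR \<theta> n n \<omega>)) -
          expectation (\<lambda>\<omega>. s * L + (\<Sum>k<K. s * w k * refl_val a (y k) \<delta> (T_stat M \<sigma> WL WR \<theta> n n \<omega> - c)))\<bar> \<le> 3 * \<epsilon>"
      proof (rule expectation_close[OF i\<phi>[OF \<theta>]])
        show "integrable M (\<lambda>\<omega>. s * L + (\<Sum>k<K. s * w k * refl_val a (y k) \<delta> (T_stat M \<sigma> WL WR \<theta> n n \<omega> - c)))"
          by (intro Bochner_Integration.integrable_add Bochner_Integration.integrable_sum integrable_mult_right iV) simp
        show "\<bar>\<phi> (T_stat M \<sigma> WL WR \<theta> n n \<omega>) - (s * L + (\<Sum>k<K. s * w k *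
            refl_val a (y k) \<delta> (T_stat M \<sigma> WL WR \<theta> n n \<omega> - c)))\<bar> \<le> 3 * \<epsilon>" for \<omega>
          unfolding flip by (rule ap\<delta>)
      qed
      also have "expectation (\<lambda>\<omega>. s * L + (\<Sum>k<K. s * w k * refl_val a (y k) \<delta> (T_stat M \<sigma> WL WR \<theta> n n \<omega> - c)))
          = s * L + (\<Sum>k<K. s * w k * V k \<theta> n)"
        using iV by (simp add: V_def prob_space)
      finally show ?thesis .
    qed
    from err0 eventually_ge_at_top[of 1] show ?thesis
    proof eventually_elim
      case (elim n)
      have thr: "\<bar>?thr n - ?lim\<bar> \<le> 6 * \<epsilon>"
      proof -
        let ?\<theta> = "threshold_strategy M \<sigma> WL WR \<mu>u \<mu>l n c"
        have "\<bar>(\<Sum>k<K. s * w k * V k ?\<theta> n) - (\<Sum>k<K. s * w k * refl_val a (y k) (1 + \<delta>) (\<beta> - c))\<bar> \<le> err n"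
          unfolding sum_subtractf[symmetric] err_def
        proof (rule order_trans[OF sum_abs], rule sum_mono)
          fix k
          have "\<bar>s * w k * V k ?\<theta> n - s * w k * refl_val a (y k) (1 + \<delta>) (\<beta> - c)\<bar> =
              w k * \<bar>V k ?\<theta> n - refl_val a (y k) (1 + \<delta>) (\<beta> - c)\<bar>"
            using w[of k] by (simp add: abs_mult abs_s flip: right_diff_distrib)
          also have "\<dots> \<le> w k * (C k * (step_error \<bar>a\<bar> n + 1 / n))"
            by (rule mult_left_mono[OF C2[OF elim(2)] w])
          finally show "\<bar>s * w k * V k ?\<theta> n - s * w k * refl_val a (y k) (1 + \<delta>) (\<beta> - c)\<bar>
              \<le> w k * C k * (step_error \<bar>a\<bar> n + 1 / n)" by (simp add: mult.assoc)
        qed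
        then show ?thesis
          using E\<phi>[OF nonanticipating_threshold, of \<mu>u \<mu>l n c n] lim_close J\<delta> elim(1) unfolding J_def by linarith
      qed
      moreover have "expectation (\<lambda>\<omega>. \<phi> (T_stat M \<sigma> WL WR \<theta> n n \<omega>)) \<le> ?lim + 6 * \<epsilon>"
        if \<theta>: "nonanticipating \<theta>" for \<theta>
      proof -
        have "(\<Sum>k<K. s * w k * V k \<theta> n) \<le> (\<Sum>k<K. s * w k * refl_val a (y k) (1 + \<delta>) (\<beta> - c)
            + w k * C k * (step_error \<bar>a\<bar> n + 1 / n))"
        proof (rule sum_mono)
          fix k
          \<comment> \<open>Here the direction of monotonicity of \<phi>, encoded in
            \<open>s\<close>, meets the order of the means, encoded in the sign of
            \<open>a\<close>.\<close>
          have "a * (s * w k) \<le> 0" using mult_nonpos_nonneg[OF as w[of k]] by (simp add: mult.assoc)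
          from C1[OF \<theta> elim(2) this, of k]
          show "s * w k * V k \<theta> n \<le> s * w k * refl_val a (y k) (1 + \<delta>) (\<beta> - c)
            + w k * C k * (step_error \<bar>a\<bar> n + 1 / n)"
            using w[of k] by (simp add: abs_mult abs_s)
        qed
        then show ?thesis
          using E\<phi>[OF \<theta>, of n] lim_close J\<delta> elim(1) unfolding J_def err_def sum.distrib by linarith
      qed
      ultimately show ?case by blast
    qed
  qed
  have lims: "\<forall>\<^sub>F n in sequentially. dist (?thr n) ?lim < e \<and> dist (?sup n) ?lim < e" if e: "e > 0" for e
  proof -
    \<comment> \<open>Six sevenths of \<open>e\<close> leave the strict inequality that convergence
      asks for.\<close>
    from e have "e / 7 > 0" by simp
    from core[OF this] show ?thesis
    proof eventually_elim
      case (elim n)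
      let ?\<theta> = "threshold_strategy M \<sigma> WL WR \<mu>u \<mu>l n c"
      have mem: "?\<theta> \<in> admissible_strategies M WL WR"
        by (simp add: admissible_iff nonanticipating_threshold)
      \<comment> \<open>The threshold strategy is itself admissible, so the supremum is squeezed
        between its value and the uniform upper bound.\<close>
      have "?thr n \<le> ?sup n"
        using b\<phi> by (intro cSUP_upper mem) (auto simp: admissible_iff intro!: bdd_aboveI2)
      moreover have "?sup n \<le> ?lim + 6 * (e / 7)"
        using mem elim by (intro cSUP_least) (auto simp: admissible_iff)
      ultimately show ?case using elim e unfolding dist_real_def by linarith
    qed
  qed
  show "?thr \<longlonglongrightarrow> ?lim" "?sup \<longlonglongrightarrow> ?lim"
    by (rule tendstoI, drule lims, simp add: eventually_conj_iff)+
qed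

end

theorem theorem3p3:
  fixes M :: "'a measure" and N :: "'b measure"
    and XL XR :: "'a \<Rightarrow> real" and WL WR :: "nat \<Rightarrow> 'a \<Rightarrow> real"
    and \<mu>L \<mu>R \<mu>u \<mu>l \<sigma> c :: real
    and \<phi> :: "real \<Rightarrow> real"
    and \<eta>1 \<eta>2 :: "'b \<Rightarrow> real"
  assumes "prob_space M"
    and "integrable M XL" and "integrable M (\<lambda>\<omega>. (XL \<omega>)\<^sup>2)"
    and "integrable M XR" and "integrable M (\<lambda>\<omega>. (XR \<omega>)\<^sup>2)"
    and "\<mu>L = prob_space.expectation M XL" and "\<mu>R = prob_space.expectation M XR"
    and "\<sigma> > 0"
    and "prob_space.variance M XL = \<sigma>\<^sup>2" and "prob_space.variance M XR = \<sigma>\<^sup>2"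
    and "\<And>i. i \<ge> 1 \<Longrightarrow> distr M borel (WL i) = distr M borel XL"
    and "\<And>i. i \<ge> 1 \<Longrightarrow> distr M borel (WR i) = distr M borel XR"
    and "prob_space.indep_vars M (\<lambda>_. borel) WL {1..}"
    and "prob_space.indep_vars M (\<lambda>_. borel) WR {1..}"
    and "prob_space.indep_var M
           (PiM {1..} (\<lambda>_. borel)) (\<lambda>\<omega>. \<lambda>i\<in>{1..}. WL i \<omega>)
           (PiM {1..} (\<lambda>_. borel)) (\<lambda>\<omega>. \<lambda>i\<in>{1..}. WR i \<omega>)"
    and "\<mu>u = max \<mu>L \<mu>R" and "\<mu>l = min \<mu>L \<mu>R"
    and "continuous_on UNIV \<phi>"
    and "\<exists>l. (\<phi> \<longlongrightarrow> l) at_top" and "\<exists>l. (\<phi> \<longlongrightarrow> l) at_bot"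
    and "\<And>x. \<phi> (x + c) = \<phi> (- x + c)"
    and "prob_space N"
  shows
    "(antimono_on {c<..} \<phi> \<and> (\<mu>L, \<mu>R) = (\<mu>u, \<mu>l)
        \<and> bandit_distributed N \<eta>1 ((\<mu>l - \<mu>u) / 2) ((\<mu>u + \<mu>l) / 2) c \<longrightarrow>
      (\<lambda>n. prob_space.expectation M
             (\<lambda>\<omega>. \<phi> (T_stat M \<sigma> WL WR (threshold_strategy M \<sigma> WL WR \<mu>u \<mu>l n c) n n \<omega>)))
        \<longlonglongrightarrow> prob_space.expectation N (\<lambda>\<omega>. \<phi> (\<eta>1 \<omega>))
      \<and>
      (\<lambda>n. SUP \<theta>\<in>admissible_strategies M WL WR.
             prob_space.expectation M (\<lambda>\<omega>. \<phi> (T_stat M \<sigma> WL WR \<theta> n n \<omega>)))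
        \<longlonglongrightarrow> prob_space.expectation N (\<lambda>\<omega>. \<phi> (\<eta>1 \<omega>)))
     \<and>
     (mono_on {c<..} \<phi> \<and> (\<mu>L, \<mu>R) = (\<mu>l, \<mu>u)
        \<and> bandit_distributed N \<eta>2 ((\<mu>u - \<mu>l) / 2) ((\<mu>u + \<mu>l) / 2) c \<longrightarrow>
      (\<lambda>n. prob_space.expectation M
             (\<lambda>\<omega>. \<phi> (T_stat M \<sigma> WL WR (threshold_strategy M \<sigma> WL WR \<mu>u \<mu>l n c) n n \<omega>)))
        \<longlonglongrightarrow> prob_space.expectation N (\<lambda>\<omega>. \<phi> (\<eta>2 \<omega>))
      \<and>
      (\<lambda>n. SUP \<theta>\<in>admissible_strategies M WL WR.
             prob_space.expectation M (\<lambda>\<omega>. \<phi> (T_stat M \<sigma> WL WR \<theta> n n \<omega>)))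
        \<longlonglongrightarrow> prob_space.expectation N (\<lambda>\<omega>. \<phi> (\<eta>2 \<omega>)))"
proof -
  interpret two_armed_bandit M XL XR WL WR \<mu>L \<mu>R \<sigma>
    using assms unfolding two_armed_bandit_def two_armed_bandit_axioms_def by blast
  obtain l where lim: "(\<phi> \<longlongrightarrow> l) at_top" using assms by blast
  note opt = asymptotically_optimal[OF _ _ _ \<open>prob_space N\<close> _ \<open>continuous_on UNIV \<phi>\<close> lim
      \<open>\<And>x. \<phi> (x + c) = \<phi> (- x + c)\<close>]
  \<comment> \<open>Arm 1 has drift -a relative to the average of the means: a \<le> 0 if the left
    arm is the better one, a \<ge> 0 in \<open>2\<close>. The same rule thus drives the statistic
    towards \<open>c\<close> in the first case and away from it in the second.\<close>
  have 1: "\<mu>L = (\<mu>u + \<mu>l) / 2 - (\<mu>l - \<mu>u) / 2" "\<mu>R = (\<mu>u + \<mu>l) / 2 + (\<mu>l - \<mu>u) / 2"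
    if "(\<mu>L, \<mu>R) = (\<mu>u, \<mu>l)" using that by (auto simp: field_simps)
  have 2: "\<mu>L = (\<mu>u + \<mu>l) / 2 - (\<mu>u - \<mu>l) / 2" "\<mu>R = (\<mu>u + \<mu>l) / 2 + (\<mu>u - \<mu>l) / 2"
    if "(\<mu>L, \<mu>R) = (\<mu>l, \<mu>u)" using that by (auto simp: field_simps)
  have ul: "\<mu>l \<le> \<mu>u" using assms by simp
  have a1: "antimono_on {c<..} (\<lambda>x. 1 * \<phi> x)" if "antimono_on {c<..} \<phi>" using that by simp
  have a2: "antimono_on {c<..} (\<lambda>x. - 1 * \<phi> x)" if "mono_on {c<..} \<phi>"
    using that by (auto simp: monotone_on_def)
  show ?thesis
  proof (intro conjI impI; elim conjE)
    assume a: "antimono_on {c<..} \<phi>" "(\<mu>L, \<mu>R) = (\<mu>u, \<mu>l)"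
      "bandit_distributed N \<eta>1 ((\<mu>l - \<mu>u) / 2) ((\<mu>u + \<mu>l) / 2) c"
    show "(\<lambda>n. prob_space.expectation M
             (\<lambda>\<omega>. \<phi> (T_stat M \<sigma> WL WR (threshold_strategy M \<sigma> WL WR \<mu>u \<mu>l n c) n n \<omega>)))
        \<longlonglongrightarrow> prob_space.expectation N (\<lambda>\<omega>. \<phi> (\<eta>1 \<omega>))"
      by (rule opt(1)[OF 1[OF a(2)] refl a(3) _ a1[OF a(1)]]) (use ul in auto)
    show "(\<lambda>n. SUP \<theta>\<in>admissible_strategies M WL WR.
             prob_space.expectation M (\<lambda>\<omega>. \<phi> (T_stat M \<sigma> WL WR \<theta> n n \<omega>)))
        \<longlonglongrightarrow> prob_space.expectation N (\<lambda>\<omega>. \<phi> (\<eta>1 \<omega>))"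
      by (rule opt(2)[OF 1[OF a(2)] refl a(3) _ a1[OF a(1)]]) (use ul in auto)
  next
    assume a: "mono_on {c<..} \<phi>" "(\<mu>L, \<mu>R) = (\<mu>l, \<mu>u)"
      "bandit_distributed N \<eta>2 ((\<mu>u - \<mu>l) / 2) ((\<mu>u + \<mu>l) / 2) c"
    show "(\<lambda>n. prob_space.expectation M
             (\<lambda>\<omega>. \<phi> (T_stat M \<sigma> WL WR (threshold_strategy M \<sigma> WL WR \<mu>u \<mu>l n c) n n \<omega>)))
        \<longlonglongrightarrow> prob_space.expectation N (\<lambda>\<omega>. \<phi> (\<eta>2 \<omega>))"
      by (rule opt(1)[OF 2[OF a(2)] refl a(3) _ a2[OF a(1)]]) (use ul in auto)
    show "(\<lambda>n. SUP \<theta>\<in>admissible_strategies M WL WR.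
             prob_space.expectation M (\<lambda>\<omega>. \<phi> (T_stat M \<sigma> WL WR \<theta> n n \<omega>)))
        \<longlonglongrightarrow> prob_space.expectation N (\<lambda>\<omega>. \<phi> (\<eta>2 \<omega>))"
      by (rule opt(2)[OF 2[OF a(2)] refl a(3) _ a2[OF a(1)]]) (use ul in auto)
  qed
qed

end
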